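(* Let $\omega\subset\mathbb R^{d-1}$ be a bounded Lipschitz domain, $M>0$, $1<p<\infty$, $\Omega=\omega\times(-1,M+1)$, and $u_0\in W^{1,p}(\omega\times(-1,0);\mathbb R^d)$. Let $f\colon\mathbb M^{d\times d}\to[0,\infty)$ be convex with $f(0)=0$ and $c_1|\zeta^T+\zeta|^p\le f(\zeta)\le c_2(|\zeta^T+\zeta|^p+1)$ for all $\zeta$ (with constants $c_1,c_2>0$). Let $G\colon L^0(\Omega;\mathbb R^d)\times L^1(\omega;[0,M])\to\mathbb R\cup\{+\infty\}$ be $$G(u,h)=\int_{\Omega_h^+}f(e(u))\,dx+\int_\omega\sqrt{1+|\nabla h(x')|^2}\,dx'$$ if $h\in C^1(\omega;[0,M])$, $u|_{\Omega_h}\in W^{1,p}(\Omega_h;\mathbb R^d)$, $u=0$ in $\Omega\setminus\Omega_h$ and $u=u_0$ in $\omega\times(-1,0)$, and $G(u,h)=+\infty$ otherwise, and let $\overline G$ be its lower semicontinuous envelope, $$\overline G(u,h)=\inf\big\{\liminf_{n\to\infty}G(u_n,h_n)\colon u_n\to u\text{ in }L^0(\Omega;\mathbb R^d),\ h_n\to h\text{ in }L^1(\omega)\big\}.$$ Then, given $0<m<M\,\mathcal H^{d-1}(\omega)$, the minimization problem $$\inf\Big\{\overline G(u,h)\colon(u,h)\in L^0(\Omega;\mathbb R^d)\times L^1(\omega;[0,M]),\ \mathcal L^d(\Omega_h^+)=m\Big\}$$ admits solutions.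
   Context: Write $x=(x',x_d)\in\mathbb R^{d-1}\times\mathbb R$. For measurable $h\colon\omega\to[0,M]$: $\Omega_h=\{x\in\omega\times\mathbb R\colon-1<x_d<h(x')\}$ and $\Omega_h^+=\{x\in\omega\times\mathbb R\colon0<x_d<h(x')\}$, so $\mathcal L^d(\Omega_h^+)=\int_\omega h\,dx'$. $\mathbb M^{d\times d}$ is the space of real $d\times d$ matrices; $L^0(\Omega;\mathbb R^d)$ is the space of $\mathcal L^d$-measurable functions $\Omega\to\mathbb R^d$ with the topology of convergence in measure. For Sobolev $u$, $e(u)=\frac12((\nabla u)^T+\nabla u)$. *)

theory Defs
  imports "HOL-Analysis.Analysis"
begin

section \<open>Lipschitz domains\<close>

text \<open>Near each boundary point, \<open>U\<close> is the strict epigraph, in some unit direction \<open>\<nu>\<close>, of a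
  Lipschitz function on the hyperplane orthogonal to \<open>\<nu>\<close>; \<open>x - (x \<bullet> \<nu>) *\<^sub>R \<nu>\<close> is the
  projection onto that hyperplane.\<close>

definition lipschitz_boundary :: "'a::euclidean_space set \<Rightarrow> bool" where
  "lipschitz_boundary U \<longleftrightarrow>
     (\<forall>z\<in>frontier U. \<exists>r>0. \<exists>\<nu> L \<gamma>. norm \<nu> = 1 \<and> L-lipschitz_on {y. y \<bullet> \<nu> = 0} \<gamma> \<and>
        U \<inter> ball z r = {x \<in> ball z r. \<gamma> (x - (x \<bullet> \<nu>) *\<^sub>R \<nu>) < x \<bullet> \<nu>})"

definition lipschitz_domain :: "'a::euclidean_space set \<Rightarrow> bool" where
  "lipschitz_domain U \<longleftrightarrow> open U \<and> connected U \<and> U \<noteq> {} \<and> lipschitz_boundary U"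


section \<open>Sobolev spaces on open subsets of Euclidean space\<close>

fun k_smooth :: "nat \<Rightarrow> ('a::euclidean_space \<Rightarrow> real) \<Rightarrow> bool" where
  "k_smooth 0 \<phi> \<longleftrightarrow> continuous_on UNIV \<phi>"
| "k_smooth (Suc k) \<phi> \<longleftrightarrow> (\<forall>x. \<phi> differentiable (at x)) \<and>
     (\<forall>b\<in>Basis. k_smooth k (\<lambda>x. frechet_derivative \<phi> (at x) b))"

definition test_functions :: "'a::euclidean_space set \<Rightarrow> ('a \<Rightarrow> real) set" where
  "test_functions U = {\<phi>. (\<forall>k. k_smooth k \<phi>) \<and>
     compact (closure {x. \<phi> x \<noteq> 0}) \<and> closure {x. \<phi> x \<noteq> 0} \<subseteq> U}"

definition locally_integrable_on ::
    "('a::euclidean_space \<Rightarrow> 'b::{banach, second_countable_topology}) \<Rightarrow> 'a set \<Rightarrow> bool" where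
  "locally_integrable_on u U \<longleftrightarrow>
     (\<forall>K. compact K \<and> K \<subseteq> U \<longrightarrow> integrable (lebesgue_on K) u)"

definition Lp_on ::
    "real \<Rightarrow> 'a::euclidean_space set \<Rightarrow> ('a \<Rightarrow> 'b::{banach, second_countable_topology}) set" where
  "Lp_on p U = {u. u \<in> borel_measurable (lebesgue_on U) \<and>
     integrable (lebesgue_on U) (\<lambda>x. norm (u x) powr p)}"

text \<open>The entry \<open>D x $ i $ j\<close> is the weak partial derivative in direction \<open>j\<close> of the component \<open>i\<close>.\<close>

definition has_weak_gradient ::
    "(real^'d \<Rightarrow> real^'m) \<Rightarrow> (real^'d \<Rightarrow> real^'d^'m) \<Rightarrow> (real^'d) set \<Rightarrow> bool" where
  "has_weak_gradient u D U \<longleftrightarrow> locally_integrable_on u U \<and> locally_integrable_on D U \<and>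
     (\<forall>\<phi>\<in>test_functions U. \<forall>i j.
        (LINT x|lebesgue_on U. u x $ i * frechet_derivative \<phi> (at x) (axis j 1)) =
        - (LINT x|lebesgue_on U. D x $ i $ j * \<phi> x))"

definition sobolev :: "real \<Rightarrow> (real^'d) set \<Rightarrow> (real^'d \<Rightarrow> real^'m) set" where
  "sobolev p U = {u \<in> Lp_on p U. \<exists>D \<in> Lp_on p U. has_weak_gradient u D U}"

text \<open>Weak gradients are unique up to null sets, so the choice only selects a representative.\<close>

definition weak_gradient :: "(real^'d) set \<Rightarrow> (real^'d \<Rightarrow> real^'m) \<Rightarrow> real^'d \<Rightarrow> real^'d^'m" where
  "weak_gradient U u = (SOME D. has_weak_gradient u D U)"

definition sym_gradient :: "(real^'d) set \<Rightarrow> (real^'d \<Rightarrow> real^'d) \<Rightarrow> real^'d \<Rightarrow> real^'d^'d" where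
  "sym_gradient U u x = (1/2) *\<^sub>R (transpose (weak_gradient U u x) + weak_gradient U u x)"


section \<open>Convergence in measure and in the mean\<close>

definition L0_on :: "'a::euclidean_space set \<Rightarrow> ('a \<Rightarrow> 'b::euclidean_space) set" where
  "L0_on U = borel_measurable (lebesgue_on U)"

definition tends_in_measure_on ::
    "'a::euclidean_space set \<Rightarrow> (nat \<Rightarrow> 'a \<Rightarrow> 'b::euclidean_space) \<Rightarrow> ('a \<Rightarrow> 'b) \<Rightarrow> bool" where
  "tends_in_measure_on U us u \<longleftrightarrow>
     (\<forall>\<epsilon>>0. (\<lambda>n. emeasure lebesgue {x \<in> U. \<epsilon> \<le> norm (us n x - u x)}) \<longlonglongrightarrow> 0)"

definition L1_range_on :: "'a::euclidean_space set \<Rightarrow> real \<Rightarrow> ('a \<Rightarrow> real) set" where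
  "L1_range_on \<omega> M = {h. integrable (lebesgue_on \<omega>) h \<and> h ` \<omega> \<subseteq> {0..M}}"

definition tends_L1_on ::
    "'a::euclidean_space set \<Rightarrow> (nat \<Rightarrow> 'a \<Rightarrow> real) \<Rightarrow> ('a \<Rightarrow> real) \<Rightarrow> bool" where
  "tends_L1_on \<omega> hs h \<longleftrightarrow> (\<lambda>n. LINT x|lebesgue_on \<omega>. \<bar>hs n x - h x\<bar>) \<longlonglongrightarrow> 0"


section \<open>Continuously differentiable functions\<close>

definition gradient :: "(real^'n \<Rightarrow> real) \<Rightarrow> real^'n \<Rightarrow> real^'n" where
  "gradient h x = (\<chi> j. frechet_derivative h (at x) (axis j 1))"

text \<open>Used for open \<open>\<omega>\<close> only.  No regularity or boundedness up to the boundary is required.\<close>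

definition C1_range_on :: "(real^'n) set \<Rightarrow> real \<Rightarrow> (real^'n \<Rightarrow> real) set" where
  "C1_range_on \<omega> M = {h. (\<forall>x\<in>\<omega>. h differentiable (at x)) \<and> continuous_on \<omega> (gradient h) \<and>
     h ` \<omega> \<subseteq> {0..M}}"


section \<open>Subgraphs\<close>

text \<open>With \<open>d = CARD('n) + 1\<close>, points of \<open>d\<close>-dimensional space are indexed by \<open>'n option\<close>: the
  coordinates \<open>Some j\<close> form \<open>x'\<close>, and \<open>None\<close> indexes the last coordinate \<open>x_d\<close>.\<close>

definition horiz :: "real^('n::finite option) \<Rightarrow> real^'n" where
  "horiz x = (\<chi> j. x $ Some j)"

definition height :: "real^('n::finite option) \<Rightarrow> real" where
  "height x = x $ None"

definition cylinder :: "(real^'n) set \<Rightarrow> real \<Rightarrow> real \<Rightarrow> (real^('n::finite option)) set" where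
  "cylinder \<omega> a b = {x. horiz x \<in> \<omega> \<and> a < height x \<and> height x < b}"

definition subgraph :: "(real^'n) set \<Rightarrow> (real^'n \<Rightarrow> real) \<Rightarrow> (real^('n::finite option)) set" where
  "subgraph \<omega> h = {x. horiz x \<in> \<omega> \<and> -1 < height x \<and> height x < h (horiz x)}"

definition subgraph_pos :: "(real^'n) set \<Rightarrow> (real^'n \<Rightarrow> real) \<Rightarrow> (real^('n::finite option)) set" where
  "subgraph_pos \<omega> h = {x. horiz x \<in> \<omega> \<and> 0 < height x \<and> height x < h (horiz x)}"


section \<open>The functional and its lower semicontinuous envelope\<close>

text \<open>The integrands are nonnegative, so values are taken in \<open>[0, \<infinity>]\<close>.\<close>

type_synonym 'n field = "real^('n option) \<Rightarrow> real^('n option)"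

definition G_finite_dom ::
    "(real^'n) set \<Rightarrow> real \<Rightarrow> real \<Rightarrow> 'n::finite field \<Rightarrow> 'n field \<Rightarrow> (real^'n \<Rightarrow> real) \<Rightarrow> bool" where
  "G_finite_dom \<omega> M p u0 u h \<longleftrightarrow>
     h \<in> C1_range_on \<omega> M \<and>
     u \<in> sobolev p (subgraph \<omega> h) \<and>
     (AE x in lebesgue_on (cylinder \<omega> (-1) (M + 1) - subgraph \<omega> h). u x = 0) \<and>
     (AE x in lebesgue_on (cylinder \<omega> (-1) 0). u x = u0 x)"

text \<open>Arguments are functions rather than classes modulo null sets, and \<open>C1_range_on\<close> refers to
  \<open>h\<close> itself.  Passing to \<open>G_relaxed\<close> removes this dependence on representatives, since both
  convergences below are insensitive to null sets.\<close>

definition G_functional ::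
    "(real^'n) set \<Rightarrow> real \<Rightarrow> real \<Rightarrow> (real^('n option)^('n option) \<Rightarrow> real) \<Rightarrow> 'n::finite field \<Rightarrow>
     'n field \<Rightarrow> (real^'n \<Rightarrow> real) \<Rightarrow> ennreal" where
  "G_functional \<omega> M p f u0 u h =
     (if G_finite_dom \<omega> M p u0 u h
      then (\<integral>\<^sup>+ x. ennreal (f (sym_gradient (subgraph \<omega> h) u x)) \<partial>lebesgue_on (subgraph_pos \<omega> h))
         + (\<integral>\<^sup>+ y. ennreal (sqrt (1 + (norm (gradient h y))\<^sup>2)) \<partial>lebesgue_on \<omega>)
      else \<infinity>)"

definition G_relaxed ::
    "(real^'n) set \<Rightarrow> real \<Rightarrow> real \<Rightarrow> (real^('n option)^('n option) \<Rightarrow> real) \<Rightarrow> 'n::finite field \<Rightarrow>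
     'n field \<Rightarrow> (real^'n \<Rightarrow> real) \<Rightarrow> ennreal" where
  "G_relaxed \<omega> M p f u0 u h =
     Inf {liminf (\<lambda>n. G_functional \<omega> M p f u0 (us n) (hs n)) | us hs.
       (\<forall>n. us n \<in> L0_on (cylinder \<omega> (-1) (M + 1)) \<and> hs n \<in> L1_range_on \<omega> M) \<and>
       tends_in_measure_on (cylinder \<omega> (-1) (M + 1)) us u \<and> tends_L1_on \<omega> hs h}"

definition admissible ::
    "(real^'n) set \<Rightarrow> real \<Rightarrow> real \<Rightarrow> 'n::finite field \<Rightarrow> (real^'n \<Rightarrow> real) \<Rightarrow> bool" where
  "admissible \<omega> M m u h \<longleftrightarrow>
     u \<in> L0_on (cylinder \<omega> (-1) (M + 1)) \<and> h \<in> L1_range_on \<omega> M \<and>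
     emeasure lebesgue (subgraph_pos \<omega> h) = ennreal m"

end

theory Submission
  imports Defs "HOL-Complex_Analysis.Great_Picard"
begin

text \<open>The relaxed energy is an infimum of limits along approximating sequences, so a minimizer exists as
soon as sequences of bounded energy are compact. Choose pairs \<open>(u\<^sub>n, h\<^sub>n)\<close> whose energies
\<open>G\<close> tend to the infimum and whose volumes tend to \<open>m\<close> (\<open>G_relaxed_attained_along\<close>). If a subsequence
converges to \<open>(u, h)\<close>, then \<open>h\<close> has volume \<open>m\<close>, and the subsequence itself competes in the definition
of the relaxed energy of \<open>(u, h)\<close>, which is therefore at most the infimum. (If the infimum is infinite,
a flat film of the right volume does.) Everything rests on
\<open>epitaxy_compactness\<close>. Both compactness statements are instances of Kolmogorov's criterion
(\<open>Kolmogorov_subsequence\<close>): bounded functions whose translates are uniformly close in mean have an almost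
everywhere convergent subsequence.

For the profiles, the surface energy bounds the gradients of \<open>h\<^sub>n\<close> in mean, which controls
translations on compact subsets of \<open>\<omega>\<close> (\<open>graph_translation_small\<close>); the rest of \<open>\<omega>\<close> has small measure
and \<open>0 \<le> h\<^sub>n \<le> M\<close>.

For the displacements, the domains below the graphs have no uniform regularity, so a Korn inequality is
not at hand; it is replaced by slicing. The increment \<open>(u(x + y) - u(x)) \<bullet> y\<close> is the integral of the
quadratic form \<open>y \<bullet> e(u) y\<close> along the segment from \<open>x\<close> to \<open>x + y\<close> as long as the segment stays
below the graph (\<open>weak_gradient_difference\<close>), and hence small in measure there
(\<open>difference_along_segment_small\<close>). The points whose segment leaves the domain form a set of small measure,
because the total variation of the graph is bounded (\<open>subgraph_exit_small\<close>). Two consequences give the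
hypotheses of Kolmogorov's criterion for \<open>u/(1 + |u|)\<close>. First, the measure of the exit set is
proportional to the horizontal part of a descending displacement, so that values of \<open>u\<close> can be carried
up from the base, where \<open>u = u\<^sub>0\<close>, along nearly vertical segments in enough directions to recover
all components (\<open>subgraph_tightness\<close>). Second, knowing increments only in their own direction suffices: in
a triangle \<open>x\<close>, \<open>x + y\<close>, \<open>x + z\<close> with \<open>|y|\<close> much smaller than \<open>|z|\<close>, the two long sides
determine \<open>(u(x + y) - u(x)) \<bullet> z\<close> up to \<open>|y|\<close> times values of \<open>u\<close>
(\<open>translation_component_small\<close>).\<close>

section \<open>Sets of small outer measure\<close>

text \<open>Outer Lebesgue measure at most \<open>e\<close>. The exceptional sets below involve conditions on all points of a
segment; working with measurable covers spares every discussion of their measurability.\<close>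

definition small :: "real \<Rightarrow> 'a::euclidean_space set \<Rightarrow> bool" where
  "small e A \<longleftrightarrow> (\<exists>B\<in>sets lebesgue. A \<subseteq> B \<and> emeasure lebesgue B \<le> ennreal e)"

lemma small_mono: "small e B \<Longrightarrow> A \<subseteq> B \<Longrightarrow> e \<le> e' \<Longrightarrow> small e' A"
  unfolding small_def by (meson ennreal_leI order_trans)

lemma small_empty: "small e {}"
  unfolding small_def by (intro bexI[of _ "{}"]) auto

lemma small_Un:
  assumes "small a A" "small b B" "0 \<le> a" "0 \<le> b"
  shows "small (a + b) (A \<union> B)"
proof -
  obtain A' B' where *: "A' \<in> sets lebesgue" "A \<subseteq> A'" "emeasure lebesgue A' \<le> ennreal a"
    "B' \<in> sets lebesgue" "B \<subseteq> B'" "emeasure lebesgue B' \<le> ennreal b"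
    using assms unfolding small_def by metis
  have "emeasure lebesgue (A' \<union> B') \<le> emeasure lebesgue A' + emeasure lebesgue B'"
    using * by (intro emeasure_subadditive) auto
  also have "\<dots> \<le> ennreal (a + b)"
    using * assms by (simp add: add_mono)
  finally show ?thesis
    unfolding small_def using * by (intro bexI[of _ "A' \<union> B'"]) auto
qed

lemma small_UN:
  assumes "finite I" "\<And>i. i \<in> I \<Longrightarrow> small e (A i)" "0 \<le> e"
  shows "small (of_nat (card I) * e) (\<Union>i\<in>I. A i)"
  using assms
proof (induction I)
  case empty
  then show ?case unfolding small_def by (intro bexI[of _ "{}"]) auto
next
  case (insert i I)
  have "small (e + of_nat (card I) * e) (A i \<union> (\<Union>i\<in>I. A i))"
    using insert by (intro small_Un) auto
  then show ?case
    using insert by (simp add: algebra_simps)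
qed

lemma small_translate:
  assumes "small e A"
  shows "small e {x. x + y \<in> A}"
proof -
  obtain B where B: "B \<in> sets lebesgue" "A \<subseteq> B" "emeasure lebesgue B \<le> ennreal e"
    using assms unfolding small_def by metis
  have eq: "{x. x + y \<in> B} = (+) (-y) ` B"
    by (auto simp: image_iff algebra_simps intro!: bexI[of _ "_ + y"])
  have "(+) (-y) ` B \<in> sets lebesgue"
    using B(1) by (rule lebesgue_sets_translation)
  moreover have "emeasure lebesgue ((+) (-y) ` B) = emeasure lebesgue B"
    using emeasure_lebesgue_affine[of 1 "-y" B] by simp
  ultimately show ?thesis
    unfolding small_def using B eq by (intro bexI[of _ "(+) (-y) ` B"]) auto
qed

lemma small_AE_cong:
  assumes "AE x in lborel. P x" "small e A"
  shows "small e {x. \<not> P x \<or> x \<in> A}"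
proof -
  obtain N where N: "{x. \<not> P x} \<subseteq> N" "N \<in> sets lborel" "emeasure lborel N = 0"
    using assms(1) by (auto elim: AE_E)
  obtain B where B: "B \<in> sets lebesgue" "A \<subseteq> B" "emeasure lebesgue B \<le> ennreal e"
    using assms unfolding small_def by metis
  have "emeasure lebesgue (B \<union> N) \<le> emeasure lebesgue B + emeasure lebesgue N"
    using B N by (intro emeasure_subadditive) auto
  also have "\<dots> \<le> ennreal e"
    using B N by simp
  finally show ?thesis
    unfolding small_def using N B by (intro bexI[of _ "B \<union> N"]) auto
qed

lemma small_markov:
  fixes g :: "'a::euclidean_space \<Rightarrow> ennreal"
  assumes [measurable]: "g \<in> borel_measurable borel"
    and "(\<integral>\<^sup>+x. g x \<partial>lborel) \<le> ennreal I" "0 < \<delta>" "0 \<le> I"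
  shows "small (I / \<delta>) {x. ennreal \<delta> \<le> g x}"
proof -
  have m: "{x. ennreal \<delta> \<le> g x} \<in> sets borel"
    by measurable
  have "ennreal \<delta> * emeasure lborel {x. ennreal \<delta> \<le> g x} = (\<integral>\<^sup>+x. ennreal \<delta> * indicator {x. ennreal \<delta> \<le> g x} x \<partial>lborel)"
    by (subst nn_integral_cmult_indicator) auto
  also have "\<dots> \<le> (\<integral>\<^sup>+x. g x \<partial>lborel)"
    by (intro nn_integral_mono) (auto simp: indicator_def)
  also have "\<dots> \<le> ennreal I" by fact
  finally have "ennreal (1/\<delta>) * (ennreal \<delta> * emeasure lborel {x. ennreal \<delta> \<le> g x}) \<le> ennreal (1/\<delta>) * ennreal I"
    by (intro mult_left_mono) auto
  also have "ennreal (1/\<delta>) * (ennreal \<delta> * emeasure lborel {x. ennreal \<delta> \<le> g x}) = emeasure lborel {x. ennreal \<delta> \<le> g x}"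
    using assms(3) by (simp flip: mult.assoc ennreal_mult)
  also have "ennreal (1/\<delta>) * ennreal I = ennreal (I / \<delta>)"
    using assms by (simp flip: ennreal_mult)
  finally show ?thesis
    unfolding small_def using m by (intro bexI[of _ "{x. ennreal \<delta> \<le> g x}"]) auto
qed

text \<open>The measure of an increasing union of intersections of covers is a supremum, hence still at
most \<open>e\<close>. With \<open>e\<close> arbitrary, this turns uniform tightness into almost everywhere finiteness of a limit.\<close>

lemma small_liminf:
  assumes "\<And>i::nat. small e (A i)"
  shows "small e {x. \<forall>\<^sub>F i in sequentially. x \<in> A i}"
proof -
  have "\<exists>B. \<forall>i. B i \<in> sets lebesgue \<and> A i \<subseteq> B i \<and> emeasure lebesgue (B i) \<le> ennreal e"
    using assms unfolding small_def Bex_def by (intro choice allI)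
  then obtain B where B: "\<And>i. B i \<in> sets lebesgue" "\<And>i. A i \<subseteq> B i" "\<And>i. emeasure lebesgue (B i) \<le> ennreal e"
    by blast
  define C where "C k = (\<Inter>i\<in>{k..}. B i)" for k
  have C: "C k \<in> sets lebesgue" for k unfolding C_def using B(1) by (intro sets.countable_INT') auto
  have inc: "incseq C" unfolding incseq_def C_def by (intro allI impI INF_superset_mono) auto
  have le: "emeasure lebesgue (C k) \<le> ennreal e" for k
  proof -
    have "emeasure lebesgue (C k) \<le> emeasure lebesgue (B k)"
      using B(1) by (intro emeasure_mono) (auto simp: C_def)
    then show ?thesis using B(3) order_trans by blast
  qed
  have "emeasure lebesgue (\<Union>k. C k) = (SUP k. emeasure lebesgue (C k))"
    using C inc by (intro SUP_emeasure_incseq[symmetric]) auto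
  also have "\<dots> \<le> ennreal e" using le by (intro SUP_least)
  finally have "emeasure lebesgue (\<Union>k. C k) \<le> ennreal e" .
  moreover have "{x. \<forall>\<^sub>F i in sequentially. x \<in> A i} \<subseteq> (\<Union>k. C k)"
    using B(2) unfolding C_def eventually_sequentially by blast
  moreover have "(\<Union>k. C k) \<in> sets lebesgue" using C by auto
  ultimately show ?thesis unfolding small_def by blast
qed

lemma AE_of_small_complement:
  assumes "\<And>e. 0 < e \<Longrightarrow> small e {x. \<not> P x}"
  shows "AE x in lborel. P x"
proof -
  have "\<exists>B. B \<in> sets lebesgue \<and> {x. \<not> P x} \<subseteq> B \<and> emeasure lebesgue B \<le> ennreal (1 / real (Suc n))" for n
    using assms[of "1 / real (Suc n)"] unfolding small_def by auto
  then obtain B where B: "\<And>n. B n \<in> sets lebesgue" "\<And>n. {x. \<not> P x} \<subseteq> B n" "\<And>n. emeasure lebesgue (B n) \<le> ennreal (1 / real (Suc n))"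
    by metis
  have m: "(\<Inter>n. B n) \<in> sets lebesgue" using B(1) by auto
  have "emeasure lebesgue (\<Inter>n. B n) \<le> ennreal (1 / real (Suc n))" for n
  proof -
    have "emeasure lebesgue (\<Inter>n. B n) \<le> emeasure lebesgue (B n)" using B(1) by (intro emeasure_mono) auto
    then show ?thesis using B(3) order_trans by blast
  qed
  then have "emeasure lebesgue (\<Inter>n. B n) \<le> 0"
  proof (intro LIMSEQ_le_const[of "\<lambda>n. ennreal (1 / real (Suc n))"])
    have "(\<lambda>n. ennreal (1 / real (Suc n))) \<longlonglongrightarrow> ennreal 0"
      by (intro tendsto_ennrealI LIMSEQ_Suc[OF lim_1_over_n])
    then show "(\<lambda>n. ennreal (1 / real (Suc n))) \<longlonglongrightarrow> 0" by simp
  qed auto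
  then have "(\<Inter>n. B n) \<in> null_sets lebesgue" using m by auto
  moreover have "{x. \<not> P x} \<subseteq> (\<Inter>n. B n)" using B(2) by blast
  ultimately have "AE x in lebesgue. P x" by (intro AE_I') auto
  then show ?thesis by (simp add: AE_completion_iff)
qed

section \<open>Translations of integrals\<close>

lemma nn_integral_lborel_translate:
  fixes f :: "'a::euclidean_space \<Rightarrow> ennreal"
  assumes [measurable]: "f \<in> borel_measurable borel"
  shows "(\<integral>\<^sup>+x. f (x + y) \<partial>lborel) = (\<integral>\<^sup>+x. f x \<partial>lborel)"
proof -
  have "(\<integral>\<^sup>+x. f x \<partial>lborel) = (\<integral>\<^sup>+x. f x \<partial>distr lborel borel ((+) y))"
    by (simp add: lborel_distr_plus)
  also have "\<dots> = (\<integral>\<^sup>+x. f (y + x) \<partial>lborel)"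
    by (subst nn_integral_distr) auto
  finally show ?thesis by (simp add: add.commute)
qed

text \<open>By Tonelli and translation invariance, averaging over segments of a fixed direction preserves
the integral. This is the only way in which integrals along segments are ever estimated.\<close>

lemma nn_integral_segment:
  fixes k :: "'a::euclidean_space \<Rightarrow> ennreal"
  assumes [measurable]: "k \<in> borel_measurable borel"
  shows "(\<integral>\<^sup>+x. (\<integral>\<^sup>+s. k (x + s *\<^sub>R y) * indicator {0..1::real} s \<partial>lborel) \<partial>lborel) = (\<integral>\<^sup>+x. k x \<partial>lborel)"
proof -
  have "(\<integral>\<^sup>+x. (\<integral>\<^sup>+s. k (x + s *\<^sub>R y) * indicator {0..1::real} s \<partial>lborel) \<partial>lborel)
     = (\<integral>\<^sup>+s. (\<integral>\<^sup>+x. k (x + s *\<^sub>R y) * indicator {0..1::real} s \<partial>lborel) \<partial>lborel)"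
    by (rule lborel_pair.Fubini') measurable
  also have "\<dots> = (\<integral>\<^sup>+s. (\<integral>\<^sup>+x. k x \<partial>lborel) * indicator {0..1::real} s \<partial>lborel)"
    by (simp add: nn_integral_multc nn_integral_lborel_translate[of k])
  also have "\<dots> = (\<integral>\<^sup>+x. k x \<partial>lborel)"
    by (subst nn_integral_cmult_indicator) auto
  finally show ?thesis .
qed

section \<open>Kolmogorov's compactness criterion\<close>

text \<open>The averages over balls of radius \<open>rad k\<close> are uniformly close to the functions in mean, and for
each \<open>k\<close> they are equicontinuous in \<open>n\<close>. A diagonal subsequence therefore converges at every point for
every \<open>k\<close>, by dominated convergence also in mean, so that the subsequence of the functions themselves is
Cauchy in mean; a further subsequence then converges almost everywhere.\<close>

lemma Kolmogorov_subsequence: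
  fixes w :: "nat \<Rightarrow> 'a::euclidean_space \<Rightarrow> 'b::euclidean_space"
  assumes [measurable]: "\<And>n. w n \<in> borel_measurable borel"
    and bnd: "\<And>n x. norm (w n x) \<le> C"
    and Q: "bounded Q" "\<And>n x. x \<notin> Q \<Longrightarrow> w n x = 0"
    and trans: "\<And>\<eta>. 0 < \<eta> \<Longrightarrow> \<exists>\<rho>>0. \<forall>n y. norm y < \<rho> \<longrightarrow>
                  (\<integral>\<^sup>+x. norm (w n (x + y) - w n x) \<partial>lborel) \<le> ennreal \<eta>"
  obtains r where "strict_mono (r::nat\<Rightarrow>nat)" "AE x in lborel. convergent (\<lambda>i. w (r i) x)"
proof -
  have C0: "0 \<le> C" using norm_ge_zero bnd order_trans by blast
  obtain R0 where R0: "Q \<subseteq> ball 0 R0" using Q(1) bounded_subset_ballD by blast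
  define R where "R = max R0 0"
  have R: "Q \<subseteq> ball 0 R" "0 \<le> R" using R0 unfolding R_def by (auto simp: subset_iff)
  define rad where "rad k = 1 / real (Suc k)" for k :: nat
  define \<mu> where "\<mu> k = uniform_measure lborel (ball (0::'a) (rad k))" for k
  define A where "A k n x = (LINT z|\<mu> k. w n (x + z))" for k n x
  have rad0: "0 < rad k" "rad k \<le> 1" for k by (auto simp: rad_def)
  have em0: "emeasure lborel (ball (0::'a) (rad k)) \<noteq> 0" for k
    using rad0[of k] by (simp add: emeasure_lborel_ball_finite emeasure_ball ennreal_eq_0_iff not_le unit_ball_vol_pos)
  have emf: "emeasure lborel (ball (0::'a) (rad k)) \<noteq> \<infinity>" for k
    using emeasure_lborel_ball_finite[of "0::'a" "rad k"] by auto
  have ps: "emeasure (\<mu> k) (space (\<mu> k)) = 1" for k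
    unfolding \<mu>_def using em0[of k] emf[of k] by (simp add: ennreal_divide_self less_top)
  have fin: "finite_measure (\<mu> k)" for k
    by (rule finite_measureI) (simp add: ps)
  have sets\<mu>[measurable_cong]: "sets (\<mu> k) = sets borel" for k
    by (simp add: \<mu>_def)
  have pair: "pair_sigma_finite lborel (\<mu> k)" for k
    using fin[of k] by (simp add: pair_sigma_finite_def finite_measure_def lborel.sigma_finite_measure_axioms)
  have sf: "sigma_finite_measure (\<mu> k)" for k
    using fin[of k] by (simp add: finite_measure_def)
  have intw: "integrable (\<mu> k) (\<lambda>z. w n (x + z))" for k n x
    by (intro finite_measure.integrable_const_bound[OF fin, where B=C]) (auto simp: bnd)
  have intd: "integrable (\<mu> k) (\<lambda>z. w n (x + z) - w n' (x' + z))" for k n x x' n'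
    using intw by (intro Bochner_Integration.integrable_diff)
  have [measurable]: "A k n \<in> borel_measurable borel" for k n
    unfolding A_def by (rule sigma_finite_measure.borel_measurable_lebesgue_integral[OF sf]) measurable
  have Abnd: "norm (A k n x) \<le> C" for k n x
  proof -
    have "ennreal (norm (A k n x)) \<le> (\<integral>\<^sup>+z. norm (w n (x + z)) \<partial>\<mu> k)"
      unfolding A_def by (rule integral_norm_bound_ennreal[OF intw])
    also have "\<dots> \<le> (\<integral>\<^sup>+z. ennreal C \<partial>\<mu> k)"
      by (intro nn_integral_mono ennreal_leI bnd)
    also have "\<dots> = ennreal C" by (simp add: ps)
    finally show ?thesis using C0 by simp
  qed
  have AE\<mu>: "AE z in \<mu> k. norm z < rad k" for k
    unfolding \<mu>_def by (rule AE_uniform_measureI) auto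
  have A0: "A k n x = 0" if "x \<notin> ball 0 (R + 1)" for k n x
  proof -
    have "AE z in \<mu> k. w n (x + z) = 0"
      using AE\<mu>[of k]
    proof eventually_elim
      case (elim z)
      have "R + 1 \<le> norm x" using that by simp
      also have "norm x \<le> norm (x + z) + norm z" by (metis add_diff_cancel_right' norm_triangle_ineq4)
      finally have "x + z \<notin> ball 0 R" using elim rad0(2)[of k] by simp
      then show ?case using Q(2) R by blast
    qed
    then have "A k n x = (LINT z|\<mu> k. 0)"
      unfolding A_def by (intro integral_cong_AE) auto
    then show ?thesis by simp
  qed
  have Aeq: "\<exists>\<rho>>0. \<forall>n x x'. norm (x - x') < \<rho> \<longrightarrow> norm (A k n x - A k n x') \<le> \<eta>" if "\<eta> > 0" for \<eta> k
  proof -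
    define v where "v = emeasure lborel (ball (0::'a) (rad k))"
    define v' where "v' = enn2real v"
    have v': "v = ennreal v'" "0 < v'"
      using em0[of k] emf[of k] unfolding v'_def v_def
      by (auto simp: enn2real_positive_iff less_top zero_less_iff_neq_zero)
    obtain \<rho> where \<rho>: "\<rho> > 0" "\<And>n y. norm y < \<rho> \<Longrightarrow> (\<integral>\<^sup>+x. norm (w n (x + y) - w n x) \<partial>lborel) \<le> ennreal (\<eta> * v')"
      using trans[of "\<eta> * v'"] mult_pos_pos[OF \<open>\<eta> > 0\<close> v'(2)] by blast
    have "norm (A k n x - A k n x') \<le> \<eta>" if "norm (x - x') < \<rho>" for n x x'
    proof -
      have "ennreal (norm (A k n x - A k n x')) = ennreal (norm (LINT z|\<mu> k. w n (x + z) - w n (x' + z)))"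
        unfolding A_def by (subst Bochner_Integration.integral_diff) (auto intro: intw)
      also have "\<dots> \<le> (\<integral>\<^sup>+z. norm (w n (x + z) - w n (x' + z)) \<partial>\<mu> k)"
        by (rule integral_norm_bound_ennreal[OF intd])
      also have "\<dots> = (\<integral>\<^sup>+z. ennreal (norm (w n (x + z) - w n (x' + z))) * indicator (ball 0 (rad k)) z \<partial>lborel) / v"
        unfolding \<mu>_def v_def by (subst nn_integral_uniform_measure) auto
      also have "\<dots> \<le> (\<integral>\<^sup>+z. ennreal (norm (w n (x + z) - w n (x' + z))) \<partial>lborel) / v"
        by (intro divide_right_mono_ennreal nn_integral_mono) (auto simp: indicator_def)
      also have "(\<integral>\<^sup>+z. ennreal (norm (w n (x + z) - w n (x' + z))) \<partial>lborel)
          = (\<integral>\<^sup>+z. ennreal (norm (w n ((z + x') + (x - x')) - w n (z + x'))) \<partial>lborel)"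
        by (simp add: add.commute)
      also have "\<dots> = (\<integral>\<^sup>+z. ennreal (norm (w n (z + (x - x')) - w n z)) \<partial>lborel)"
        by (rule nn_integral_lborel_translate) measurable
      also have "\<dots> \<le> ennreal (\<eta> * v')" by (rule \<rho>(2)[OF that])
      finally have "ennreal (norm (A k n x - A k n x')) \<le> ennreal (\<eta> * v') / v"
        by (simp add: divide_right_mono_ennreal)
      also have "\<dots> = ennreal \<eta>"
        using v' \<open>\<eta> > 0\<close> by (simp add: divide_ennreal)
      finally show ?thesis using \<open>\<eta> > 0\<close> by simp
    qed
    with \<rho>(1) show ?thesis by blast
  qed
  have Aclose: "\<exists>k. \<forall>n. (\<integral>\<^sup>+x. norm (A k n x - w n x) \<partial>lborel) \<le> ennreal \<eta>" if "\<eta> > 0" for \<eta>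
  proof -
    obtain \<rho> where \<rho>: "\<rho> > 0" "\<And>n y. norm y < \<rho> \<Longrightarrow> (\<integral>\<^sup>+x. norm (w n (x + y) - w n x) \<partial>lborel) \<le> ennreal \<eta>"
      using trans[OF \<open>\<eta> > 0\<close>] by blast
    obtain k where k: "rad k < \<rho>"
      using reals_Archimedean[OF \<rho>(1)] by (auto simp: rad_def inverse_eq_divide)
    have "(\<integral>\<^sup>+x. norm (A k n x - w n x) \<partial>lborel) \<le> ennreal \<eta>" for n
    proof -
      interpret pair_sigma_finite lborel "\<mu> k" by (rule pair)
      have "(\<integral>\<^sup>+x. norm (A k n x - w n x) \<partial>lborel) \<le> (\<integral>\<^sup>+x. (\<integral>\<^sup>+z. norm (w n (x + z) - w n x) \<partial>\<mu> k) \<partial>lborel)"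
      proof (rule nn_integral_mono)
        fix x
        have "measure (\<mu> k) (space (\<mu> k)) = 1" using ps[of k] by (simp add: measure_def)
        then have "A k n x - w n x = (LINT z|\<mu> k. w n (x + z) - w n x)"
          unfolding A_def by (subst Bochner_Integration.integral_diff) (auto intro: intw finite_measure.integrable_const[OF fin])
        then show "ennreal (norm (A k n x - w n x)) \<le> (\<integral>\<^sup>+z. norm (w n (x + z) - w n x) \<partial>\<mu> k)"
          by (auto intro!: integral_norm_bound_ennreal Bochner_Integration.integrable_diff intw finite_measure.integrable_const[OF fin])
      qed
      also have "\<dots> = (\<integral>\<^sup>+z. (\<integral>\<^sup>+x. norm (w n (x + z) - w n x) \<partial>lborel) \<partial>\<mu> k)"
        by (rule Fubini'[symmetric]) measurable
      also have "\<dots> \<le> (\<integral>\<^sup>+z. ennreal \<eta> \<partial>\<mu> k)"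
        using AE\<mu>[of k] by (intro nn_integral_mono_AE, eventually_elim) (use k \<rho>(2) in auto)
      also have "\<dots> = ennreal \<eta>" by (simp add: ps)
      finally show ?thesis .
    qed
    then show ?thesis by blast
  qed
  obtain D :: "'a set" where D: "countable D" "\<And>X. open X \<Longrightarrow> X \<noteq> {} \<Longrightarrow> \<exists>d\<in>D. d \<in> X"
    by (rule countable_dense_setE) auto
  define S where "S = D \<times> (UNIV::nat set)"
  have "countable S" using D(1) by (simp add: S_def)
  obtain q where q: "strict_mono (q::nat\<Rightarrow>nat)"
     "\<And>p. p \<in> S \<Longrightarrow> \<exists>l. (\<lambda>n. (\<lambda>(x,k). A k (q n) x) p) \<longlonglongrightarrow> l"
    by (rule function_convergent_subsequence[OF \<open>countable S\<close>, where f = "\<lambda>n (x,k). A k n x" and M=C])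
       (auto simp: Abnd)
  have conv: "convergent (\<lambda>n. A k (q n) x)" for k x
  proof (rule Cauchy_convergent, rule metric_CauchyI)
    fix e :: real assume "0 < e"
    then obtain \<rho> where \<rho>: "\<rho> > 0" "\<And>n x x'. norm (x - x') < \<rho> \<Longrightarrow> norm (A k n x - A k n x') \<le> e/4"
      using Aeq[of "e/4" k] by auto
    obtain d where d: "d \<in> D" "norm (x - d) < \<rho>"
      using D(2)[of "ball x \<rho>"] \<rho>(1) by (auto simp: dist_norm)
    obtain l where "(\<lambda>n. A k (q n) d) \<longlonglongrightarrow> l" using q(2)[of "(d,k)"] d(1) by (auto simp: S_def)
    then have "Cauchy (\<lambda>n. A k (q n) d)" by (rule LIMSEQ_imp_Cauchy)
    then obtain N where N: "\<And>m n. m \<ge> N \<Longrightarrow> n \<ge> N \<Longrightarrow> dist (A k (q m) d) (A k (q n) d) < e/4"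
      using \<open>0 < e\<close> unfolding Cauchy_def by (metis zero_less_divide_iff zero_less_numeral)
    have "dist (A k (q m) x) (A k (q n) x) < e" if "m \<ge> N" "n \<ge> N" for m n
    proof -
      have "dist (A k (q m) x) (A k (q m) d) \<le> e/4" "dist (A k (q n) x) (A k (q n) d) \<le> e/4"
        using \<rho>(2)[OF d(2)] by (auto simp: dist_norm)
      then show ?thesis using N[OF that] \<open>0 < e\<close> by metric
    qed
    then show "\<exists>M. \<forall>m\<ge>M. \<forall>n\<ge>M. dist (A k (q m) x) (A k (q n) x) < e" by blast
  qed
  have [measurable]: "(\<lambda>x. lim (\<lambda>n. A k (q n) x)) \<in> borel_measurable borel" for k
    by (rule borel_measurable_lim_metric) measurable
  have AL1: "(\<lambda>i. (\<integral>\<^sup>+x. norm (lim (\<lambda>n. A k (q n) x) - A k (q i) x) \<partial>lborel)) \<longlonglongrightarrow> 0" for k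
  proof (rule nn_integral_dominated_convergence_norm[where w = "\<lambda>x. C * indicator (ball 0 (R+1)) x"])
    show "AE x in lborel. norm (A k (q j) x) \<le> C * indicator (ball 0 (R + 1)) x" for j
      using Abnd[of k "q j"] A0[of _ k "q j"] by (intro AE_I2) (auto simp: indicator_def)
    have "(\<integral>\<^sup>+ x. ennreal (C * indicator (ball (0::'a) (R + 1)) x) \<partial>lborel) = (\<integral>\<^sup>+ x. ennreal C * indicator (ball (0::'a) (R + 1)) x \<partial>lborel)"
      by (intro nn_integral_cong) (auto simp: indicator_def)
    also have "\<dots> = ennreal C * emeasure lborel (ball (0::'a) (R+1))"
      by (subst nn_integral_cmult_indicator) auto
    also have "\<dots> < \<infinity>"
      using emeasure_lborel_ball_finite[of "0::'a" "R+1"] by (simp add: ennreal_mult_less_top)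
    finally show "(\<integral>\<^sup>+ x. ennreal (C * indicator (ball (0::'a) (R + 1)) x) \<partial>lborel) < \<infinity>" .
    show "AE x in lborel. (\<lambda>i. A k (q i) x) \<longlonglongrightarrow> lim (\<lambda>n. A k (q n) x)"
      using conv by (simp add: convergent_LIMSEQ_iff)
    show "(\<lambda>x::'a. C * indicator (ball 0 (R+1)) x) \<in> borel_measurable lborel"
      by (intro borel_measurable_times borel_measurable_indicator) auto
  qed measurable
  have intwl: "integrable lborel (w n)" for n
  proof (rule integrableI_bounded_set[where A = "ball 0 (R+1)" and B = C])
    show "emeasure lborel (ball (0::'a) (R + 1)) < \<infinity>" using emeasure_lborel_ball_finite[of "0::'a" "R+1"] by simp
    show "AE x in lborel. x \<in> ball 0 (R + 1) \<longrightarrow> norm (w n x) \<le> C" by (simp add: bnd)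
    have "ball 0 R \<subseteq> ball (0::'a) (R+1)" by auto
    then have "w n x = 0" if "x \<notin> ball 0 (R+1)" for x using that R(1) Q(2) by blast
    then show "AE x in lborel. x \<notin> ball 0 (R + 1) \<longrightarrow> w n x = 0" by auto
  qed measurable
  have "\<exists>N. \<forall>i\<ge>N. \<forall>j\<ge>N. LINT x|lborel. norm (w (q i) x - w (q j) x) < e" if "e > 0" for e
  proof -
    obtain k where k: "\<And>n. (\<integral>\<^sup>+x. norm (A k n x - w n x) \<partial>lborel) \<le> ennreal (e/5)"
      using Aclose[of "e/5"] \<open>e > 0\<close> by auto
    define g where "g x = lim (\<lambda>n. A k (q n) x)" for x
    have [measurable]: "g \<in> borel_measurable borel" unfolding g_def by measurable
    have "\<forall>\<^sub>F i in sequentially. (\<integral>\<^sup>+x. norm (g x - A k (q i) x) \<partial>lborel) < ennreal (e/5)"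
      using AL1[of k] that unfolding g_def by (intro order_tendstoD) auto
    then obtain N where N: "\<And>i. i \<ge> N \<Longrightarrow> (\<integral>\<^sup>+x. norm (g x - A k (q i) x) \<partial>lborel) \<le> ennreal (e/5)"
      unfolding eventually_sequentially by (auto intro: less_imp_le)
    have "LINT x|lborel. norm (w (q i) x - w (q j) x) < e" if ij: "i \<ge> N" "j \<ge> N" for i j
    proof -
      have "(\<integral>\<^sup>+x. norm (w (q i) x - w (q j) x) \<partial>lborel)
        \<le> (\<integral>\<^sup>+x. (norm (A k (q i) x - w (q i) x) + norm (g x - A k (q i) x))
             + (norm (A k (q j) x - w (q j) x) + norm (g x - A k (q j) x)) \<partial>lborel)"
      proof (intro nn_integral_mono)
        fix x
        have "norm (w (q i) x - w (q j) x) \<le> (norm (A k (q i) x - w (q i) x) + norm (g x - A k (q i) x))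
             + (norm (A k (q j) x - w (q j) x) + norm (g x - A k (q j) x))"
          by norm
        then show "ennreal (norm (w (q i) x - w (q j) x)) \<le> ennreal ((norm (A k (q i) x - w (q i) x) + norm (g x - A k (q i) x))
             + (norm (A k (q j) x - w (q j) x) + norm (g x - A k (q j) x)))" by (rule ennreal_leI)
      qed
      also have "\<dots> = ((\<integral>\<^sup>+x. norm (A k (q i) x - w (q i) x) \<partial>lborel) + (\<integral>\<^sup>+x. norm (g x - A k (q i) x) \<partial>lborel))
           + ((\<integral>\<^sup>+x. norm (A k (q j) x - w (q j) x) \<partial>lborel) + (\<integral>\<^sup>+x. norm (g x - A k (q j) x) \<partial>lborel))"
        by (simp add: nn_integral_add)
      also have "\<dots> \<le> (ennreal (e/5) + ennreal (e/5)) + (ennreal (e/5) + ennreal (e/5))"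
        by (intro add_mono k N ij)
      also have "\<dots> = ennreal (4*e/5)" using \<open>e > 0\<close> by (simp flip: ennreal_plus)
      finally have "(\<integral>\<^sup>+x. norm (w (q i) x - w (q j) x) \<partial>lborel) \<le> ennreal (4*e/5)" .
      moreover have "(\<integral>\<^sup>+x. norm (w (q i) x - w (q j) x) \<partial>lborel) = ennreal (LINT x|lborel. norm (w (q i) x - w (q j) x))"
        by (intro nn_integral_eq_integral) (auto intro!: integrable_norm Bochner_Integration.integrable_diff intwl)
      ultimately have "(LINT x|lborel. norm (w (q i) x - w (q j) x)) \<le> 4*e/5"
        using \<open>e > 0\<close> by simp
      then show ?thesis using \<open>e > 0\<close> by simp
    qed
    then show ?thesis by blast
  qed
  with intwl obtain r where r: "strict_mono r" "AE x in lborel. Cauchy (\<lambda>i. w (q (r i)) x)"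
    by (rule cauchy_L1_AE_cauchy_subseq[of lborel "\<lambda>i. w (q i)"])
  show ?thesis
  proof
    show "strict_mono (q \<circ> r)" using q(1) r(1) by (rule strict_mono_o)
    show "AE x in lborel. convergent (\<lambda>i. w ((q \<circ> r) i) x)"
      using r(2) by (simp add: Cauchy_convergent_iff)
  qed
qed

section \<open>Smooth functions and bumps\<close>

text \<open>Iterated derivatives are given through the choice operator; knowing one derivative explicitly
pins it down.\<close>

lemma k_smooth_SucI:
  assumes "\<And>x. (\<phi> has_derivative \<phi>' x) (at x)" "\<And>b. b \<in> Basis \<Longrightarrow> k_smooth k (\<lambda>x. \<phi>' x b)"
  shows "k_smooth (Suc k) \<phi>"
proof -
  have "frechet_derivative \<phi> (at x) = \<phi>' x" for x
    using frechet_derivative_at[OF assms(1)] by simp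
  then show ?thesis
    using assms by (auto simp: differentiable_def)
qed

lemma k_smooth_Suc_imp: "k_smooth (Suc k) \<phi> \<Longrightarrow> k_smooth k \<phi>"
proof (induction k arbitrary: \<phi>)
  case 0
  then show ?case
    by (auto intro!: continuous_at_imp_continuous_on differentiable_imp_continuous_within)
next
  case (Suc k)
  then show ?case by (metis k_smooth.simps(2))
qed

lemma k_smooth_const: "k_smooth k (\<lambda>x::'a::euclidean_space. c)"
proof (induction k arbitrary: c)
  case (Suc k)
  show ?case by (rule k_smooth_SucI[where \<phi>' = "\<lambda>x y. 0"]) (auto intro: Suc)
qed auto

lemma k_smooth_add: "k_smooth k \<phi> \<Longrightarrow> k_smooth k \<psi> \<Longrightarrow> k_smooth k (\<lambda>x. \<phi> x + \<psi> x)"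
proof (induction k arbitrary: \<phi> \<psi>)
  case 0
  then show ?case by (auto intro: continuous_intros)
next
  case (Suc k)
  show ?case
  proof (rule k_smooth_SucI[where \<phi>' = "\<lambda>x y. frechet_derivative \<phi> (at x) y + frechet_derivative \<psi> (at x) y"])
    show "((\<lambda>x. \<phi> x + \<psi> x) has_derivative (\<lambda>y. frechet_derivative \<phi> (at x) y + frechet_derivative \<psi> (at x) y)) (at x)" for x
      using Suc by (intro has_derivative_add) (auto simp: frechet_derivative_works)
  qed (use Suc in auto)
qed

lemma k_smooth_mult: "k_smooth k \<phi> \<Longrightarrow> k_smooth k \<psi> \<Longrightarrow> k_smooth k (\<lambda>x. \<phi> x * \<psi> x)"
proof (induction k arbitrary: \<phi> \<psi>)
  case 0
  then show ?case by (auto intro: continuous_intros)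
next
  case (Suc k)
  show ?case
  proof (rule k_smooth_SucI[where \<phi>' = "\<lambda>x y. \<phi> x * frechet_derivative \<psi> (at x) y + frechet_derivative \<phi> (at x) y * \<psi> x"])
    show "((\<lambda>x. \<phi> x * \<psi> x) has_derivative (\<lambda>y. \<phi> x * frechet_derivative \<psi> (at x) y + frechet_derivative \<phi> (at x) y * \<psi> x)) (at x)" for x
      using Suc by (intro has_derivative_mult) (auto simp: frechet_derivative_works)
    show "k_smooth k (\<lambda>x. \<phi> x * frechet_derivative \<psi> (at x) b + frechet_derivative \<phi> (at x) b * \<psi> x)" if "b \<in> Basis" for b
      using that Suc.prems k_smooth_Suc_imp[OF Suc.prems(1)] k_smooth_Suc_imp[OF Suc.prems(2)]
      by (intro k_smooth_add Suc.IH) auto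
  qed
qed

lemma k_smooth_prod:
  "finite I \<Longrightarrow> (\<And>i. i \<in> I \<Longrightarrow> k_smooth k (\<phi> i)) \<Longrightarrow> k_smooth k (\<lambda>x. \<Prod>i\<in>I. \<phi> i x)"
  by (induction I rule: finite_induct) (auto intro: k_smooth_const k_smooth_mult)

text \<open>The functions \<open>P(1/t) exp(-l/t)\<close>, extended by zero, are closed under differentiation; their
derivatives involve the polynomial \<open>X\<^sup>2 (l P - P')\<close>. The parameter \<open>l\<close> is kept because \<open>exp(-l/t)\<close>
increases to one as \<open>l\<close> decreases to zero, which approximates indicators of boxes by smooth bumps.\<close>

definition flat_exp :: "real \<Rightarrow> real poly \<Rightarrow> real \<Rightarrow> real" where
  "flat_exp l P t = (if 0 < t then poly P (1/t) * exp (- l / t) else 0)"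

lemma poly_exp_tendsto_0:
  fixes l :: real
  assumes "0 < l"
  shows "((\<lambda>x. poly P x * exp (- l * x)) \<longlongrightarrow> 0) at_top"
proof -
  have *: "((\<lambda>x. x ^ k * exp (- l * x)) \<longlongrightarrow> 0) at_top" for k
  proof -
    have "((\<lambda>x. (1/l)^k * ((l * x) ^ k / exp (l * x))) \<longlongrightarrow> (1/l)^k * 0) at_top"
      using assms
      by (intro tendsto_mult tendsto_const filterlim_compose[OF tendsto_power_div_exp_0]
          filterlim_tendsto_pos_mult_at_top[OF tendsto_const _ filterlim_ident])
    moreover have "(1/l)^k * ((l * x) ^ k / exp (l * x)) = x ^ k * exp (- l * x)" for x
      using assms by (simp add: power_mult_distrib exp_minus field_simps power_divide)
    ultimately show ?thesis by simp
  qed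
  have "((\<lambda>x. \<Sum>i\<le>degree P. coeff P i * (x ^ i * exp (- l * x))) \<longlongrightarrow> (\<Sum>i\<le>degree P. coeff P i * 0)) at_top"
    by (intro tendsto_sum tendsto_mult tendsto_const *)
  then show ?thesis
    by (simp add: poly_altdef sum_distrib_right mult.assoc)
qed

lemma has_field_derivative_flat_exp:
  assumes "0 < l"
  shows "(flat_exp l P has_field_derivative flat_exp l ([:0,0,1:] * (smult l P - pderiv P)) t) (at t)"
proof -
  consider "t > 0" | "t < 0" | "t = 0" by linarith
  then show ?thesis
  proof cases
    case 1
    have "((\<lambda>t. poly P (1/t) * exp (- l / t)) has_field_derivative flat_exp l ([:0,0,1:] * (smult l P - pderiv P)) t) (at t)"
      using 1 unfolding flat_exp_def
      by (auto intro!: derivative_eq_intros DERIV_chain'[OF _ poly_DERIV] simp: field_simps power2_eq_square)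
    moreover have "\<forall>\<^sub>F s in nhds t. flat_exp l P s = poly P (1/s) * exp (- l / s)"
      using eventually_nhds_in_open[of "{0<..}" t] 1 by (auto elim!: eventually_mono simp: flat_exp_def)
    ultimately show ?thesis by (subst DERIV_cong_ev[OF refl _ refl])
  next
    case 2
    have "\<forall>\<^sub>F s in nhds t. flat_exp l P s = 0"
      using eventually_nhds_in_open[of "{..<0}" t] 2 by (auto elim!: eventually_mono simp: flat_exp_def)
    then show ?thesis using 2 by (subst DERIV_cong_ev[OF refl _ refl]) (auto simp: flat_exp_def)
  next
    case 3
    have "((\<lambda>h. flat_exp l P h / h) \<longlongrightarrow> 0) (at 0)"
    proof (rule filterlim_split_at)
      show "((\<lambda>h. flat_exp l P h / h) \<longlongrightarrow> 0) (at_left 0)"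
        by (rule tendsto_eventually) (auto simp: flat_exp_def eventually_at_filter)
      have "((\<lambda>h. poly ([:0,1:] * P) (inverse h) * exp (- l * inverse h)) \<longlongrightarrow> 0) (at_right 0)"
        by (rule filterlim_compose[OF poly_exp_tendsto_0[OF assms] filterlim_inverse_at_top_right])
      then show "((\<lambda>h. flat_exp l P h / h) \<longlongrightarrow> 0) (at_right 0)"
        by (rule Lim_transform_eventually)
           (auto simp: eventually_at_filter flat_exp_def field_simps)
    qed
    then show ?thesis
      using 3 by (simp add: DERIV_def flat_exp_def)
  qed
qed

lemma k_smooth_flat_exp:
  assumes "0 < l"
  shows "k_smooth k (\<lambda>x::'a::euclidean_space. flat_exp l P (x \<bullet> v - a))"
proof (induction k arbitrary: P)
  case 0
  have "continuous_on UNIV (flat_exp l P)"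
    using has_field_derivative_flat_exp[OF assms] by (intro continuous_at_imp_continuous_on) (auto intro: DERIV_isCont)
  then show ?case
    by (auto intro!: continuous_on_compose2[of UNIV "flat_exp l P"] continuous_intros)
next
  case (Suc k)
  show ?case
  proof (rule k_smooth_SucI)
    fix x
    show "((\<lambda>x. flat_exp l P (x \<bullet> v - a)) has_derivative
       (\<lambda>y. (y \<bullet> v) * flat_exp l ([:0,0,1:] * (smult l P - pderiv P)) (x \<bullet> v - a))) (at x)"
      by (rule DERIV_compose_FDERIV[OF has_field_derivative_flat_exp[OF assms]]) (auto intro!: derivative_eq_intros)
  next
    fix b :: 'a
    show "k_smooth k (\<lambda>x. (b \<bullet> v) * flat_exp l ([:0,0,1:] * (smult l P - pderiv P)) (x \<bullet> v - a))"
      by (intro k_smooth_mult k_smooth_const Suc)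
  qed
qed

text \<open>In each coordinate one factor vanishes to the left of \<open>a\<close> and the other, read in the direction
\<open>-b\<close>, to the right of \<open>c\<close>.\<close>

definition box_bump :: "real \<Rightarrow> 'a::euclidean_space \<Rightarrow> 'a \<Rightarrow> 'a \<Rightarrow> real" where
  "box_bump l a c x = (\<Prod>b\<in>Basis. flat_exp l 1 (x \<bullet> b - a \<bullet> b) * flat_exp l 1 (x \<bullet> (-b) - (- (c \<bullet> b))))"

lemma flat_exp_1: "flat_exp l 1 t = (if 0 < t then exp (- l / t) else 0)"
  by (simp add: flat_exp_def)

lemma box_bump_outside: "x \<notin> box a c \<Longrightarrow> box_bump l a c x = 0"
proof -
  assume "x \<notin> box a c"
  then obtain b where "b \<in> Basis" "x \<bullet> b \<le> a \<bullet> b \<or> c \<bullet> b \<le> x \<bullet> b"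
    by (auto simp: mem_box not_less)
  then show ?thesis
    unfolding box_bump_def by (intro prod_zero) (auto simp: flat_exp_1 intro!: bexI[of _ b])
qed

lemma box_bump_test:
  assumes "0 < l" "cbox a c \<subseteq> U"
  shows "box_bump l a c \<in> test_functions U"
proof -
  have "closure {x. box_bump l a c x \<noteq> 0} \<subseteq> cbox a c"
    using box_bump_outside[of _ a c l] box_subset_cbox by (intro closure_minimal) blast+
  moreover from this have "compact (closure {x. box_bump l a c x \<noteq> 0})"
    by (metis bounded_cbox bounded_subset closed_closure compact_eq_bounded_closed)
  moreover have "k_smooth k (box_bump l a c)" for k
    unfolding box_bump_def[abs_def] using assms(1)
    by (intro k_smooth_prod k_smooth_mult k_smooth_flat_exp) auto
  ultimately show ?thesis using assms(2) by (auto simp: test_functions_def)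
qed

lemma box_bump_bounds: "0 < l \<Longrightarrow> 0 \<le> box_bump l a c x" "0 < l \<Longrightarrow> box_bump l a c x \<le> 1"
  unfolding box_bump_def by (auto intro!: prod_nonneg prod_le_1 mult_le_one simp: flat_exp_1)

lemma box_bump_tendsto: "(\<lambda>n. box_bump (1 / real (Suc n)) a c x) \<longlonglongrightarrow> indicator (box a c) x"
proof (cases "x \<in> box a c")
  case False
  then show ?thesis by (simp add: box_bump_outside)
next
  case True
  have f: "(\<lambda>n. flat_exp (1 / real (Suc n)) 1 t) \<longlonglongrightarrow> 1" if "0 < t" for t
  proof -
    have "(\<lambda>n. exp (- ((1 / real (Suc n)) / t))) \<longlonglongrightarrow> exp (- (0 / t))"
      by (intro tendsto_exp tendsto_minus tendsto_divide tendsto_const LIMSEQ_Suc[OF lim_1_over_n]) (use that in auto)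
    then show ?thesis using that by (simp add: flat_exp_1)
  qed
  have "(\<lambda>n. box_bump (1 / real (Suc n)) a c x) \<longlonglongrightarrow> (\<Prod>b\<in>(Basis::'a set). 1 * 1)"
    unfolding box_bump_def using True by (intro tendsto_prod tendsto_mult f) (auto simp: mem_box)
  then show ?thesis using True by simp
qed

lemma test_function_smooth: "\<phi> \<in> test_functions U \<Longrightarrow> k_smooth k \<phi>"
  by (simp add: test_functions_def)

lemma test_function_continuous: "\<phi> \<in> test_functions U \<Longrightarrow> continuous_on A \<phi>"
  using test_function_smooth[of \<phi> U 0] by (auto intro: continuous_on_subset)

lemma test_function_derivative:
  "\<phi> \<in> test_functions U \<Longrightarrow> (\<phi> has_derivative frechet_derivative \<phi> (at x)) (at x)"
  using test_function_smooth[of \<phi> U 1] by (auto simp: frechet_derivative_works)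

section \<open>Averages along segments\<close>

text \<open>Differentiation under the integral sign; \<open>fx x s\<close> is the derivative as a
bounded linear function, assembled from the partial derivatives because only these are known to be continuous.\<close>

lemma has_derivative_segment_average:
  fixes \<phi> :: "'a::euclidean_space \<Rightarrow> real"
  assumes "k_smooth 1 \<phi>"
  shows "((\<lambda>z. integral {0..1} (\<lambda>s. \<phi> (z - s *\<^sub>R y))) has_derivative
           (\<lambda>v. integral {0..1} (\<lambda>s. frechet_derivative \<phi> (at (x - s *\<^sub>R y)) v))) (at x)"
proof -
  let ?D = "\<lambda>b x. frechet_derivative \<phi> (at x) b"
  have der: "(\<phi> has_derivative frechet_derivative \<phi> (at x)) (at x)" for x
    using assms by (simp add: frechet_derivative_works)
  have cont: "continuous_on UNIV \<phi>" using k_smooth_Suc_imp[of 0 \<phi>] assms by simp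
  have contD: "continuous_on UNIV (?D b)" if "b \<in> Basis" for b
    using assms that by simp
  define fx where "fx x s = (\<Sum>b\<in>Basis. ?D b (x - s *\<^sub>R y) *\<^sub>R (blinfun_inner_right b :: 'a \<Rightarrow>\<^sub>L real))" for x and s :: real
  have fx: "blinfun_apply (fx x s) v = frechet_derivative \<phi> (at (x - s *\<^sub>R y)) v" for x s v
  proof -
    have lin: "linear (frechet_derivative \<phi> (at (x - s *\<^sub>R y)))"
      using der by (blast intro: has_derivative_linear)
    have "frechet_derivative \<phi> (at (x - s *\<^sub>R y)) v = frechet_derivative \<phi> (at (x - s *\<^sub>R y)) (\<Sum>b\<in>Basis. (v \<bullet> b) *\<^sub>R b)"
      by (simp add: euclidean_representation)
    also have "\<dots> = (\<Sum>b\<in>Basis. (v \<bullet> b) *\<^sub>R ?D b (x - s *\<^sub>R y))"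
      using lin by (simp add: linear_sum linear_cmul)
    also have "\<dots> = blinfun_apply (fx x s) v"
      unfolding fx_def by (simp add: blinfun.sum_left blinfun.scaleR_left inner_commute mult.commute)
    finally show ?thesis by simp
  qed
  have cfx: "continuous_on (UNIV \<times> cbox 0 1) (\<lambda>(x, s). fx x s)"
    unfolding fx_def case_prod_beta
    by (intro continuous_on_sum continuous_on_scaleR continuous_on_compose2[OF contD] continuous_intros) auto
  have D: "((\<lambda>z. integral (cbox 0 1) (\<lambda>s. \<phi> (z - s *\<^sub>R y))) has_derivative integral (cbox 0 1) (fx x)) (at x within UNIV)"
  proof (rule leibniz_rule)
    fix z and s :: real
    have "((\<lambda>z. \<phi> (z - s *\<^sub>R y)) has_derivative (\<lambda>v. frechet_derivative \<phi> (at (z - s *\<^sub>R y)) v)) (at z)"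
      by (rule has_derivative_compose[OF _ der]) (auto intro!: derivative_eq_intros)
    then show "((\<lambda>z. \<phi> (z - s *\<^sub>R y)) has_derivative blinfun_apply (fx z s)) (at z within UNIV)"
      by (simp add: fx[abs_def])
    show "(\<lambda>s. \<phi> (z - s *\<^sub>R y)) integrable_on cbox 0 (1::real)"
      by (intro integrable_continuous continuous_on_compose2[OF cont] continuous_intros) auto
  qed (use cfx in auto)
  have int: "fx x integrable_on cbox 0 1"
    by (intro integrable_continuous continuous_on_compose2[OF cfx, of _ "\<lambda>s. (x, s)", simplified] continuous_intros) auto
  have "blinfun_apply (integral (cbox 0 1) (fx x)) = (\<lambda>v. integral {0..1} (\<lambda>s. frechet_derivative \<phi> (at (x - s *\<^sub>R y)) v))"
  proof
    fix v
    have "blinfun_apply (integral (cbox 0 1) (fx x)) v = integral (cbox 0 1) (\<lambda>s. blinfun_apply (fx x s) v)"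
      using blinfun_apply_integral[OF int] by simp
    then show "blinfun_apply (integral (cbox 0 1) (fx x)) v = integral {0..1} (\<lambda>s. frechet_derivative \<phi> (at (x - s *\<^sub>R y)) v)" by (simp add: fx)
  qed
  then show ?thesis
    using D by simp
qed

lemma k_smooth_segment_average:
  fixes \<phi> :: "'a::euclidean_space \<Rightarrow> real"
  assumes "\<And>k. k_smooth k \<phi>"
  shows "k_smooth k (\<lambda>z. integral {0..1} (\<lambda>s. \<phi> (z - s *\<^sub>R y)))"
  using assms
proof (induction k arbitrary: \<phi>)
  case 0
  have "continuous_on UNIV \<phi>" using 0[of 0] by simp
  then have "continuous_on (UNIV \<times> cbox 0 1) (\<lambda>(z, s::real). \<phi> (z - s *\<^sub>R y))"
    by (auto simp: case_prod_beta intro!: continuous_on_compose2[of UNIV \<phi>] continuous_intros)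
  from integral_continuous_on_param[OF this] show ?case by simp
next
  case (Suc k)
  have "k_smooth j (\<lambda>x. frechet_derivative \<phi> (at x) b)" if "b \<in> Basis" for b j
    using Suc.prems[of "Suc j"] that by simp
  then show ?case
    using Suc.prems by (intro k_smooth_SucI[OF has_derivative_segment_average] Suc.IH) auto
qed

section \<open>Borel representatives\<close>

lemma completion_ex_borel_measurable_euclidean:
  fixes f :: "'a \<Rightarrow> 'b::euclidean_space"
  assumes "f \<in> borel_measurable (completion M)"
  obtains g where "g \<in> borel_measurable M" "AE x in M. f x = g x"
proof -
  have "\<exists>g\<in>borel_measurable M. AE x in M. f x \<bullet> b = g x" for b
    using assms by (intro completion_ex_borel_measurable_real) auto
  then obtain g where g: "\<And>b. g b \<in> borel_measurable M" "\<And>b. AE x in M. f x \<bullet> b = g b x"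
    by metis
  show ?thesis
  proof
    show "(\<lambda>x. \<Sum>b\<in>Basis. g b x *\<^sub>R b) \<in> borel_measurable M"
      using g(1) by auto
    have "AE x in M. \<forall>b\<in>(Basis::'b set). f x \<bullet> b = g b x"
      using g(2) by (intro AE_finite_allI) auto
    then show "AE x in M. f x = (\<Sum>b\<in>Basis. g b x *\<^sub>R b)"
    proof eventually_elim
      case (elim x)
      have "(\<Sum>b\<in>Basis. g b x *\<^sub>R b) = (\<Sum>b\<in>Basis. (f x \<bullet> b) *\<^sub>R b)"
        using elim by (intro sum.cong) auto
      then show ?case by (simp add: euclidean_representation)
    qed
  qed
qed

text \<open>Borel functions, unlike Lebesgue measurable ones, may be composed with \<open>(x, s) \<mapsto> x + s y\<close>, which
Fubini's theorem along segments requires.\<close>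

lemma borel_representative:
  fixes f :: "'a::euclidean_space \<Rightarrow> 'b::euclidean_space"
  assumes "f \<in> borel_measurable (lebesgue_on U)" "U \<in> sets borel"
  obtains g where "g \<in> borel_measurable borel" "AE x in lborel. x \<in> U \<longrightarrow> g x = f x" "\<And>x. x \<notin> U \<Longrightarrow> g x = 0"
proof -
  have "U \<in> sets lebesgue" using assms(2) by auto
  then have "(\<lambda>x. indicator U x *\<^sub>R f x) \<in> borel_measurable lebesgue"
    using assms(1) by (subst (asm) borel_measurable_restrict_space_iff) (auto simp: mult.commute)
  then obtain g where g: "g \<in> borel_measurable lborel" "AE x in lborel. indicator U x *\<^sub>R f x = g x"
    by (rule completion_ex_borel_measurable_euclidean)
  show ?thesis
  proof
    show "(\<lambda>x. indicator U x *\<^sub>R g x) \<in> borel_measurable borel"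
      using g(1) assms(2) by simp
    show "AE x in lborel. x \<in> U \<longrightarrow> indicat_real U x *\<^sub>R g x = f x"
      using g(2) by eventually_elim (auto simp: indicator_def split: if_splits)
  qed (auto simp: indicator_def)
qed

text \<open>An open set is a countable union of compact boxes, on each of which the function is measurable.\<close>

lemma locally_integrable_measurable:
  fixes f :: "'a::euclidean_space \<Rightarrow> 'b::euclidean_space"
  assumes "locally_integrable_on f U" "open U"
  shows "f \<in> borel_measurable (lebesgue_on U)"
proof -
  obtain \<D> where D: "countable \<D>" "\<D> \<subseteq> Pow U" "\<And>X. X \<in> \<D> \<Longrightarrow> \<exists>a b. X = cbox a b" "\<Union>\<D> = U"
    using open_countable_Union_open_cbox[OF assms(2)] by metis
  have U: "U \<in> sets lebesgue" using assms(2) by auto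
  show ?thesis
  proof (rule measurable_piecewise_restrict[OF D(1)])
    fix X assume X: "X \<in> \<D>"
    then obtain a b where ab: "X = cbox a b" using D by blast
    have XU: "X \<subseteq> U" using X D by auto
    show "X \<inter> space (lebesgue_on U) \<in> sets (lebesgue_on U)"
      using ab XU U by (auto simp: sets_restrict_space_iff Int_absorb2)
    have "integrable (lebesgue_on X) f"
      using assms(1) XU ab unfolding locally_integrable_on_def by (metis compact_cbox)
    moreover have "restrict_space (lebesgue_on U) X = lebesgue_on X"
      using XU U by (simp add: restrict_restrict_space ab Int_absorb1)
    ultimately show "f \<in> borel_measurable (restrict_space (lebesgue_on U) X)"
      by auto
  qed (use D in auto)
qed

lemma locally_integrable_representative:
  fixes f :: "'a::euclidean_space \<Rightarrow> 'b::euclidean_space"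
  assumes "locally_integrable_on f U" "open U"
  shows "\<exists>g\<in>borel_measurable borel. AE x in lborel. x \<in> U \<longrightarrow> g x = f x"
proof -
  have "U \<in> sets borel" using assms by simp
  from borel_representative[OF locally_integrable_measurable[OF assms] this] show ?thesis
    by blast
qed

lemma lebesgue_on_to_lborel:
  fixes f g :: "'a::euclidean_space \<Rightarrow> 'b::euclidean_space"
  assumes [measurable]: "g \<in> borel_measurable borel" and ae: "AE x in lborel. x \<in> K \<longrightarrow> g x = f x"
    and f: "f \<in> borel_measurable (lebesgue_on K)" and K: "K \<in> sets borel"
  shows "integrable (lebesgue_on K) f \<longleftrightarrow> integrable lborel (\<lambda>x. indicator K x *\<^sub>R g x)"
    and "(LINT x|lebesgue_on K. f x) = (LINT x|lborel. indicator K x *\<^sub>R g x)"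
proof -
  have KL: "K \<inter> space lebesgue \<in> sets lebesgue" using K by auto
  have m1: "(\<lambda>x. indicator K x *\<^sub>R f x) \<in> borel_measurable lebesgue"
    using f KL by (subst (asm) borel_measurable_restrict_space_iff) (auto simp: mult.commute)
  have m2: "(\<lambda>x. indicator K x *\<^sub>R g x) \<in> borel_measurable lborel" using K by simp
  then have m3: "(\<lambda>x. indicator K x *\<^sub>R g x) \<in> borel_measurable lebesgue"
    using measurable_completion by blast
  have ae': "AE x in lebesgue. indicator K x *\<^sub>R f x = indicator K x *\<^sub>R g x"
    using AE_completion[OF ae] by eventually_elim (auto simp: indicator_def)
  show "integrable (lebesgue_on K) f \<longleftrightarrow> integrable lborel (\<lambda>x. indicator K x *\<^sub>R g x)"
    unfolding integrable_restrict_space[OF KL] integrable_cong_AE[OF m1 m3 ae']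
    by (rule integrable_completion[OF m2])
  show "(LINT x|lebesgue_on K. f x) = (LINT x|lborel. indicator K x *\<^sub>R g x)"
    unfolding integral_restrict_space[OF KL] integral_cong_AE[OF m1 m3 ae']
    by (rule integral_completion[OF m2])
qed

lemma AE_lebesgue_on_iff:
  assumes "A \<in> sets borel"
  shows "(AE x in lebesgue_on A. P x) \<longleftrightarrow> (AE x in lborel. x \<in> A \<longrightarrow> P x)"
proof -
  have "A \<inter> space lebesgue \<in> sets lebesgue" using assms by auto
  then show ?thesis by (simp add: AE_restrict_space_iff AE_completion_iff)
qed

lemma locally_integrable_representative_on_compact:
  fixes f :: "'a::euclidean_space \<Rightarrow> 'b::euclidean_space"
  assumes "locally_integrable_on f U" "open U"
    and g: "g \<in> borel_measurable borel" "AE x in lborel. x \<in> U \<longrightarrow> g x = f x" and K: "compact K" "K \<subseteq> U"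
  shows "integrable lborel (\<lambda>x. indicator K x *\<^sub>R g x)"
proof -
  have "integrable (lebesgue_on K) f" using assms by (auto simp: locally_integrable_on_def)
  moreover have "AE x in lborel. x \<in> K \<longrightarrow> g x = f x" using g(2) by eventually_elim (use K in auto)
  ultimately show ?thesis
    using lebesgue_on_to_lborel(1)[OF g(1), of K f] K by (auto simp: compact_imp_closed)
qed

section \<open>The fundamental lemma of the calculus of variations\<close>

text \<open>Boxes form an intersection-stable generator, so the vanishing of the integral spreads from
boxes to all Borel sets; the hypothesis on the whole space starts the step to complements.\<close>

lemma AE_zero_of_box_integrals:
  fixes w :: "'a::euclidean_space \<Rightarrow> real"
  assumes w: "integrable lborel w" and box: "\<And>a c. (LINT x:box a c|lborel. w x) = 0" and tot: "(LINT x|lborel. w x) = 0"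
  shows "AE x in lborel. w x = 0"
proof (rule density_unique_real[OF w integrable_zero])
  fix A :: "'a set" assume A: "A \<in> sets lborel"
  let ?E = "range (\<lambda>(a, b). box a b::'a set)"
  have si: "set_integrable lborel A w" if "A \<in> sets borel" for A
    using integrable_mult_indicator[OF _ w, of A] that by (simp add: set_integrable_def)
  have "sets (borel::'a measure) = sets (sigma UNIV ?E)"
    by (subst borel_eq_box) (rule refl)
  then have sig: "sigma_sets UNIV ?E = sets borel" by (simp add: sets_measure_of)
  have "Int_stable ?E" by (auto simp: Int_stable_def box_Int_box)
  moreover have "?E \<subseteq> Pow UNIV" by simp
  moreover have "A \<in> sigma_sets UNIV ?E" using A sig by simp
  ultimately have "(LINT x:A|lborel. w x) = 0"
  proof (induction rule: sigma_sets_induct_disjoint)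
    case (basic A)
    then show ?case using box by auto
  next
    case empty
    show ?case by (simp add: set_lebesgue_integral_def)
  next
    case (compl A)
    then have Ab: "A \<in> sets borel" using sig by simp
    have "(LINT x:A \<union> (UNIV - A)|lborel. w x) = (LINT x:A|lborel. w x) + (LINT x:UNIV - A|lborel. w x)"
      by (rule set_integral_Un) (use Ab in \<open>auto intro!: si\<close>)
    moreover have "A \<union> (UNIV - A) = UNIV" by auto
    ultimately show ?case using compl tot by (simp add: set_lebesgue_integral_def)
  next
    case (union A)
    have Ab: "A i \<in> sets borel" for i using union(2) sig by auto
    have "(LINT x:(\<Union>i. A i)|lborel. w x) = (\<Sum>i. (LINT x:A i|lborel. w x))"
    proof (rule lebesgue_integral_countable_add)
      show "\<And>i j. i \<noteq> j \<Longrightarrow> A i \<inter> A j = {}" using union(1) by (auto simp: disjoint_family_on_def)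
      show "set_integrable lborel (\<Union> (range A)) w" using Ab by (intro si) auto
    qed (use Ab in auto)
    then show ?case using union(3) by simp
  qed
  then show "(LINT x:A|lborel. w x) = (LINT x:A|lborel. 0)"
    by (simp add: set_lebesgue_integral_def)
qed

text \<open>The bumps \<open>box_bump\<close> converge to the indicator of a box, so the integral over every box whose
closure lies in \<open>V\<close> vanishes.\<close>

lemma fundamental_lemma_of_variations:
  fixes w :: "'a::euclidean_space \<Rightarrow> real"
  assumes V: "open V" and [measurable]: "w \<in> borel_measurable borel"
    and loc: "\<And>K. compact K \<Longrightarrow> K \<subseteq> V \<Longrightarrow> integrable lborel (\<lambda>x. indicator K x *\<^sub>R w x)"
    and test: "\<And>\<phi>. \<phi> \<in> test_functions V \<Longrightarrow> (LINT x|lborel. w x * \<phi> x) = 0"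
  shows "AE x in lborel. x \<in> V \<longrightarrow> w x = 0"
proof -
  have box: "(LINT x:box a c|lborel. w x) = 0" if ac: "cbox a c \<subseteq> V" for a c
  proof -
    have "(\<lambda>n. LINT x|lborel. w x * box_bump (1 / real (Suc n)) a c x) \<longlonglongrightarrow> (LINT x|lborel. w x * indicator (box a c) x)"
    proof (rule integral_dominated_convergence)
      show "integrable lborel (\<lambda>x. norm (indicator (cbox a c) x *\<^sub>R w x))"
        using ac by (intro integrable_norm loc) auto
      show "AE x in lborel. (\<lambda>n. w x * box_bump (1 / real (Suc n)) a c x) \<longlonglongrightarrow> w x * indicator (box a c) x"
        by (intro AE_I2 tendsto_mult tendsto_const box_bump_tendsto)
      show "AE x in lborel. norm (w x * box_bump (1 / real (Suc n)) a c x) \<le> norm (indicator (cbox a c) x *\<^sub>R w x)" for n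
      proof (rule AE_I2)
        fix x
        show "norm (w x * box_bump (1 / real (Suc n)) a c x) \<le> norm (indicator (cbox a c) x *\<^sub>R w x)"
        proof (cases "x \<in> box a c")
          case True
          then have "x \<in> cbox a c" using box_subset_cbox by blast
          then show ?thesis
            using box_bump_bounds[of "1 / real (Suc n)" a c x] by (simp add: abs_mult mult_left_le)
        qed (simp add: box_bump_outside)
      qed
      have "continuous_on UNIV (box_bump (1 / real (Suc n)) a c)" for n
        using box_bump_test[of "1 / real (Suc n)" a c UNIV] by (auto intro: test_function_continuous)
      then have [measurable]: "box_bump (1 / real (Suc n)) a c \<in> borel_measurable borel" for n
        by (rule borel_measurable_continuous_onI)
      show "(\<lambda>x. w x * box_bump (1 / real (Suc n)) a c x) \<in> borel_measurable lborel" for n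
        by measurable
    qed measurable
    moreover have "(LINT x|lborel. w x * box_bump (1 / real (Suc n)) a c x) = 0" for n
      by (intro test box_bump_test ac) auto
    ultimately have "(LINT x|lborel. w x * indicator (box a c) x) = 0"
      by (simp add: LIMSEQ_const_iff)
    then show ?thesis by (simp add: set_lebesgue_integral_def mult.commute)
  qed
  obtain \<D> where D: "countable \<D>" "\<D> \<subseteq> Pow V" "\<And>X. X \<in> \<D> \<Longrightarrow> \<exists>a b. X = cbox a b" "\<Union>\<D> = V"
    using open_countable_Union_open_cbox[OF V] by metis
  have "AE x in lborel. x \<in> X \<longrightarrow> w x = 0" if X: "X \<in> \<D>" for X
  proof -
    obtain a c where ac: "X = cbox a c" using D X by blast
    have sub: "cbox a c \<subseteq> V" using D X ac by auto
    have int: "integrable lborel (\<lambda>x. indicator (cbox a c) x *\<^sub>R w x)"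
      using sub by (intro loc) auto
    have nul: "AE x in lborel. x \<notin> cbox a c - box a c"
      by (rule AE_not_in) (simp add: null_sets_def emeasure_Diff box_subset_cbox emeasure_lborel_cbox_eq emeasure_lborel_box_eq)
    have eq: "(LINT x:box a' c'|lborel. indicator (cbox a c) x *\<^sub>R w x) = 0" for a' c'
    proof -
      obtain a'' c'' where i: "box a' c' \<inter> box a c = box a'' c''"
        using that[OF box_Int_box] .
      have "(LINT x:box a' c'|lborel. indicator (cbox a c) x *\<^sub>R w x) = (LINT x:box a'' c''|lborel. w x)"
        unfolding set_lebesgue_integral_def i[symmetric]
        using nul box_subset_cbox[of a c]
        by (intro integral_cong_AE) (auto elim!: eventually_mono simp: indicator_def)
      moreover have "(LINT x:box a'' c''|lborel. w x) = 0"
      proof (cases "box a'' c'' = {}")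
        case True
        then show ?thesis by (simp add: set_lebesgue_integral_def)
      next
        case False
        have "box a'' c'' \<subseteq> cbox a c" using i box_subset_cbox by blast
        then have "closure (box a'' c'') \<subseteq> cbox a c" by (intro closure_minimal) auto
        then show ?thesis using sub False by (intro box) (simp add: closure_box)
      qed
      ultimately show ?thesis by simp
    qed
    have "(LINT x|lborel. indicator (cbox a c) x *\<^sub>R w x) = (LINT x:box a c|lborel. w x)"
        unfolding set_lebesgue_integral_def
        using nul box_subset_cbox[of a c]
        by (intro integral_cong_AE) (auto elim!: eventually_mono simp: indicator_def)
    then have tot: "(LINT x|lborel. indicator (cbox a c) x *\<^sub>R w x) = 0"
      using box[OF sub] by simp
    have "AE x in lborel. indicator (cbox a c) x *\<^sub>R w x = 0"
      by (rule AE_zero_of_box_integrals[OF int eq tot])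
    then show ?thesis by eventually_elim (auto simp: ac)
  qed
  then have "AE x in lborel. \<forall>X\<in>\<D>. x \<in> X \<longrightarrow> w x = 0"
    by (intro AE_ball_countable[OF D(1), THEN iffD2] ballI)
  then show ?thesis
    by eventually_elim (use D(4) in blast)
qed

section \<open>Integrals against test functions\<close>

lemma lborel_translate:
  fixes f :: "'a::euclidean_space \<Rightarrow> 'b::{banach, second_countable_topology}"
  assumes [measurable]: "f \<in> borel_measurable borel"
  shows "(LINT x|lborel. f (x + y)) = (LINT x|lborel. f x)"
    and "integrable lborel (\<lambda>x. f (x + y)) \<longleftrightarrow> integrable lborel f"
proof -
  have "(LINT x|lborel. f x) = (LINT x|distr lborel borel ((+) y). f x)" by (simp add: lborel_distr_plus)
  also have "\<dots> = (LINT x|lborel. f (y + x))" by (rule integral_distr) auto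
  finally show "(LINT x|lborel. f (x + y)) = (LINT x|lborel. f x)" by (simp add: add.commute)
  have "integrable lborel f \<longleftrightarrow> integrable (distr lborel borel ((+) y)) f" by (simp add: lborel_distr_plus)
  also have "\<dots> \<longleftrightarrow> integrable lborel (\<lambda>x. f (y + x))" by (rule integrable_distr_eq) auto
  finally show "integrable lborel (\<lambda>x. f (x + y)) \<longleftrightarrow> integrable lborel f" by (simp add: add.commute)
qed

lemma borel_measurable_nth [measurable]:
  "f \<in> borel_measurable M \<Longrightarrow> (\<lambda>x. f x $ i) \<in> borel_measurable M"
  for f :: "_ \<Rightarrow> 'b::euclidean_space ^ 'n"
  by (erule measurable_compose) (intro borel_measurable_continuous_onI continuous_intros)

lemma test_function_zero: "\<phi> \<in> test_functions U \<Longrightarrow> x \<notin> closure {x. \<phi> x \<noteq> 0} \<Longrightarrow> \<phi> x = 0"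
  using closure_subset[of "{x. \<phi> x \<noteq> 0}"] by blast

lemma test_function_outside: "\<phi> \<in> test_functions U \<Longrightarrow> x \<notin> U \<Longrightarrow> \<phi> x = 0"
  using test_function_zero[of \<phi> U x] unfolding test_functions_def by blast

lemma test_functionI:
  assumes "\<And>k. k_smooth k \<phi>" "\<And>x. x \<notin> T \<Longrightarrow> \<phi> x = 0" "compact T" "T \<subseteq> U"
  shows "\<phi> \<in> test_functions U"
proof -
  have "closure {x. \<phi> x \<noteq> 0} \<subseteq> T"
    using assms(2,3) by (intro closure_minimal compact_imp_closed) auto
  then show ?thesis
    using assms unfolding test_functions_def
    by (auto simp: compact_eq_bounded_closed intro: bounded_subset)
qed

lemma test_functions_mono: "U \<subseteq> V \<Longrightarrow> test_functions U \<subseteq> test_functions V"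
  by (auto simp: test_functions_def)

lemma test_function_borel: "\<phi> \<in> test_functions U \<Longrightarrow> \<phi> \<in> borel_measurable borel"
  by (intro borel_measurable_continuous_onI test_function_continuous)

lemma test_function_bounded:
  assumes "\<phi> \<in> test_functions U"
  obtains B where "0 < B" "\<And>x. \<bar>\<phi> x\<bar> \<le> B"
proof -
  have "compact (\<phi> ` closure {x. \<phi> x \<noteq> 0})"
    using assms by (intro compact_continuous_image test_function_continuous) (auto simp: test_functions_def)
  then obtain B where B: "0 < B" "\<And>x. x \<in> closure {x. \<phi> x \<noteq> 0} \<Longrightarrow> \<bar>\<phi> x\<bar> \<le> B"
    by (auto dest!: compact_imp_bounded simp: bounded_pos)
  have "\<bar>\<phi> x\<bar> \<le> B" for x
    using B test_function_zero[OF assms, of x] by (cases "x \<in> closure {x. \<phi> x \<noteq> 0}") auto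
  then show ?thesis using B(1) that by blast
qed

text \<open>The support does not grow, because a function vanishing on an open set has zero derivative there.\<close>

lemma test_function_partial:
  assumes \<phi>: "\<phi> \<in> test_functions U" and b: "b \<in> Basis"
  shows "(\<lambda>x. frechet_derivative \<phi> (at x) b) \<in> test_functions U"
proof (rule test_functionI)
  show "k_smooth k (\<lambda>x. frechet_derivative \<phi> (at x) b)" for k
    using test_function_smooth[OF \<phi>, of "Suc k"] b by simp
  fix x assume x: "x \<notin> closure {x. \<phi> x \<noteq> 0}"
  have "((\<lambda>x. 0) has_derivative (\<lambda>y. 0)) (at x)" by simp
  then have "(\<phi> has_derivative (\<lambda>y. 0)) (at x)"
  proof (rule has_derivative_transform_within_open)
    show "open (- closure {x. \<phi> x \<noteq> 0})" by (rule open_Compl[OF closed_closure])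
    show "x \<in> - closure {x. \<phi> x \<noteq> 0}" using x by (rule Compl_iff[THEN iffD2])
    show "0 = \<phi> z" if "z \<in> - closure {x. \<phi> x \<noteq> 0}" for z
      using test_function_zero[OF \<phi> ComplD[OF that]] by (rule sym)
  qed
  from frechet_derivative_at[OF this] show "frechet_derivative \<phi> (at x) b = 0" by metis
next
  show "compact (closure {x. \<phi> x \<noteq> 0})" "closure {x. \<phi> x \<noteq> 0} \<subseteq> U"
    using \<phi> by (simp_all add: test_functions_def)
qed

lemma test_function_integrable:
  fixes g :: "'a::euclidean_space \<Rightarrow> 'b::euclidean_space"
  assumes \<phi>: "\<phi> \<in> test_functions U" and [measurable]: "g \<in> borel_measurable borel"
    and loc: "\<And>K. compact K \<Longrightarrow> K \<subseteq> U \<Longrightarrow> integrable lborel (\<lambda>x. indicator K x *\<^sub>R g x)"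
  shows "integrable lborel (\<lambda>x. \<phi> x *\<^sub>R g x)"
proof -
  obtain B where B: "0 < B" "\<And>x. \<bar>\<phi> x\<bar> \<le> B" using test_function_bounded[OF \<phi>] by blast
  have m: "\<phi> \<in> borel_measurable borel" by (rule test_function_borel[OF \<phi>])
  let ?K = "closure {x. \<phi> x \<noteq> 0}"
  have "compact ?K" "?K \<subseteq> U" using \<phi> by (simp_all add: test_functions_def)
  then have "integrable lborel (\<lambda>x. indicator ?K x *\<^sub>R g x)" by (rule loc)
  from integrable_scaleR_right[OF integrable_norm[OF this]]
  have "integrable lborel (\<lambda>x. B *\<^sub>R norm (indicator ?K x *\<^sub>R g x))" .
  then show ?thesis
  proof (rule Bochner_Integration.integrable_bound)
    show "AE x in lborel. norm (\<phi> x *\<^sub>R g x) \<le> norm (B *\<^sub>R norm (indicator ?K x *\<^sub>R g x))"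
    proof (rule AE_I2)
      fix x
      show "norm (\<phi> x *\<^sub>R g x) \<le> norm (B *\<^sub>R norm (indicator ?K x *\<^sub>R g x))"
      proof (cases "x \<in> ?K")
        case True
        have "norm (\<phi> x *\<^sub>R g x) = \<bar>\<phi> x\<bar> * norm (g x)" by simp
        also have "\<dots> \<le> B * norm (g x)"
          by (intro mult_right_mono B(2) norm_ge_zero)
        also have "\<dots> = norm (B *\<^sub>R norm (indicator ?K x *\<^sub>R g x))"
          unfolding indicator_simps(1)[OF True] using B(1) by simp
        finally show ?thesis .
      next
        case False
        then have "\<phi> x = 0" by (rule test_function_zero[OF \<phi>])
        then show ?thesis by (simp only: scaleR_zero_left norm_zero norm_ge_zero)
      qed
    qed
    show "(\<lambda>x. \<phi> x *\<^sub>R g x) \<in> borel_measurable lborel"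
      using m assms(2) by (simp add: borel_measurable_scaleR)
  qed
qed

section \<open>Weak gradients\<close>

text \<open>The integration by parts formula, transferred to Borel representatives on the whole space.\<close>

lemma has_weak_gradient_representative:
  assumes wg: "has_weak_gradient u D U" and U: "open U" and \<phi>: "\<phi> \<in> test_functions U"
    and [measurable]: "u' \<in> borel_measurable borel" "D' \<in> borel_measurable borel"
    and ae: "AE x in lborel. x \<in> U \<longrightarrow> u' x = u x" "AE x in lborel. x \<in> U \<longrightarrow> D' x = D x"
  shows "(LINT x|lborel. u' x $ i * frechet_derivative \<phi> (at x) (axis j 1)) = - (LINT x|lborel. D' x $ i $ j * \<phi> x)"
proof -
  let ?\<psi> = "\<lambda>x. frechet_derivative \<phi> (at x) (axis j 1)"
  have \<psi>: "?\<psi> \<in> test_functions U"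
    by (rule test_function_partial[OF \<phi>]) (simp add: axis_in_Basis_iff)
  note [measurable] = test_function_borel[OF \<phi>] test_function_borel[OF \<psi>]
  have mu: "u \<in> borel_measurable (lebesgue_on U)" "D \<in> borel_measurable (lebesgue_on U)"
    using wg U by (auto simp: has_weak_gradient_def intro: locally_integrable_measurable)
  have b: "f \<in> borel_measurable borel \<Longrightarrow> f \<in> borel_measurable (lebesgue_on U)" for f :: "_ \<Rightarrow> real"
  proof -
    assume "f \<in> borel_measurable borel"
    then have "f \<in> borel_measurable lborel" by simp
    then have "f \<in> borel_measurable lebesgue" by (rule measurable_completion)
    then show ?thesis by (rule measurable_restrict_space1)
  qed
  have z: "x \<notin> U \<Longrightarrow> \<phi> x = 0" "x \<notin> U \<Longrightarrow> ?\<psi> x = 0" for x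
    using test_function_outside[OF \<phi>] test_function_outside[OF \<psi>] by blast+
  have mc: "(\<lambda>x. u x $ i) \<in> borel_measurable (lebesgue_on U)" "(\<lambda>x. D x $ i $ j) \<in> borel_measurable (lebesgue_on U)"
    using mu by (auto intro!: borel_measurable_nth)
  have mc': "(\<lambda>x. u' x $ i) \<in> borel_measurable borel" "(\<lambda>x. D' x $ i $ j) \<in> borel_measurable borel"
    by (auto intro!: borel_measurable_nth)
  have e1: "(LINT x|lebesgue_on U. u x $ i * ?\<psi> x) = (LINT x|lborel. indicator U x *\<^sub>R (u' x $ i * ?\<psi> x))"
    proof (rule lebesgue_on_to_lborel(2))
    show "(\<lambda>x. u' x $ i * ?\<psi> x) \<in> borel_measurable borel"
      by (rule borel_measurable_times[OF mc'(1) test_function_borel[OF \<psi>]])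
    show "(\<lambda>x. u x $ i * ?\<psi> x) \<in> borel_measurable (lebesgue_on U)"
      by (rule borel_measurable_times[OF mc(1) b[OF test_function_borel[OF \<psi>]]])
    show "AE x in lborel. x \<in> U \<longrightarrow> u' x $ i * ?\<psi> x = u x $ i * ?\<psi> x"
      using ae(1) by eventually_elim simp
  qed (use U in simp)
  have e2: "(LINT x|lebesgue_on U. D x $ i $ j * \<phi> x) = (LINT x|lborel. indicator U x *\<^sub>R (D' x $ i $ j * \<phi> x))"
    proof (rule lebesgue_on_to_lborel(2))
    show "(\<lambda>x. D' x $ i $ j * \<phi> x) \<in> borel_measurable borel"
      by (rule borel_measurable_times[OF mc'(2) test_function_borel[OF \<phi>]])
    show "(\<lambda>x. D x $ i $ j * \<phi> x) \<in> borel_measurable (lebesgue_on U)"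
      by (rule borel_measurable_times[OF mc(2) b[OF test_function_borel[OF \<phi>]]])
    show "AE x in lborel. x \<in> U \<longrightarrow> D' x $ i $ j * \<phi> x = D x $ i $ j * \<phi> x"
      using ae(2) by eventually_elim simp
  qed (use U in simp)
  have e3: "indicator U x *\<^sub>R (u' x $ i * ?\<psi> x) = u' x $ i * ?\<psi> x" for x
    using z(2)[of x] by (cases "x \<in> U") auto
  have e4: "indicator U x *\<^sub>R (D' x $ i $ j * \<phi> x) = D' x $ i $ j * \<phi> x" for x
    using z(1)[of x] by (cases "x \<in> U") auto
  have "(LINT x|lebesgue_on U. u x $ i * ?\<psi> x) = - (LINT x|lebesgue_on U. D x $ i $ j * \<phi> x)"
    using wg \<phi> unfolding has_weak_gradient_def by blast
  then show ?thesis unfolding e1 e2 e3 e4 .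
qed

text \<open>Used with the base as smaller domain: there every displacement of finite energy equals \<open>u0\<close>, and
hence has the weak gradient of \<open>u0\<close>, whose norm is a fixed integrable function.\<close>

lemma weak_gradient_unique:
  assumes wg: "has_weak_gradient u D U" "has_weak_gradient u0 D0 U0" and U: "open U" "open U0" "U \<subseteq> U0"
    and ae: "AE x in lborel. x \<in> U \<longrightarrow> u x = u0 x"
  shows "AE x in lborel. x \<in> U \<longrightarrow> D x = D0 x"
proof -
  have li: "locally_integrable_on u0 U0" "locally_integrable_on D U" "locally_integrable_on D0 U0"
    using wg by (auto simp: has_weak_gradient_def)
  obtain u' where u': "u' \<in> borel_measurable borel" "AE x in lborel. x \<in> U0 \<longrightarrow> u' x = u0 x"
    using locally_integrable_representative[OF li(1) U(2)] by blast
  obtain D' where D': "D' \<in> borel_measurable borel" "AE x in lborel. x \<in> U \<longrightarrow> D' x = D x"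
    using locally_integrable_representative[OF li(2) U(1)] by blast
  obtain D0' where D0': "D0' \<in> borel_measurable borel" "AE x in lborel. x \<in> U0 \<longrightarrow> D0' x = D0 x"
    using locally_integrable_representative[OF li(3) U(2)] by blast
  have uU: "AE x in lborel. x \<in> U \<longrightarrow> u' x = u x"
    using u'(2) ae by eventually_elim (use U in auto)
  have K: "integrable lborel (\<lambda>x. indicator K x *\<^sub>R D' x)" "integrable lborel (\<lambda>x. indicator K x *\<^sub>R D0' x)" if "compact K" "K \<subseteq> U" for K
    using locally_integrable_representative_on_compact[OF li(2) U(1) D' that]
       locally_integrable_representative_on_compact[OF li(3) U(2) D0' that(1)] that U by auto
  have mc: "(\<lambda>x. D' x $ i $ j) \<in> borel_measurable borel" "(\<lambda>x. D0' x $ i $ j) \<in> borel_measurable borel" for i j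
    using D' D0' by (auto intro!: borel_measurable_nth)
  have "AE x in lborel. x \<in> U \<longrightarrow> D' x $ i $ j - D0' x $ i $ j = 0" for i j
  proof (rule fundamental_lemma_of_variations[OF U(1)])
    show "(\<lambda>x. D' x $ i $ j - D0' x $ i $ j) \<in> borel_measurable borel"
      using mc by (rule borel_measurable_diff)
    have lin: "bounded_linear (\<lambda>A::real^'a^'b. A $ i $ j)"
      by (rule bounded_linear_compose[OF bounded_linear_vec_nth bounded_linear_vec_nth])
    show "integrable lborel (\<lambda>x. indicator K x *\<^sub>R (D' x $ i $ j - D0' x $ i $ j))" if "compact K" "K \<subseteq> U" for K
      using integrable_bounded_linear[OF lin Bochner_Integration.integrable_diff[OF K[OF that]]]
      by (simp add: algebra_simps)
    fix \<phi> assume \<phi>: "\<phi> \<in> test_functions U"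
    then have \<phi>0: "\<phi> \<in> test_functions U0" using test_functions_mono U by blast
    have i: "integrable lborel (\<lambda>x. D' x $ i $ j * \<phi> x)" "integrable lborel (\<lambda>x. D0' x $ i $ j * \<phi> x)"
      using integrable_bounded_linear[OF lin test_function_integrable[OF \<phi> D'(1) K(1)]]
        integrable_bounded_linear[OF lin test_function_integrable[OF \<phi> D0'(1) K(2)]] by (auto simp: mult.commute)
    have "(LINT x|lborel. D' x $ i $ j * \<phi> x) = (LINT x|lborel. D0' x $ i $ j * \<phi> x)"
      using has_weak_gradient_representative[OF wg(1) U(1) \<phi> u'(1) D'(1) uU D'(2), of i j]
        has_weak_gradient_representative[OF wg(2) U(2) \<phi>0 u'(1) D0'(1) u'(2) D0'(2), of i j] by simp
    then show "(LINT x|lborel. (D' x $ i $ j - D0' x $ i $ j) * \<phi> x) = 0"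
      using i by (simp add: left_diff_distrib)
  qed
  then have "AE x in lborel. \<forall>i\<in>UNIV. \<forall>j\<in>UNIV. x \<in> U \<longrightarrow> D' x $ i $ j - D0' x $ i $ j = 0"
    by (intro AE_finite_allI) auto
  with D'(2) D0'(2) show ?thesis
    by eventually_elim (use U in \<open>auto simp: vec_eq_iff\<close>)
qed

lemma sobolev_weak_gradient:
  assumes "u \<in> sobolev p U"
  shows "has_weak_gradient u (weak_gradient U u) U"
proof -
  obtain D where "has_weak_gradient u D U" using assms by (auto simp: sobolev_def)
  then show ?thesis unfolding weak_gradient_def by (rule someI[where P = "\<lambda>D. has_weak_gradient u D U"])
qed

section \<open>Integrating a weak gradient along segments\<close>

lemma closed_segment_translate: "closed_segment x (x + y) = (\<lambda>s. x + s *\<^sub>R y) ` {0..1}"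
  for x y :: "'a::euclidean_space"
  unfolding closed_segment_image_interval by (intro image_cong) (auto simp: algebra_simps)

lemma open_segment_inside:
  fixes U :: "'a::euclidean_space set"
  assumes "open U"
  shows "open {x. closed_segment x (x + y) \<subseteq> U}"
proof (rule openI)
  fix x assume "x \<in> {x. closed_segment x (x + y) \<subseteq> U}"
  then obtain e where e: "0 < e" "(\<Union>p\<in>closed_segment x (x + y). ball p e) \<subseteq> U"
    using compact_subset_open_imp_ball_epsilon_subset[OF compact_segment assms] by blast
  have "closed_segment x' (x' + y) \<subseteq> U" if "x' \<in> ball x e" for x'
  proof -
    have "x' + s *\<^sub>R y \<in> ball (x + s *\<^sub>R y) e" for s using that by (simp add: dist_norm)
    then show ?thesis using e(2) unfolding closed_segment_translate by blast
  qed
  then show "\<exists>T>0. ball x T \<subseteq> {x. closed_segment x (x + y) \<subseteq> U}"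
    using e(1) by blast
qed

text \<open>If \<open>\<phi>\<close> lives where the segments from \<open>x\<close> to \<open>x + y\<close> stay in \<open>U\<close>, then sweeping its support
along these segments remains a compact subset of \<open>U\<close>.\<close>

lemma test_function_segment_average:
  assumes \<phi>: "\<phi> \<in> test_functions {x. closed_segment x (x + y) \<subseteq> U}"
  shows "(\<lambda>z. integral {0..1} (\<lambda>s. \<phi> (z - s *\<^sub>R y))) \<in> test_functions U"
proof (rule test_functionI)
  let ?S = "closure {x. \<phi> x \<noteq> 0}"
  let ?T = "(\<lambda>(x, s). x + s *\<^sub>R y) ` (?S \<times> {0..1::real})"
  show "k_smooth k (\<lambda>z. integral {0..1} (\<lambda>s. \<phi> (z - s *\<^sub>R y)))" for k
    using \<phi> by (intro k_smooth_segment_average test_function_smooth)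
  show "compact ?T"
    using \<phi> by (intro compact_continuous_image compact_Times) (auto simp: test_functions_def case_prod_beta intro!: continuous_intros)
  have "x + s *\<^sub>R y \<in> U" if "x \<in> ?S" "s \<in> {0..1}" for x s
  proof -
    have "closed_segment x (x + y) \<subseteq> U" using \<phi> that by (auto simp: test_functions_def)
    then show ?thesis using that(2) unfolding closed_segment_translate by blast
  qed
  then show "?T \<subseteq> U" by auto
  fix z assume z: "z \<notin> ?T"
  have "\<phi> (z - s *\<^sub>R y) = 0" if "s \<in> {0..1}" for s
  proof (rule test_function_zero[OF \<phi>], rule notI)
    assume "z - s *\<^sub>R y \<in> ?S"
    then have "(\<lambda>(x, s). x + s *\<^sub>R y) (z - s *\<^sub>R y, s) \<in> ?T" using that by (intro imageI) simp
    then show False using z by simp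
  qed
  then have "integral {0..1} (\<lambda>s. \<phi> (z - s *\<^sub>R y)) = integral {0..1} (\<lambda>s::real. 0)"
    by (intro integral_cong) auto
  then show "integral {0..1} (\<lambda>s. \<phi> (z - s *\<^sub>R y)) = 0" by simp
qed

text \<open>The average telescopes in its own direction. Testing a weak gradient with it turns the
infinitesimal integration by parts into a finite difference.\<close>

lemma segment_average_directional_derivative:
  fixes \<phi> :: "'a::euclidean_space \<Rightarrow> real"
  assumes "k_smooth 1 \<phi>"
  shows "frechet_derivative (\<lambda>z. integral {0..1} (\<lambda>s. \<phi> (z - s *\<^sub>R y))) (at x) y = \<phi> x - \<phi> (x - y)"
proof -
  have der: "(\<phi> has_derivative frechet_derivative \<phi> (at x)) (at x)" for x
    using assms by (simp add: frechet_derivative_works)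
  have "((\<lambda>s. frechet_derivative \<phi> (at (x - s *\<^sub>R y)) y) has_integral (- \<phi> (x - 1 *\<^sub>R y) - (- \<phi> (x - 0 *\<^sub>R y)))) {0..1}"
  proof (rule fundamental_theorem_of_calculus)
    fix s :: real
    have "((\<lambda>s. x - s *\<^sub>R y) has_derivative (\<lambda>h. - (h *\<^sub>R y))) (at s within {0..1})"
      by (auto intro!: derivative_eq_intros)
    from has_derivative_compose[OF this der]
    have "((\<lambda>s. - \<phi> (x - s *\<^sub>R y)) has_derivative (\<lambda>h. - frechet_derivative \<phi> (at (x - s *\<^sub>R y)) (- (h *\<^sub>R y)))) (at s within {0..1})"
      by (rule has_derivative_minus)
    moreover have "linear (frechet_derivative \<phi> (at (x - s *\<^sub>R y)))"
      using der by (blast intro: has_derivative_linear)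
    ultimately show "((\<lambda>s. - \<phi> (x - s *\<^sub>R y)) has_vector_derivative frechet_derivative \<phi> (at (x - s *\<^sub>R y)) y) (at s within {0..1})"
      by (simp add: has_vector_derivative_def linear_neg linear_cmul)
  qed simp
  then have "integral {0..1} (\<lambda>s. frechet_derivative \<phi> (at (x - s *\<^sub>R y)) y) = \<phi> x - \<phi> (x - y)"
    by (simp add: integral_unique)
  moreover have "frechet_derivative (\<lambda>z. integral {0..1} (\<lambda>s. \<phi> (z - s *\<^sub>R y))) (at x) = (\<lambda>v. integral {0..1} (\<lambda>s. frechet_derivative \<phi> (at (x - s *\<^sub>R y)) v))"
    using frechet_derivative_at[OF has_derivative_segment_average[OF assms]] by metis
  ultimately show ?thesis by metis
qed

lemma integrable_segment:
  fixes d :: "'a::euclidean_space \<Rightarrow> real"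
  assumes d: "integrable lborel d"
  shows "integrable (lborel \<Otimes>\<^sub>M lborel) (\<lambda>(x, s). indicator {0..1::real} s * d (x + s *\<^sub>R y))"
proof (rule integrableI_bounded)
  have [measurable]: "d \<in> borel_measurable borel" using d by auto
  show "(\<lambda>(x, s). indicator {0..1::real} s * d (x + s *\<^sub>R y)) \<in> borel_measurable (lborel \<Otimes>\<^sub>M lborel)"
    by measurable
  have "(\<integral>\<^sup>+ p. ennreal (norm (case p of (x, s) \<Rightarrow> indicator {0..1::real} s * d (x + s *\<^sub>R y))) \<partial>(lborel \<Otimes>\<^sub>M lborel))
      = (\<integral>\<^sup>+ x. (\<integral>\<^sup>+ s. ennreal (norm (indicator {0..1::real} s * d (x + s *\<^sub>R y))) \<partial>lborel) \<partial>lborel)"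
    by (subst lborel.nn_integral_fst[symmetric]) (auto simp: split_beta')
  also have "\<dots> = (\<integral>\<^sup>+ x. (\<integral>\<^sup>+ s. ennreal (norm (d (x + s *\<^sub>R y))) * indicator {0..1::real} s \<partial>lborel) \<partial>lborel)"
    by (intro nn_integral_cong) (auto simp: indicator_def)
  also have "\<dots> = (\<integral>\<^sup>+ x. ennreal (norm (d x)) \<partial>lborel)"
    by (rule nn_integral_segment) measurable
  also have "\<dots> < \<infinity>" using d by (simp add: integrable_iff_bounded)
  finally show "(\<integral>\<^sup>+ p. ennreal (norm (case p of (x, s) \<Rightarrow> indicator {0..1::real} s * d (x + s *\<^sub>R y))) \<partial>(lborel \<Otimes>\<^sub>M lborel)) < \<infinity>" .
qed

text \<open>The adjoint of averaging along \<open>-y\<close> is averaging along \<open>y\<close>.\<close>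

lemma integral_segment_average:
  fixes d :: "'a::euclidean_space \<Rightarrow> real"
  assumes d: "integrable lborel d" and \<phi>: "\<phi> \<in> test_functions V"
  shows "(LINT x|lborel. d x * integral {0..1} (\<lambda>s. \<phi> (x - s *\<^sub>R y)))
       = (LINT x|lborel. (LINT s|lborel. indicator {0..1} s * d (x + s *\<^sub>R y)) * \<phi> x)"
proof -
  have [measurable]: "d \<in> borel_measurable borel" using d by auto
  have [measurable]: "\<phi> \<in> borel_measurable borel" by (rule test_function_borel[OF \<phi>])
  obtain B where B: "0 < B" "\<And>x. \<bar>\<phi> x\<bar> \<le> B" using test_function_bounded[OF \<phi>] by blast
  have inner: "integral {0..1} (\<lambda>s. \<phi> (x - s *\<^sub>R y)) = (LINT s|lborel. indicator {0..1} s * \<phi> (x - s *\<^sub>R y))" for x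
  proof -
    have "continuous_on {0..1} (\<lambda>s. \<phi> (x - s *\<^sub>R y))"
      by (intro continuous_on_compose2[OF test_function_continuous[OF \<phi>, of UNIV]] continuous_intros) auto
    then have "set_integrable lborel {0..1} (\<lambda>s. \<phi> (x - s *\<^sub>R y))"
      by (rule borel_integrable_atLeastAtMost')
    from set_borel_integral_eq_integral(2)[OF this] show ?thesis
      by (simp add: set_lebesgue_integral_def)
  qed
  have i1: "integrable (lborel \<Otimes>\<^sub>M lborel) (\<lambda>(x, s). indicator {0..1::real} s * (d x * \<phi> (x - s *\<^sub>R y)))"
  proof (rule Bochner_Integration.integrable_bound)
    show "integrable (lborel \<Otimes>\<^sub>M lborel) (\<lambda>p. B *\<^sub>R (case p of (x, s) \<Rightarrow> indicator {0..1::real} s * d (x + s *\<^sub>R 0)))"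
      by (intro integrable_scaleR_right integrable_segment d)
    show "AE p in lborel \<Otimes>\<^sub>M lborel. norm (case p of (x, s) \<Rightarrow> indicator {0..1::real} s * (d x * \<phi> (x - s *\<^sub>R y)))
      \<le> norm (B *\<^sub>R (case p of (x, s) \<Rightarrow> indicator {0..1::real} s * d (x + s *\<^sub>R 0)))"
    proof (rule AE_I2, clarify)
      fix x and s :: real
      have "\<bar>d x\<bar> * \<bar>\<phi> (x - s *\<^sub>R y)\<bar> \<le> B * \<bar>d x\<bar>"
        using mult_left_mono[OF B(2)[of "x - s *\<^sub>R y"], of "\<bar>d x\<bar>"] by (simp add: mult.commute)
      then show "norm (indicator {0..1::real} s * (d x * \<phi> (x - s *\<^sub>R y))) \<le> norm (B *\<^sub>R (indicator {0..1::real} s * d (x + s *\<^sub>R 0)))"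
        using B(1) by (simp add: abs_mult indicator_def)
    qed
  qed measurable
  have i2: "integrable (lborel \<Otimes>\<^sub>M lborel) (\<lambda>(x, s). indicator {0..1::real} s * (d (x + s *\<^sub>R y) * \<phi> x))"
  proof (rule Bochner_Integration.integrable_bound)
    show "integrable (lborel \<Otimes>\<^sub>M lborel) (\<lambda>p. B *\<^sub>R (case p of (x, s) \<Rightarrow> indicator {0..1::real} s * d (x + s *\<^sub>R y)))"
      by (intro integrable_scaleR_right integrable_segment d)
    show "AE p in lborel \<Otimes>\<^sub>M lborel. norm (case p of (x, s) \<Rightarrow> indicator {0..1::real} s * (d (x + s *\<^sub>R y) * \<phi> x))
      \<le> norm (B *\<^sub>R (case p of (x, s) \<Rightarrow> indicator {0..1::real} s * d (x + s *\<^sub>R y)))"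
    proof (rule AE_I2, clarify)
      fix x and s :: real
      have "\<bar>d (x + s *\<^sub>R y)\<bar> * \<bar>\<phi> x\<bar> \<le> B * \<bar>d (x + s *\<^sub>R y)\<bar>"
        using mult_left_mono[OF B(2)[of x], of "\<bar>d (x + s *\<^sub>R y)\<bar>"] by (simp add: mult.commute)
      then show "norm (indicator {0..1::real} s * (d (x + s *\<^sub>R y) * \<phi> x)) \<le> norm (B *\<^sub>R (indicator {0..1::real} s * d (x + s *\<^sub>R y)))"
        using B(1) by (simp add: abs_mult indicator_def)
    qed
  qed measurable
  have "(LINT x|lborel. d x * integral {0..1} (\<lambda>s. \<phi> (x - s *\<^sub>R y)))
      = (LINT x|lborel. (LINT s|lborel. indicator {0..1} s * (d x * \<phi> (x - s *\<^sub>R y))))"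
    unfolding inner by (subst integral_mult_right_zero[symmetric]) (simp add: mult.left_commute)
  also have "\<dots> = (LINT s|lborel. (LINT x|lborel. indicator {0..1} s * (d x * \<phi> (x - s *\<^sub>R y))))"
    by (rule lborel_pair.Fubini_integral[symmetric, OF i1])
  also have "\<dots> = (LINT s|lborel. (LINT x|lborel. indicator {0..1} s * (d (x + s *\<^sub>R y) * \<phi> x)))"
  proof (rule Bochner_Integration.integral_cong[OF refl])
    fix s :: real
    have "(LINT x|lborel. d x * \<phi> (x - s *\<^sub>R y)) = (LINT x|lborel. d (x + s *\<^sub>R y) * \<phi> ((x + s *\<^sub>R y) - s *\<^sub>R y))"
      by (rule lborel_translate(1)[symmetric]) measurable
    then show "(LINT x|lborel. indicator {0..1} s * (d x * \<phi> (x - s *\<^sub>R y))) = (LINT x|lborel. indicator {0..1} s * (d (x + s *\<^sub>R y) * \<phi> x))"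
      by simp
  qed
  also have "\<dots> = (LINT x|lborel. (LINT s|lborel. indicator {0..1} s * (d (x + s *\<^sub>R y) * \<phi> x)))"
    by (rule lborel_pair.Fubini_integral[OF i2])
  also have "\<dots> = (LINT x|lborel. (LINT s|lborel. indicator {0..1} s * d (x + s *\<^sub>R y)) * \<phi> x)"
    by (subst integral_mult_left_zero[symmetric]) (simp add: mult.assoc)
  finally show ?thesis .
qed

lemma frechet_derivative_axis_sum:
  fixes \<phi> :: "real^'d \<Rightarrow> real"
  assumes "\<phi> \<in> test_functions U"
  shows "frechet_derivative \<phi> (at x) y = (\<Sum>j\<in>UNIV. y $ j * frechet_derivative \<phi> (at x) (axis j 1))"
proof -
  have lin: "linear (frechet_derivative \<phi> (at x))"
    using test_function_derivative[OF assms] by (rule has_derivative_linear)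
  have "frechet_derivative \<phi> (at x) y = frechet_derivative \<phi> (at x) (\<Sum>j\<in>UNIV. y $ j *\<^sub>R axis j 1)"
    using basis_expansion[of y] by (simp add: scalar_mult_eq_scaleR)
  then show ?thesis by (simp add: linear_sum[OF lin] linear_cmul[OF lin])
qed

text \<open>Contracting the integration by parts formula twice with \<open>y\<close> leaves only the quadratic form of the
gradient, hence only its symmetric part.\<close>

lemma weak_gradient_quadratic_form:
  fixes u :: "real^'d \<Rightarrow> real^'d"
  assumes U: "open U" and wg: "has_weak_gradient u D U" and \<Phi>: "\<Phi> \<in> test_functions U"
    and v: "v \<in> borel_measurable borel" "AE x in lborel. x \<in> U \<longrightarrow> v x = u x"
    and d: "d \<in> borel_measurable borel" "AE x in lborel. x \<in> U \<longrightarrow> d x = y \<bullet> (D x *v y)"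
  shows "(LINT x|lborel. (v x \<bullet> y) * frechet_derivative \<Phi> (at x) y) = - (LINT x|lborel. d x * \<Phi> x)"
proof -
  have li: "locally_integrable_on u U" "locally_integrable_on D U" using wg by (auto simp: has_weak_gradient_def)
  obtain D' where D': "D' \<in> borel_measurable borel" "AE x in lborel. x \<in> U \<longrightarrow> D' x = D x"
    using locally_integrable_representative[OF li(2) U] by blast
  let ?\<psi> = "\<lambda>j x. frechet_derivative \<Phi> (at x) (axis j 1)"
  have \<psi>: "?\<psi> j \<in> test_functions U" for j
    by (rule test_function_partial[OF \<Phi>]) (simp add: axis_in_Basis_iff)
  have i1: "integrable lborel (\<lambda>x. v x $ i * ?\<psi> j x)" for i j
    using integrable_bounded_linear[OF bounded_linear_vec_nth[of i] test_function_integrable[OF \<psi>[of j] v(1) locally_integrable_representative_on_compact[OF li(1) U v]]]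
    by (simp add: mult.commute)
  have lin: "bounded_linear (\<lambda>A::real^'d^'d. A $ i $ j)" for i j
    by (rule bounded_linear_compose[OF bounded_linear_vec_nth bounded_linear_vec_nth])
  have i2: "integrable lborel (\<lambda>x. D' x $ i $ j * \<Phi> x)" for i j
    using integrable_bounded_linear[OF lin[of i j] test_function_integrable[OF \<Phi> D'(1) locally_integrable_representative_on_compact[OF li(2) U D']]]
    by (simp add: mult.commute)
  have e: "(LINT x|lborel. v x $ i * ?\<psi> j x) = - (LINT x|lborel. D' x $ i $ j * \<Phi> x)" for i j
    by (rule has_weak_gradient_representative[OF wg U \<Phi> v(1) D'(1) v(2) D'(2)])
  have "(LINT x|lborel. (v x \<bullet> y) * frechet_derivative \<Phi> (at x) y)
      = (LINT x|lborel. (\<Sum>i\<in>UNIV. \<Sum>j\<in>UNIV. (y $ i * y $ j) * (v x $ i * ?\<psi> j x)))"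
    unfolding frechet_derivative_axis_sum[OF \<Phi>, of _ y] inner_vec_def sum_product
    by (simp add: ac_simps)
  also have "\<dots> = (\<Sum>i\<in>UNIV. \<Sum>j\<in>UNIV. (y $ i * y $ j) * (LINT x|lborel. v x $ i * ?\<psi> j x))"
    using i1 by (simp add: Bochner_Integration.integral_sum)
  also have "\<dots> = - (\<Sum>i\<in>UNIV. \<Sum>j\<in>UNIV. (y $ i * y $ j) * (LINT x|lborel. D' x $ i $ j * \<Phi> x))"
    by (simp add: e sum_negf)
  also have "(\<Sum>i\<in>UNIV. \<Sum>j\<in>UNIV. (y $ i * y $ j) * (LINT x|lborel. D' x $ i $ j * \<Phi> x))
     = (LINT x|lborel. (\<Sum>i\<in>UNIV. \<Sum>j\<in>UNIV. (y $ i * y $ j) * (D' x $ i $ j * \<Phi> x)))"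
    using i2 by (simp add: Bochner_Integration.integral_sum)
  also have "\<dots> = (LINT x|lborel. (y \<bullet> (D' x *v y)) * \<Phi> x)"
    by (simp add: inner_vec_def matrix_vector_mult_def sum_distrib_left sum_distrib_right ac_simps)
  also have "\<dots> = (LINT x|lborel. d x * \<Phi> x)"
  proof (rule integral_cong_AE)
    have [measurable]: "\<Phi> \<in> borel_measurable borel" by (rule test_function_borel[OF \<Phi>])
    note [measurable] = D'(1) d(1)
    have "(\<lambda>x. y \<bullet> (D' x *v y)) \<in> borel_measurable borel"
      unfolding inner_vec_def matrix_vector_mult_def by simp
    then show "(\<lambda>x. y \<bullet> (D' x *v y) * \<Phi> x) \<in> borel_measurable lborel" by simp
    show "(\<lambda>x. d x * \<Phi> x) \<in> borel_measurable lborel" by simp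
    show "AE x in lborel. y \<bullet> (D' x *v y) * \<Phi> x = d x * \<Phi> x"
      using D'(2) d(2)
    proof eventually_elim
      case (elim x)
      then show ?case using test_function_outside[OF \<Phi>, of x] by (cases "x \<in> U") auto
    qed
  qed
  finally show ?thesis .
qed

text \<open>The fundamental theorem of calculus along almost every segment. Testing with the segment
average of \<open>\<phi>\<close> and moving the translation and the average onto the other factor shows that the difference of the
two sides is orthogonal to every test function.\<close>

lemma weak_gradient_difference:
  fixes u v :: "real^'d \<Rightarrow> real^'d"
  assumes U: "open U" and wg: "has_weak_gradient u D U"
    and v: "v \<in> borel_measurable borel" "AE x in lborel. x \<in> U \<longrightarrow> v x = u x"
    and d: "integrable lborel d" "AE x in lborel. x \<in> U \<longrightarrow> d x = y \<bullet> (D x *v y)"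
  shows "AE x in lborel. closed_segment x (x + y) \<subseteq> U \<longrightarrow>
     (v (x + y) - v x) \<bullet> y = (LINT s|lborel. indicator {0..1} s * d (x + s *\<^sub>R y))"
proof -
  let ?V = "{x. closed_segment x (x + y) \<subseteq> U}"
  let ?g = "\<lambda>x. LINT s|lborel. indicator {0..1} s * d (x + s *\<^sub>R y)"
  let ?w = "\<lambda>x. (v (x + y) - v x) \<bullet> y - ?g x"
  note [measurable] = v(1)
  have [measurable]: "d \<in> borel_measurable borel" using d by auto
  have mg: "?g \<in> borel_measurable borel" by measurable
  have li: "locally_integrable_on u U" using wg by (auto simp: has_weak_gradient_def)
  have ig: "integrable lborel ?g"
    using lborel_pair.integrable_fst'[OF integrable_segment[OF d(1), of y]] by simp
  have sub: "?V \<subseteq> U" by auto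
  have Kv: "integrable lborel (\<lambda>x. indicator K x *\<^sub>R v x)" if "compact K" "K \<subseteq> U" for K
    by (rule locally_integrable_representative_on_compact[OF li U v that])
  have Kvy: "integrable lborel (\<lambda>x. indicator K x *\<^sub>R v (x + y))" if "compact K" "K \<subseteq> ?V" for K
  proof -
    have K': "compact ((+) y ` K)" using that(1) by (rule compact_translation)
    have "(+) y ` K \<subseteq> U"
    proof (clarify)
      fix x assume "x \<in> K"
      then have "closed_segment x (x + y) \<subseteq> U" using that(2) by auto
      then show "y + x \<in> U" by (simp add: add.commute subset_iff)
    qed
    from Kv[OF K' this] have "integrable lborel (\<lambda>x. indicator ((+) y ` K) x *\<^sub>R v x)" .
    moreover have "(\<lambda>x. indicator ((+) y ` K) x *\<^sub>R v x) \<in> borel_measurable borel"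
      using borel_closed[OF compact_imp_closed[OF K']] v(1) by (intro borel_measurable_scaleR borel_measurable_indicator) simp_all
    ultimately have "integrable lborel (\<lambda>x. indicator ((+) y ` K) (x + y) *\<^sub>R v (x + y))"
      using lborel_translate(2)[of "\<lambda>x. indicator ((+) y ` K) x *\<^sub>R v x" y] by simp
    moreover have "indicator ((+) y ` K) (x + y) = (indicator K x :: real)" for x
      by (auto simp: indicator_def image_iff add.commute)
    ultimately show ?thesis by simp
  qed
  have "AE x in lborel. x \<in> ?V \<longrightarrow> ?w x = 0"
  proof (rule fundamental_lemma_of_variations)
    show "open ?V" by (rule open_segment_inside[OF U])
    show "?w \<in> borel_measurable borel" using mg by simp
    show "integrable lborel (\<lambda>x. indicator K x *\<^sub>R ?w x)" if K: "compact K" "K \<subseteq> ?V" for K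
    proof -
      have "integrable lborel (\<lambda>x. ((indicator K x *\<^sub>R v (x + y)) - (indicator K x *\<^sub>R v x)) \<bullet> y - indicator K x *\<^sub>R ?g x)"
        using K sub ig compact_imp_closed[OF K(1)]
        by (intro Bochner_Integration.integrable_diff integrable_inner_left Kv Kvy integrable_mult_indicator) auto
      then show ?thesis by (simp add: algebra_simps inner_diff_left)
    qed
    fix \<phi> assume \<phi>: "\<phi> \<in> test_functions ?V"
    let ?\<Phi> = "\<lambda>z. integral {0..1} (\<lambda>s. \<phi> (z - s *\<^sub>R y))"
    have \<Phi>: "?\<Phi> \<in> test_functions U" by (rule test_function_segment_average[OF \<phi>])
    have \<phi>U: "\<phi> \<in> test_functions U" using \<phi> test_functions_mono[OF sub] by blast
    have m\<phi>[measurable]: "\<phi> \<in> borel_measurable borel" by (rule test_function_borel[OF \<phi>])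
    have a1: "integrable lborel (\<lambda>x. (v x \<bullet> y) * \<phi> x)"
      using integrable_inner_left[OF test_function_integrable[OF \<phi>U v(1) Kv], of y] by (simp add: mult.commute)
    have a2: "integrable lborel (\<lambda>x. (v (x + y) \<bullet> y) * \<phi> x)"
    proof -
      have "(\<lambda>x. v (x + y)) \<in> borel_measurable borel" by measurable
      from integrable_inner_left[OF test_function_integrable[OF \<phi> this Kvy], of y] show ?thesis by (simp add: mult.commute)
    qed
    have a3: "integrable lborel (\<lambda>x. ?g x * \<phi> x)"
    proof -
      have "integrable lborel (\<lambda>x. indicator K x *\<^sub>R ?g x)" if "compact K" "K \<subseteq> ?V" for K
        using compact_imp_closed[OF that(1)] ig by (intro integrable_mult_indicator) auto
      from test_function_integrable[OF \<phi> mg this] show ?thesis by (simp add: mult.commute)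
    qed
    have tr: "(LINT x|lborel. (v (x + y) \<bullet> y) * \<phi> x) = (LINT x|lborel. (v x \<bullet> y) * \<phi> (x - y))"
      using lborel_translate(1)[of "\<lambda>x. (v x \<bullet> y) * \<phi> (x - y)" y] by simp
    have a4: "integrable lborel (\<lambda>x. (v x \<bullet> y) * \<phi> (x - y))"
      using lborel_translate(2)[of "\<lambda>x. (v x \<bullet> y) * \<phi> (x - y)" y] a2 by simp
    have "(LINT x|lborel. (v x \<bullet> y) * \<phi> x) - (LINT x|lborel. (v x \<bullet> y) * \<phi> (x - y))
      = (LINT x|lborel. (v x \<bullet> y) * frechet_derivative ?\<Phi> (at x) y)"
      unfolding segment_average_directional_derivative[OF test_function_smooth[OF \<phi>]]
      using a1 a4 by (simp add: right_diff_distrib)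
    also have "\<dots> = - (LINT x|lborel. d x * ?\<Phi> x)"
      using d by (intro weak_gradient_quadratic_form[OF U wg \<Phi> v]) auto
    also have "(LINT x|lborel. d x * ?\<Phi> x) = (LINT x|lborel. ?g x * \<phi> x)"
      by (rule integral_segment_average[OF d(1) \<phi>])
    finally have "(LINT x|lborel. (v (x + y) \<bullet> y) * \<phi> x) - (LINT x|lborel. (v x \<bullet> y) * \<phi> x) - (LINT x|lborel. ?g x * \<phi> x) = 0"
      using tr by simp
    then show "(LINT x|lborel. ?w x * \<phi> x) = 0"
      using a1 a2 a3 by (simp add: inner_diff_left left_diff_distrib)
  qed
  then show ?thesis by eventually_elim auto
qed

lemma norm_matrix_vector_mult_le:
  fixes A :: "real^'n^'m"
  shows "norm (A *v x) \<le> norm A * norm x"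
proof -
  have "norm (A *v x) = L2_set (\<lambda>i. \<bar>(A $ i) \<bullet> x\<bar>) UNIV"
    by (simp add: norm_vec_def matrix_vector_mult_def inner_vec_def)
  also have "\<dots> \<le> L2_set (\<lambda>i. norm (A $ i) * norm x) UNIV"
    by (intro L2_set_mono) (auto simp: Cauchy_Schwarz_ineq2)
  also have "\<dots> = norm A * norm x"
    by (subst norm_vec_def[of A]) (simp add: L2_set_left_distrib)
  finally show ?thesis .
qed

abbreviation sym_part :: "real^'n^'n \<Rightarrow> real^'n^'n" where
  "sym_part A \<equiv> (1/2) *\<^sub>R (transpose A + A)"

lemma quadratic_form_symmetric_part:
  fixes A :: "real^'n^'n"
  shows "\<bar>y \<bullet> (A *v y)\<bar> \<le> norm (sym_part A) * (norm y)\<^sup>2"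
proof -
  have t: "y \<bullet> (y v* A) = y \<bullet> (A *v y)"
    by (metis dot_lmul_matrix inner_commute)
  have "y \<bullet> ((sym_part A) *v y) = y \<bullet> (A *v y)"
    by (simp add: scaleR_matrix_vector_assoc[symmetric] matrix_vector_mult_add_rdistrib inner_add_right t)
  then have "\<bar>y \<bullet> (A *v y)\<bar> \<le> norm y * norm ((sym_part A) *v y)"
    using Cauchy_Schwarz_ineq2[of y "(sym_part A) *v y"] by simp
  also have "\<dots> \<le> norm y * (norm (sym_part A) * norm y)"
    by (intro mult_left_mono norm_matrix_vector_mult_le norm_ge_zero)
  finally show ?thesis by (simp add: power2_eq_square ac_simps)
qed

abbreviation jumps :: "'a::euclidean_space set \<Rightarrow> ('a \<Rightarrow> 'a) \<Rightarrow> real \<Rightarrow> 'a \<Rightarrow> 'a set" where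
  "jumps U v \<delta> y \<equiv> {x. closed_segment x (x + y) \<subseteq> U \<and> \<delta> < \<bar>(v (x + y) - v x) \<bullet> y\<bar>}"

text \<open>Only the mean of the symmetric part enters, quadratically in the length of the segment:
by \<open>nn_integral_segment\<close> the increment has integral at most \<open>I |y|\<^sup>2\<close>, and Markov's inequality applies.\<close>

lemma difference_along_segment_small:
  fixes u v :: "real^'d \<Rightarrow> real^'d"
  assumes U: "open U" and wg: "has_weak_gradient u D U"
    and v: "v \<in> borel_measurable borel" "AE x in lborel. x \<in> U \<longrightarrow> v x = u x"
    and E: "(\<integral>\<^sup>+x. norm (sym_part (D x)) \<partial>lebesgue_on U) \<le> ennreal I" "0 \<le> I"
    and \<delta>: "0 < \<delta>"
  shows "small (I * (norm y)\<^sup>2 / \<delta>) (jumps U v \<delta> y)"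
proof -
  have UL: "U \<inter> space lebesgue \<in> sets lebesgue" using U by auto
  have mD: "D \<in> borel_measurable (lebesgue_on U)"
    using wg U by (auto simp: has_weak_gradient_def intro: locally_integrable_measurable)
  from mD obtain D' where D': "D' \<in> borel_measurable borel" "AE x in lborel. x \<in> U \<longrightarrow> D' x = D x" "\<And>x. x \<notin> U \<Longrightarrow> D' x = 0"
    by (rule borel_representative) (use U in auto)
  note [measurable] = D'(1)
  define d where "d x = y \<bullet> (D' x *v y)" for x
  have md[measurable]: "d \<in> borel_measurable borel"
    unfolding d_def inner_vec_def matrix_vector_mult_def by simp
  have "(\<integral>\<^sup>+x. ennreal \<bar>d x\<bar> \<partial>lborel) = (\<integral>\<^sup>+x. ennreal \<bar>d x\<bar> \<partial>lebesgue)"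
    by (simp add: nn_integral_completion)
  also have "\<dots> \<le> (\<integral>\<^sup>+x. ennreal ((norm y)\<^sup>2) * (ennreal (norm (sym_part (D x))) * indicator U x) \<partial>lebesgue)"
  proof (rule nn_integral_mono_AE)
    show "AE x in lebesgue. ennreal \<bar>d x\<bar> \<le> ennreal ((norm y)\<^sup>2) * (ennreal (norm (sym_part (D x))) * indicator U x)"
      using AE_completion[OF D'(2)]
    proof eventually_elim
      case (elim x)
      show ?case
      proof (cases "x \<in> U")
        case True
        then have "\<bar>d x\<bar> \<le> norm (sym_part (D x)) * (norm y)\<^sup>2"
          using elim quadratic_form_symmetric_part[of y "D x"] by (simp add: d_def)
        then have "ennreal \<bar>d x\<bar> \<le> ennreal ((norm y)\<^sup>2 * norm (sym_part (D x)))"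
          by (intro ennreal_leI) (simp add: mult.commute)
        then show ?thesis using True by (simp add: ennreal_mult del: norm_scaleR)
      next
        case False
        then show ?thesis by (simp add: d_def D'(3))
      qed
    qed
  qed
  also have "\<dots> = ennreal ((norm y)\<^sup>2) * (\<integral>\<^sup>+x. ennreal (norm (sym_part (D x))) * indicator U x \<partial>lebesgue)"
  proof (rule nn_integral_cmult)
    have "continuous_on UNIV (\<lambda>A::real^'d^'d. norm (sym_part A))"
      unfolding transpose_def by (intro continuous_intros)
    from measurable_compose[OF mD borel_measurable_continuous_onI[OF this]]
    have "(\<lambda>x. ennreal (norm (sym_part (D x)))) \<in> borel_measurable (lebesgue_on U)"
      by (rule measurable_compose[OF _ measurable_ennreal])
    then show "(\<lambda>x. ennreal (norm (sym_part (D x))) * indicator U x) \<in> borel_measurable lebesgue"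
      by (subst (asm) borel_measurable_restrict_space_iff_ennreal[OF UL])
  qed
  also have "\<dots> \<le> ennreal ((norm y)\<^sup>2) * ennreal I"
    using E(1) by (intro mult_left_mono) (simp_all add: nn_integral_restrict_space[OF UL])
  also have "\<dots> = ennreal (I * (norm y)\<^sup>2)" by (simp add: ennreal_mult' E(2) mult.commute)
  finally have J: "(\<integral>\<^sup>+x. ennreal \<bar>d x\<bar> \<partial>lborel) \<le> ennreal (I * (norm y)\<^sup>2)" .
  have id: "integrable lborel d"
    using J by (intro integrableI_bounded) (auto simp: real_norm_def intro: le_less_trans)
  define G where "G x = (\<integral>\<^sup>+s. ennreal \<bar>d (x + s *\<^sub>R y)\<bar> * indicator {0..1::real} s \<partial>lborel)" for x
  have mG: "G \<in> borel_measurable borel" unfolding G_def by measurable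
  have "(\<integral>\<^sup>+x. G x \<partial>lborel) = (\<integral>\<^sup>+x. ennreal \<bar>d x\<bar> \<partial>lborel)"
    unfolding G_def by (rule nn_integral_segment) measurable
  with J have GJ: "(\<integral>\<^sup>+x. G x \<partial>lborel) \<le> ennreal (I * (norm y)\<^sup>2)" by simp
  have sG: "small (I * (norm y)\<^sup>2 / \<delta>) {x. ennreal \<delta> \<le> G x}"
    by (rule small_markov[OF mG GJ \<delta>]) (use E(2) in simp)
  have "AE x in lborel. x \<in> U \<longrightarrow> d x = y \<bullet> (D x *v y)"
    using D'(2) by eventually_elim (simp add: d_def)
  from weak_gradient_difference[OF U wg v id this]
  have ae: "AE x in lborel. closed_segment x (x + y) \<subseteq> U \<longrightarrow>
     (v (x + y) - v x) \<bullet> y = (LINT s|lborel. indicator {0..1} s * d (x + s *\<^sub>R y))" .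
  show ?thesis
  proof (rule small_mono[OF small_AE_cong[OF ae sG] _ order_refl], clarify, rule ccontr)
    fix x
    assume a: "closed_segment x (x + y) \<subseteq> U" "\<delta> < \<bar>(v (x + y) - v x) \<bullet> y\<bar>"
      "(v (x + y) - v x) \<bullet> y = (LINT s|lborel. indicator {0..1} s * d (x + s *\<^sub>R y))"
      "\<not> ennreal \<delta> \<le> G x"
    have "integrable lborel (\<lambda>s. indicator {0..1} s * d (x + s *\<^sub>R y)) \<Longrightarrow> False"
    proof -
      assume "integrable lborel (\<lambda>s. indicator {0..1} s * d (x + s *\<^sub>R y))"
      then have "ennreal (norm (LINT s|lborel. indicator {0..1} s * d (x + s *\<^sub>R y))) \<le> (\<integral>\<^sup>+s. ennreal (norm (indicator {0..1} s * d (x + s *\<^sub>R y))) \<partial>lborel)"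
        by (rule integral_norm_bound_ennreal)
      also have "\<dots> = G x"
        unfolding G_def by (intro nn_integral_cong) (auto simp: indicator_def)
      finally have "ennreal \<bar>(v (x + y) - v x) \<bullet> y\<bar> \<le> G x" using a(3) by simp
      then show False using a(2,4) by (meson ennreal_leI less_imp_le order_trans)
    qed
    then have "(v (x + y) - v x) \<bullet> y = 0" using a(3) not_integrable_integral_eq by metis
    then show False using a(2) \<delta> by simp
  qed
qed

section \<open>Splitting off the last coordinate\<close>

definition lift_coord :: "real^'n \<Rightarrow> real \<Rightarrow> real^('n::finite option)" where
  "lift_coord y t = (\<chi> i. case i of None \<Rightarrow> t | Some j \<Rightarrow> y $ j)"

lemma horiz_lift [simp]: "horiz (lift_coord y t) = y"
  by (simp add: horiz_def lift_coord_def vec_eq_iff)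

lemma height_lift [simp]: "height (lift_coord y t) = t"
  by (simp add: height_def lift_coord_def)

lemma horiz_add [simp]: "horiz (x + y) = horiz x + horiz y"
  by (simp add: horiz_def vec_eq_iff)

lemma height_add [simp]: "height (x + y) = height x + height y"
  by (simp add: height_def)

lemma horiz_scaleR [simp]: "horiz (s *\<^sub>R x) = s *\<^sub>R horiz x"
  by (simp add: horiz_def vec_eq_iff)

lemma height_scaleR [simp]: "height (s *\<^sub>R x) = s * height x"
  by (simp add: height_def)

lemma continuous_on_horiz: "continuous_on A horiz"
  unfolding horiz_def by (intro continuous_intros)

lemma continuous_on_height: "continuous_on A height"
  unfolding height_def by (intro continuous_intros)

lemma measurable_horiz [measurable]: "horiz \<in> borel_measurable borel"
  by (intro borel_measurable_continuous_onI continuous_on_horiz)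

lemma measurable_height [measurable]: "height \<in> borel_measurable borel"
  by (intro borel_measurable_continuous_onI continuous_on_height)

lemma abs_height_le: "\<bar>height x\<bar> \<le> norm x"
  by (simp add: height_def component_le_norm_cart)

lemma norm_horiz_le: "norm (horiz x) \<le> norm x"
proof -
  have "(\<Sum>j\<in>UNIV. (x $ Some j)\<^sup>2) = (\<Sum>i\<in>range Some. (x $ i)\<^sup>2)"
    by (subst sum.reindex) auto
  also have "\<dots> \<le> (\<Sum>i\<in>UNIV. (x $ i)\<^sup>2)"
    by (intro sum_mono2) auto
  finally show ?thesis
    by (simp add: norm_vec_def L2_set_def horiz_def)
qed

lemma measurable_lift_coord [measurable]: "(\<lambda>(y, t). lift_coord y t) \<in> borel_measurable borel"
proof -
  have "continuous_on UNIV (\<lambda>p::(real^'n) \<times> real. lift_coord (fst p) (snd p))"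
    unfolding lift_coord_def
  proof (rule continuous_on_vec_lambda)
    fix i :: "'n option"
    show "continuous_on UNIV (\<lambda>p::(real^'n) \<times> real. case i of None \<Rightarrow> snd p | Some j \<Rightarrow> fst p $ j)"
      by (cases i) (auto intro!: continuous_intros)
  qed
  from borel_measurable_continuous_onI[OF this] show ?thesis
    by (simp add: case_prod_beta')
qed

lemma prod_Basis_vec: "(\<Prod>b\<in>(Basis :: (real^'n) set). f b) = (\<Prod>i\<in>UNIV. f (axis i 1))"
proof -
  have B: "(Basis :: (real^'n) set) = range (\<lambda>i. axis i 1)" by (auto simp: Basis_vec_def)
  have i: "inj (\<lambda>i::'n. axis i (1::real))" by (auto intro!: injI simp: axis_eq_axis)
  show ?thesis unfolding B prod.reindex[OF i] by simp
qed

text \<open>Lebesgue measure is determined by the volumes of boxes, and a box in the product is a box over a box.\<close>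

lemma lborel_lift_coord:
  "distr (lborel :: ((real^'n) \<times> real) measure) borel (\<lambda>(y, t). lift_coord y t) = (lborel :: (real^('n::finite option)) measure)"
proof (rule lborel_eqI[symmetric])
  fix l u :: "real^('n option)"
  assume le: "\<And>b. b \<in> Basis \<Longrightarrow> l \<bullet> b \<le> u \<bullet> b"
  have le': "l $ i \<le> u $ i" for i
    using le[of "axis i 1"] by (simp add: inner_axis axis_in_Basis_iff)
  have eq: "(\<lambda>(y, t). lift_coord y t) -` box l u = box (horiz l) (horiz u) \<times> box (height l) (height u)"
  proof -
    have "lift_coord y t \<in> box l u \<longleftrightarrow> y \<in> box (horiz l) (horiz u) \<and> t \<in> box (height l) (height u)" for y t
    proof -
      have "lift_coord y t \<in> box l u \<longleftrightarrow> (\<forall>i. l $ i < lift_coord y t $ i \<and> lift_coord y t $ i < u $ i)"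
        by (simp add: mem_box_cart)
      also have "\<dots> \<longleftrightarrow> (l $ None < t \<and> t < u $ None) \<and> (\<forall>j. l $ Some j < y $ j \<and> y $ j < u $ Some j)"
        by (subst split_option_all) (simp add: lift_coord_def)
      finally show ?thesis by (auto simp: mem_box_cart horiz_def height_def)
    qed
    then show ?thesis by auto
  qed
  have "emeasure (distr (lborel :: ((real^'n) \<times> real) measure) borel (\<lambda>(y, t). lift_coord y t)) (box l u)
      = emeasure lborel (box (horiz l) (horiz u) \<times> box (height l) (height u))"
    by (subst emeasure_distr) (auto simp: eq)
  also have "\<dots> = emeasure lborel (box (horiz l) (horiz u)) * emeasure lborel (box (height l) (height u))"
    by (subst lborel_prod[symmetric]) (rule lborel.emeasure_pair_measure_Times, auto)
  also have "emeasure lborel (box (horiz l) (horiz u)) = ennreal (\<Prod>j\<in>UNIV. u $ Some j - l $ Some j)"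
  proof -
    have "b \<in> Basis \<Longrightarrow> horiz l \<bullet> b \<le> horiz u \<bullet> b" for b :: "real^'n"
      using le' by (auto simp: Basis_vec_def inner_axis horiz_def)
    then show ?thesis
      by (subst emeasure_lborel_box) (auto simp: prod_Basis_vec inner_axis horiz_def)
  qed
  also have "emeasure lborel (box (height l) (height u)) = ennreal (u $ None - l $ None)"
    using le'[of None] by (subst emeasure_lborel_box) (auto simp: height_def)
  also have "ennreal (\<Prod>j\<in>UNIV. u $ Some j - l $ Some j) * ennreal (u $ None - l $ None)
      = ennreal ((\<Prod>j\<in>UNIV. u $ Some j - l $ Some j) * (u $ None - l $ None))"
    using le' by (intro ennreal_mult[symmetric] prod_nonneg) auto
  also have "(\<Prod>j\<in>UNIV. u $ Some j - l $ Some j) * (u $ None - l $ None) = (\<Prod>i\<in>UNIV. u $ i - l $ i)"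
    by (simp add: UNIV_option_conv prod.reindex mult.commute)
  also have "\<dots> = (\<Prod>b\<in>Basis. (u - l) \<bullet> b)"
    by (simp add: prod_Basis_vec inner_axis)
  finally show "emeasure (distr (lborel :: ((real^'n) \<times> real) measure) borel (\<lambda>(y, t). lift_coord y t)) (box l u) = (\<Prod>b\<in>Basis. (u - l) \<bullet> b)" .
qed simp

lemma nn_integral_lift_coord:
  fixes F :: "real^('n::finite option) \<Rightarrow> ennreal"
  assumes [measurable]: "F \<in> borel_measurable borel"
  shows "(\<integral>\<^sup>+x. F x \<partial>lborel) = (\<integral>\<^sup>+y. (\<integral>\<^sup>+t. F (lift_coord y t) \<partial>lborel) \<partial>lborel)"
proof -
  have m: "(\<lambda>p. F (case p of (y, t) \<Rightarrow> lift_coord y t)) \<in> borel_measurable borel"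
    by (rule measurable_compose[OF measurable_lift_coord assms])
  have "(\<integral>\<^sup>+x. F x \<partial>lborel) = (\<integral>\<^sup>+p. F (case p of (y, t) \<Rightarrow> lift_coord y t) \<partial>lborel)"
    unfolding lborel_lift_coord[symmetric] by (rule nn_integral_distr) (use measurable_lift_coord in auto)
  also have "\<dots> = (\<integral>\<^sup>+p. F (case p of (y, t) \<Rightarrow> lift_coord y t) \<partial>(lborel \<Otimes>\<^sub>M lborel))"
    by (simp add: lborel_prod)
  also have "\<dots> = (\<integral>\<^sup>+y. (\<integral>\<^sup>+t. F (lift_coord y t) \<partial>lborel) \<partial>lborel)"
    using m by (subst lborel.nn_integral_fst[symmetric]) (simp_all add: lborel_prod)
  finally show ?thesis .
qed

lemma emeasure_lift_coord:
  fixes B :: "(real^('n::finite option)) set"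
  assumes "B \<in> sets borel"
  shows "emeasure lborel B = (\<integral>\<^sup>+y. emeasure lborel {t. lift_coord y t \<in> B} \<partial>lborel)"
proof -
  have m: "{t. lift_coord y t \<in> B} \<in> sets borel" for y
  proof -
    have "(\<lambda>t. (\<lambda>(y, t). lift_coord y t) (y, t)) \<in> borel_measurable borel"
      by (rule measurable_compose[OF _ measurable_lift_coord]) (intro borel_measurable_continuous_onI continuous_intros)
    from measurable_sets[OF this assms] show ?thesis by (simp add: vimage_def)
  qed
  have "emeasure lborel B = (\<integral>\<^sup>+x. indicator B x \<partial>lborel)" using assms by simp
  also have "\<dots> = (\<integral>\<^sup>+y. (\<integral>\<^sup>+t. indicator B (lift_coord y t) \<partial>lborel) \<partial>lborel)"
    by (rule nn_integral_lift_coord) (use assms in simp)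
  also have "\<dots> = (\<integral>\<^sup>+y. (\<integral>\<^sup>+t. indicator {t. lift_coord y t \<in> B} t \<partial>lborel) \<partial>lborel)"
    by (simp add: indicator_def)
  also have "\<dots> = (\<integral>\<^sup>+y. emeasure lborel {t. lift_coord y t \<in> B} \<partial>lborel)"
    using m by simp
  finally show ?thesis .
qed

lemma cylinder_borel:
  assumes "A \<in> sets borel"
  shows "cylinder A a b \<in> sets borel"
proof -
  have "cylinder A a b = (horiz -` A \<inter> space borel) \<inter> (height -` {a<..<b} \<inter> space borel)"
    by (auto simp: cylinder_def)
  also have "\<dots> \<in> sets borel"
    using assms by (intro sets.Int measurable_sets[OF measurable_horiz] measurable_sets[OF measurable_height]) auto
  finally show ?thesis .
qed

lemma emeasure_cylinder:
  assumes A: "A \<in> sets borel" and "a \<le> b"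
  shows "emeasure lborel (cylinder A a b) = emeasure lborel A * ennreal (b - a)"
proof -
  have "emeasure lborel {t. lift_coord y t \<in> cylinder A a b} = ennreal (b - a) * indicator A y" for y
  proof -
    have "{t. lift_coord y t \<in> cylinder A a b} = (if y \<in> A then {a<..<b} else {})"
      by (auto simp: cylinder_def)
    then show ?thesis using assms(2) by (simp add: indicator_def)
  qed
  then show ?thesis
    using A by (simp add: emeasure_lift_coord cylinder_borel nn_integral_cmult_indicator)
      (rule mult.commute)
qed

text \<open>A vertical cylinder over a null set is null.\<close>

lemma AE_horiz:
  assumes "AE y in lborel. P y"
  shows "AE x in lborel. P (horiz x)"
proof -
  obtain N where N: "{x. \<not> P x} \<subseteq> N" "N \<in> sets borel" "emeasure lborel N = 0"
    using assms by (auto elim: AE_E)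
  let ?B = "{x. horiz x \<in> N}"
  have B: "?B \<in> sets borel" using measurable_sets[OF measurable_horiz N(2)] by (simp add: vimage_def)
  have "AE y in lborel. y \<notin> N" using N by (intro AE_not_in) auto
  then have "emeasure lborel ?B = (\<integral>\<^sup>+y. 0 \<partial>(lborel :: (real^'a) measure))"
    unfolding emeasure_lift_coord[OF B] by (intro nn_integral_cong_AE) (auto elim!: eventually_mono)
  then have "AE x in lborel. x \<notin> ?B" using B by (intro AE_not_in) auto
  then show ?thesis by eventually_elim (use N(1) in auto)
qed

section \<open>Volume below a graph\<close>

text \<open>Tonelli applied to a Borel representative of \<open>h\<close>; the set below \<open>h\<close> differs from the set below
the representative inside a vertical cylinder over a null set.\<close>

lemma emeasure_subgraph_pos:
  fixes \<omega> :: "(real^'n::finite) set"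
  assumes \<omega>: "open \<omega>" and h: "h \<in> L1_range_on \<omega> M"
  shows "emeasure lebesgue (subgraph_pos \<omega> h) = ennreal (LINT y|lebesgue_on \<omega>. h y)"
proof -
  have \<omega>L: "\<omega> \<inter> space lebesgue \<in> sets lebesgue" using \<omega> by auto
  have hi: "integrable (lebesgue_on \<omega>) h" and h0: "\<And>y. y \<in> \<omega> \<Longrightarrow> 0 \<le> h y"
    using h by (auto simp: L1_range_on_def)
  have "(\<lambda>y. indicator \<omega> y *\<^sub>R h y) \<in> borel_measurable lebesgue"
    using hi \<omega>L integrable_restrict_space[OF \<omega>L, of h] by auto
  then obtain k where k: "k \<in> borel_measurable lborel" "AE y in lborel. indicator \<omega> y *\<^sub>R h y = k y"
    using completion_ex_borel_measurable_real by blast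
  have [measurable]: "k \<in> borel_measurable borel" "\<omega> \<in> sets borel" using k \<omega> by auto
  let ?S = "subgraph_pos \<omega> k :: (real^('n option)) set"
  have mk: "(\<lambda>x. k (horiz x)) \<in> borel_measurable borel"
    by (rule measurable_compose[OF measurable_horiz]) measurable
  have "?S = (horiz -` \<omega> \<inter> space borel) \<inter> (height -` {0<..} \<inter> space borel) \<inter> {x \<in> space borel. height x < k (horiz x)}"
    by (auto simp: subgraph_pos_def)
  also have "\<dots> \<in> sets borel"
    using \<omega> by (intro sets.Int measurable_sets[OF measurable_horiz] measurable_sets[OF measurable_height]
        borel_measurable_less[OF measurable_height mk]) auto
  finally have Sb: "?S \<in> sets borel" .
  have ae: "AE x in lebesgue. x \<in> ?S \<longleftrightarrow> x \<in> subgraph_pos \<omega> h"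
    using AE_completion[OF AE_horiz[OF k(2)]]
    by eventually_elim (auto simp: subgraph_pos_def indicator_def)
  have Sh: "subgraph_pos \<omega> h \<in> sets lebesgue"
    by (rule completion.in_sets_AE[OF ae]) (use Sb in auto)
  have "emeasure lebesgue (subgraph_pos \<omega> h) = emeasure lebesgue ?S"
    by (rule emeasure_eq_AE) (use ae Sh Sb in auto)
  also have "\<dots> = emeasure lborel ?S" using Sb by simp
  also have "\<dots> = (\<integral>\<^sup>+y. emeasure lborel {t. lift_coord y t \<in> ?S} \<partial>lborel)"
    by (rule emeasure_lift_coord[OF Sb])
  also have "\<dots> = (\<integral>\<^sup>+y. ennreal (h y) * indicator \<omega> y \<partial>lebesgue)"
  proof -
    have "(\<integral>\<^sup>+y. emeasure lborel {t. lift_coord y t \<in> ?S} \<partial>lborel) = (\<integral>\<^sup>+y. ennreal (k y) * indicator \<omega> y \<partial>lborel)"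
    proof (intro nn_integral_cong)
      fix y
      have "{t. lift_coord y t \<in> ?S} = (if y \<in> \<omega> then {0<..<k y} else {})"
        by (auto simp: subgraph_pos_def)
      then show "emeasure lborel {t. lift_coord y t \<in> ?S} = ennreal (k y) * indicator \<omega> y"
        by (cases "0 \<le> k y") (auto simp: ennreal_neg)
    qed
    also have "\<dots> = (\<integral>\<^sup>+y. ennreal (k y) * indicator \<omega> y \<partial>lebesgue)"
      by (subst nn_integral_completion) auto
    also have "\<dots> = (\<integral>\<^sup>+y. ennreal (h y) * indicator \<omega> y \<partial>lebesgue)"
      using AE_completion[OF k(2)] by (intro nn_integral_cong_AE) (auto elim!: eventually_mono simp: indicator_def)
    finally show ?thesis .
  qed
  also have "\<dots> = (\<integral>\<^sup>+y. ennreal (h y) \<partial>lebesgue_on \<omega>)"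
    by (simp add: nn_integral_restrict_space[OF \<omega>L])
  also have "\<dots> = ennreal (LINT y|lebesgue_on \<omega>. h y)"
    using hi h0 by (intro nn_integral_eq_integral AE_I2) (auto simp: space_restrict_space)
  finally show ?thesis .
qed

section \<open>Oscillation of a continuously differentiable graph\<close>

lemma gradient_inner:
  assumes "h differentiable (at x)"
  shows "frechet_derivative h (at x) v = gradient h x \<bullet> v"
proof -
  have lin: "linear (frechet_derivative h (at x))"
    using assms by (metis frechet_derivative_works has_derivative_linear)
  have "frechet_derivative h (at x) v = frechet_derivative h (at x) (\<Sum>j\<in>UNIV. v $ j *\<^sub>R axis j 1)"
    using basis_expansion[of v] by (simp add: scalar_mult_eq_scaleR)
  then show ?thesis
    by (simp add: linear_sum[OF lin] linear_cmul[OF lin] gradient_def inner_vec_def mult.commute)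
qed

text \<open>Cutting off outside \<open>\<omega>\<close> makes the slope a Borel function on the whole space, as \<open>nn_integral_segment\<close>
requires.\<close>

definition slope :: "(real^'n) set \<Rightarrow> (real^'n \<Rightarrow> real) \<Rightarrow> real^'n \<Rightarrow> ennreal" where
  "slope \<omega> h y = ennreal (indicator \<omega> y *\<^sub>R norm (gradient h y))"

definition path_variation :: "(real^'n) set \<Rightarrow> (real^'n \<Rightarrow> real) \<Rightarrow> real^'n \<Rightarrow> real^'n \<Rightarrow> ennreal" where
  "path_variation \<omega> h z y = (\<integral>\<^sup>+s. slope \<omega> h (y + s *\<^sub>R z) * indicator {0..1::real} s \<partial>lborel)"

lemma C1_continuous:
  assumes "h \<in> C1_range_on \<omega> M"
  shows "continuous_on \<omega> h"
  using assms by (auto simp: C1_range_on_def intro!: continuous_at_imp_continuous_on differentiable_imp_continuous_within)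

lemma measurable_slope:
  assumes "open \<omega>" "h \<in> C1_range_on \<omega> M"
  shows "slope \<omega> h \<in> borel_measurable borel"
proof -
  have "continuous_on \<omega> (\<lambda>y. norm (gradient h y))"
    using assms(2) by (auto simp: C1_range_on_def intro: continuous_intros)
  then have "(\<lambda>y. indicator \<omega> y *\<^sub>R norm (gradient h y)) \<in> borel_measurable borel"
    using assms(1) by (intro borel_measurable_continuous_on_indicator) auto
  then show ?thesis unfolding slope_def[abs_def] by (rule measurable_compose[OF _ measurable_ennreal])
qed

lemma measurable_path_variation:
  assumes "open \<omega>" "h \<in> C1_range_on \<omega> M"
  shows "path_variation \<omega> h z \<in> borel_measurable borel"
proof -
  note [measurable] = measurable_slope[OF assms]
  show ?thesis unfolding path_variation_def[abs_def] by measurable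
qed

lemma nn_integral_path_variation:
  assumes "open \<omega>" "h \<in> C1_range_on \<omega> M"
  shows "(\<integral>\<^sup>+y. path_variation \<omega> h z y \<partial>lborel) = (\<integral>\<^sup>+y. slope \<omega> h y \<partial>lborel)"
  unfolding path_variation_def by (rule nn_integral_segment[OF measurable_slope[OF assms]])

text \<open>A single function bounds the oscillation of \<open>h\<close> along the whole segment, so that a supremum over
the segment costs no more than a difference of end points.\<close>

lemma C1_difference_le:
  assumes h: "h \<in> C1_range_on \<omega> M" and seg: "\<And>s. s \<in> {0..1} \<Longrightarrow> y + s *\<^sub>R z \<in> \<omega>"
    and s: "s \<in> {0..1}"
  shows "ennreal \<bar>h (y + s *\<^sub>R z) - h y\<bar> \<le> ennreal (norm z) * path_variation \<omega> h z y"
proof -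
  have dif: "h differentiable (at x)" if "x \<in> \<omega>" for x using h that by (auto simp: C1_range_on_def)
  have cg: "continuous_on {0..1} (\<lambda>s. norm (gradient h (y + s *\<^sub>R z)))"
  proof (rule continuous_on_norm, rule continuous_on_compose2[of \<omega> "gradient h" _ "\<lambda>s. y + s *\<^sub>R z"])
    show "continuous_on \<omega> (gradient h)" using h by (simp add: C1_range_on_def)
    show "continuous_on {0..1} (\<lambda>s. y + s *\<^sub>R z)" by (intro continuous_intros)
    show "(\<lambda>s. y + s *\<^sub>R z) ` {0..1} \<subseteq> \<omega>" using seg by blast
  qed
  have int1: "(\<lambda>s. norm (gradient h (y + s *\<^sub>R z))) integrable_on {0..1}"
    using cg by (rule integrable_continuous_real)
  have int2: "(\<lambda>s. norm (gradient h (y + s *\<^sub>R z))) integrable_on {0..s}"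
    using s by (intro integrable_continuous_real continuous_on_subset[OF cg]) auto
  have ftc: "((\<lambda>s. gradient h (y + s *\<^sub>R z) \<bullet> z) has_integral (h (y + s *\<^sub>R z) - h (y + 0 *\<^sub>R z))) {0..s}"
  proof (rule fundamental_theorem_of_calculus)
    fix r assume r: "r \<in> {0..s}"
    then have w: "y + r *\<^sub>R z \<in> \<omega>" using s by (intro seg) auto
    have "((\<lambda>r. y + r *\<^sub>R z) has_derivative (\<lambda>k. k *\<^sub>R z)) (at r within {0..s})"
      by (auto intro!: derivative_eq_intros)
    from has_derivative_compose[OF this, of h "frechet_derivative h (at (y + r *\<^sub>R z))"] dif[OF w]
    have "((\<lambda>r. h (y + r *\<^sub>R z)) has_derivative (\<lambda>k. frechet_derivative h (at (y + r *\<^sub>R z)) (k *\<^sub>R z))) (at r within {0..s})"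
      by (simp add: frechet_derivative_works)
    then show "((\<lambda>r. h (y + r *\<^sub>R z)) has_vector_derivative gradient h (y + r *\<^sub>R z) \<bullet> z) (at r within {0..s})"
      by (simp add: has_vector_derivative_def gradient_inner[OF dif[OF w]])
  qed (use s in auto)
  have "\<bar>h (y + s *\<^sub>R z) - h y\<bar> = norm (integral {0..s} (\<lambda>s. gradient h (y + s *\<^sub>R z) \<bullet> z))"
    using integral_unique[OF ftc] by simp
  also have "\<dots> \<le> integral {0..s} (\<lambda>s. norm z * norm (gradient h (y + s *\<^sub>R z)))"
  proof (rule integral_norm_bound_integral)
    show "(\<lambda>s. gradient h (y + s *\<^sub>R z) \<bullet> z) integrable_on {0..s}"
      using ftc by (rule has_integral_integrable)
    show "(\<lambda>s. norm z * norm (gradient h (y + s *\<^sub>R z))) integrable_on {0..s}"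
      using integrable_on_cmult_left[OF int2, of "norm z"] by simp
    show "norm (gradient h (y + r *\<^sub>R z) \<bullet> z) \<le> norm z * norm (gradient h (y + r *\<^sub>R z))" for r
      using Cauchy_Schwarz_ineq2[of "gradient h (y + r *\<^sub>R z)" z] by (simp add: mult.commute)
  qed
  also have "\<dots> = norm z * integral {0..s} (\<lambda>s. norm (gradient h (y + s *\<^sub>R z)))" by simp
  also have "\<dots> \<le> norm z * integral {0..1} (\<lambda>s. norm (gradient h (y + s *\<^sub>R z)))"
    using s int1 int2 by (intro mult_left_mono integral_subset_le) auto
  finally have "ennreal \<bar>h (y + s *\<^sub>R z) - h y\<bar> \<le> ennreal (norm z * integral {0..1} (\<lambda>s. norm (gradient h (y + s *\<^sub>R z))))"
    by (rule ennreal_leI)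
  also have "\<dots> = ennreal (norm z) * ennreal (integral {0..1} (\<lambda>s. norm (gradient h (y + s *\<^sub>R z))))"
    by (rule ennreal_mult) (auto intro: Henstock_Kurzweil_Integration.integral_nonneg[OF int1])
  also have "ennreal (integral {0..1} (\<lambda>s. norm (gradient h (y + s *\<^sub>R z)))) = (\<integral>\<^sup>+s. ennreal (norm (gradient h (y + s *\<^sub>R z))) * indicator {0..1} s \<partial>lborel)"
    by (rule nn_integral_has_integral_lebesgue'[OF _ integrable_integral[OF int1], symmetric]) simp
  also have "\<dots> = path_variation \<omega> h z y"
    unfolding path_variation_def slope_def
    by (intro nn_integral_cong) (use seg in \<open>auto simp: indicator_def\<close>)
  finally show ?thesis .
qed

lemma C1_indicator_measurable:
  assumes "open \<omega>" "h \<in> C1_range_on \<omega> M"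
  shows "(\<lambda>y. indicator \<omega> y * h y) \<in> borel_measurable borel"
  using borel_measurable_continuous_on_indicator[OF _ C1_continuous[OF assms(2)]] assms(1) by simp

section \<open>Segments leaving a subgraph\<close>

lemma emeasure_below_le: "emeasure lborel {t::real. t < a \<and> ennreal (a - t) \<le> e} \<le> e"
proof (cases e)
  case (real r)
  have "{t. t < a \<and> ennreal (a - t) \<le> e} \<subseteq> {a - r..a}"
    using real by (auto simp: ennreal_le_iff)
  then have "emeasure lborel {t. t < a \<and> ennreal (a - t) \<le> e} \<le> emeasure lborel {a - r..a}"
    by (rule emeasure_mono) simp
  also have "\<dots> = e" using real by simp
  finally show ?thesis .
qed simp

abbreviation exits :: "'a::euclidean_space set \<Rightarrow> 'a \<Rightarrow> 'a set" where
  "exits U z \<equiv> {x \<in> U. \<not> closed_segment x (x + z) \<subseteq> U}"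

text \<open>The condition on heights excludes segments that end below the bottom of the subgraph.\<close>

abbreviation tilt_exits :: "(real^('n::finite option)) set \<Rightarrow> real^('n option) \<Rightarrow> (real^('n option)) set" where
  "tilt_exits U z \<equiv> {x \<in> U. - 1 < height x + height z \<and> \<not> closed_segment x (x + z) \<subseteq> U}"

text \<open>A segment over \<open>\<omega>\<close> that stays above the bottom can leave the subgraph only through the graph, and
then \<open>x\<close> lies below the graph by at most the rise \<open>c\<close> of the segment plus the variation of \<open>h\<close> along it. For a
descending segment \<open>c = 0\<close>, and the bound is proportional to the horizontal displacement only.\<close>

lemma subgraph_exit_small:
  fixes \<omega> :: "(real^'n::finite) set"
  assumes \<omega>: "open \<omega>" "bounded \<omega>" and h: "h \<in> C1_range_on \<omega> M" and K: "K \<in> sets borel" "K \<subseteq> \<omega>"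
    and seg: "\<And>y s. y \<in> K \<Longrightarrow> s \<in> {0..1} \<Longrightarrow> y + s *\<^sub>R horiz z \<in> \<omega>"
    and I: "(\<integral>\<^sup>+y. slope \<omega> h y \<partial>lborel) \<le> ennreal I" "0 \<le> I"
    and c: "0 \<le> c" "height z \<le> c"
  shows "small (c * measure lebesgue \<omega> + norm (horiz z) * I)
     {x \<in> subgraph \<omega> h. horiz x \<in> K \<and> - 1 < height x + height z \<and> \<not> closed_segment x (x + z) \<subseteq> subgraph \<omega> h}"
proof -
  define hb where "hb y = indicator \<omega> y * h y" for y
  define W where "W y = ennreal (norm (horiz z)) * path_variation \<omega> h (horiz z) y" for y
  have mh: "hb \<in> borel_measurable borel" unfolding hb_def[abs_def] by (rule C1_indicator_measurable[OF \<omega>(1) h])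
  have mP: "path_variation \<omega> h (horiz z) \<in> borel_measurable borel" by (rule measurable_path_variation[OF \<omega>(1) h])
  have mW: "W \<in> borel_measurable borel" unfolding W_def[abs_def] using mP by (intro borel_measurable_times_ennreal borel_measurable_const)
  have mhh: "(\<lambda>x. hb (horiz x)) \<in> borel_measurable borel" by (rule measurable_compose[OF measurable_horiz mh])
  have mWh: "(\<lambda>x. W (horiz x)) \<in> borel_measurable borel" by (rule measurable_compose[OF measurable_horiz mW])
  let ?B = "{x. horiz x \<in> K \<and> height x < hb (horiz x) \<and> ennreal (hb (horiz x) - height x) \<le> ennreal c + W (horiz x)}"
  have "?B = (horiz -` K \<inter> space borel) \<inter> {x \<in> space borel. height x < hb (horiz x)} \<inter>
       {x \<in> space borel. ennreal (hb (horiz x) - height x) \<le> ennreal c + W (horiz x)}" by auto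
  also have "\<dots> \<in> sets borel"
    by (intro sets.Int measurable_sets[OF measurable_horiz K(1)] borel_measurable_less[OF measurable_height mhh]
        borel_measurable_le measurable_compose[OF borel_measurable_diff[OF mhh measurable_height] measurable_ennreal]
        borel_measurable_add borel_measurable_const mWh)
  finally have B: "?B \<in> sets borel" .
  have "emeasure lborel ?B = (\<integral>\<^sup>+y. emeasure lborel {t. lift_coord y t \<in> ?B} \<partial>lborel)"
    by (rule emeasure_lift_coord[OF B])
  also have "\<dots> \<le> (\<integral>\<^sup>+y. ennreal c * indicator \<omega> y + W y \<partial>lborel)"
  proof (rule nn_integral_mono)
    fix y
    show "emeasure lborel {t. lift_coord y t \<in> ?B} \<le> ennreal c * indicator \<omega> y + W y"
    proof (cases "y \<in> K")
      case True
      then show ?thesis using emeasure_below_le[of "hb y" "ennreal c + W y"] K(2) by (auto simp: indicator_def)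
    qed simp
  qed
  also have "\<dots> = ennreal c * emeasure lborel \<omega> + ennreal (norm (horiz z)) * (\<integral>\<^sup>+y. slope \<omega> h y \<partial>lborel)"
    using \<omega>(1) mW mP unfolding W_def
    by (subst nn_integral_add) (auto simp: nn_integral_cmult_indicator nn_integral_cmult nn_integral_path_variation[OF \<omega>(1) h])
  also have "\<dots> \<le> ennreal c * emeasure lborel \<omega> + ennreal (norm (horiz z)) * ennreal I"
    by (intro add_left_mono mult_left_mono I) auto
  also have "emeasure lborel \<omega> = ennreal (measure lebesgue \<omega>)"
  proof -
    have "\<omega> \<in> lmeasurable" using \<omega> by (simp add: lmeasurable_open)
    then have "emeasure lebesgue \<omega> = ennreal (measure lebesgue \<omega>)" by (simp add: emeasure_eq_measure2)
    then show ?thesis using \<omega>(1) by simp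
  qed
  also have "ennreal c * ennreal (measure lebesgue \<omega>) + ennreal (norm (horiz z)) * ennreal I = ennreal (c * measure lebesgue \<omega> + norm (horiz z) * I)"
    using c(1) I(2) by (subst ennreal_plus) (simp_all add: ennreal_mult)
  finally have le: "emeasure lborel ?B \<le> ennreal (c * measure lebesgue \<omega> + norm (horiz z) * I)" .
  show ?thesis
    unfolding small_def
  proof (intro bexI[of _ ?B] conjI)
    show "?B \<in> sets lebesgue" using B by auto
    show "emeasure lebesgue ?B \<le> ennreal (c * measure lebesgue \<omega> + norm (horiz z) * I)" using le B by simp
    show "{x \<in> subgraph \<omega> h. horiz x \<in> K \<and> - 1 < height x + height z \<and> \<not> closed_segment x (x + z) \<subseteq> subgraph \<omega> h} \<subseteq> ?B"
    proof (rule subsetI)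
      fix x assume "x \<in> {x \<in> subgraph \<omega> h. horiz x \<in> K \<and> - 1 < height x + height z \<and> \<not> closed_segment x (x + z) \<subseteq> subgraph \<omega> h}"
      then have x: "x \<in> subgraph \<omega> h" "horiz x \<in> K" "- 1 < height x + height z"
        and n: "\<not> closed_segment x (x + z) \<subseteq> subgraph \<omega> h" by simp_all
      have eq: "closed_segment x (x + z) = (\<lambda>s. x + s *\<^sub>R z) ` {0..1}"
        unfolding closed_segment_image_interval by (intro image_cong) (auto simp: algebra_simps)
      have "\<not> (\<forall>s\<in>{0..1}. x + s *\<^sub>R z \<in> subgraph \<omega> h)"
        using n unfolding eq image_subset_iff .
      then obtain s where s: "s \<in> {0..1}" "x + s *\<^sub>R z \<notin> subgraph \<omega> h" by blast
      have hx: "-1 < height x" "height x < h (horiz x)" using x(1) by (auto simp: subgraph_def)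
      have "-1 < height x + s * height z"
      proof -
        have "height x + s * height z = (1 - s) * height x + s * (height x + height z)" by (simp add: algebra_simps)
        moreover have "(1 - s) * (-1) \<le> (1 - s) * height x" "s * (-1) \<le> s * (height x + height z)"
          using s(1) hx x(3) mult_left_mono[of "-1" "height x" "1 - s"] mult_left_mono[of "-1" "height x + height z" s] by auto
        moreover have "(1 - s) * (-1) < (1 - s) * height x \<or> s * (-1) < s * (height x + height z)"
        proof (cases "s = 0")
          case True then show ?thesis using hx by simp
        next
          case False
          then have "0 < s" using s(1) by simp
          then show ?thesis using x(3) by (intro disjI2 mult_strict_left_mono) auto
        qed
        ultimately show ?thesis by argo
      qed
      then have "h (horiz x + s *\<^sub>R horiz z) \<le> height x + s * height z"
        using s(2) seg[OF x(2) s(1)] by (auto simp: subgraph_def not_less)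
      also have "s * height z \<le> c"
      proof (cases "0 \<le> height z")
        case True
        then have "s * height z \<le> 1 * height z" using s(1) by (intro mult_right_mono) auto
        then show ?thesis using c by simp
      next
        case False
        then have "s * height z \<le> 0" using s(1) by (simp add: mult_nonneg_nonpos)
        then show ?thesis using c by simp
      qed
      finally have "h (horiz x) - height x \<le> c + \<bar>h (horiz x + s *\<^sub>R horiz z) - h (horiz x)\<bar>" by simp
      then have "ennreal (h (horiz x) - height x) \<le> ennreal (c + \<bar>h (horiz x + s *\<^sub>R horiz z) - h (horiz x)\<bar>)"
        by (rule ennreal_leI)
      also have "\<dots> = ennreal c + ennreal \<bar>h (horiz x + s *\<^sub>R horiz z) - h (horiz x)\<bar>" using c by simp
      also have "\<dots> \<le> ennreal c + W (horiz x)"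
        unfolding W_def using seg[OF x(2)] s(1) by (intro add_left_mono C1_difference_le[OF h]) auto
      finally show "x \<in> ?B"
        using x hx K(2) by (auto simp: hb_def)
    qed
  qed
qed

text \<open>Near the boundary of \<open>\<omega>\<close> segments may leave \<open>\<omega>\<close>; this is avoided by discarding a set of small
measure, the same one for all profiles.\<close>

lemma compact_exhaustion:
  fixes \<omega> :: "'a::euclidean_space set"
  assumes "open \<omega>" "bounded \<omega>" "0 < e"
  obtains K \<epsilon> where "compact K" "K \<subseteq> \<omega>" "emeasure lborel (\<omega> - K) \<le> ennreal e" "0 < \<epsilon>"
    "\<And>y w. y \<in> K \<Longrightarrow> norm w < \<epsilon> \<Longrightarrow> y + w \<in> \<omega>"
proof -
  have "\<omega> \<in> sets lebesgue" using assms(1) by auto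
  then obtain K where K: "closed K" "K \<subseteq> \<omega>" "emeasure lebesgue (\<omega> - K) < ennreal e"
    using sets_lebesgue_inner_closed[OF _ assms(3)] by metis
  have cK: "compact K" using K(1,2) assms(2) bounded_subset compact_eq_bounded_closed by blast
  obtain \<epsilon> where \<epsilon>: "0 < \<epsilon>" "(\<Union>x\<in>K. ball x \<epsilon>) \<subseteq> \<omega>"
    using compact_subset_open_imp_ball_epsilon_subset[OF cK assms(1) K(2)] by metis
  show ?thesis
  proof (rule that[OF cK K(2) _ \<epsilon>(1)])
    have "\<omega> - K \<in> sets borel" using assms(1) K(1) by auto
    then show "emeasure lborel (\<omega> - K) \<le> ennreal e" using K(3) by simp
    show "y + w \<in> \<omega>" if "y \<in> K" "norm w < \<epsilon>" for y w
    proof -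
      have "y + w \<in> ball y \<epsilon>" using that(2) by (simp add: dist_norm)
      then show ?thesis using \<epsilon>(2) that(1) by blast
    qed
  qed
qed

lemma subgraph_exit_uniformly_small:
  fixes \<omega> :: "(real^'n::finite) set"
  assumes \<omega>: "open \<omega>" "bounded \<omega>" and I: "0 \<le> I" and M: "0 < M" and \<eta>: "0 < \<eta>"
  obtains \<delta> where "0 < \<delta>"
    "\<And>h z. h \<in> C1_range_on \<omega> M \<Longrightarrow> (\<integral>\<^sup>+y. slope \<omega> h y \<partial>lborel) \<le> ennreal I \<Longrightarrow> norm (horiz z) \<le> \<delta> \<Longrightarrow> height z \<le> \<delta>
      \<Longrightarrow> small \<eta> (tilt_exits (subgraph \<omega> h) z)"
proof -
  obtain K \<epsilon> where K: "compact K" "K \<subseteq> \<omega>" "emeasure lborel (\<omega> - K) \<le> ennreal (\<eta> / 2 / (M + 1))" "0 < \<epsilon>"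
    "\<And>y w. y \<in> K \<Longrightarrow> norm w < \<epsilon> \<Longrightarrow> y + w \<in> \<omega>"
    using compact_exhaustion[OF \<omega>, of "\<eta> / 2 / (M + 1)"] M \<eta> by auto
  define \<delta> where "\<delta> = min (\<epsilon> / 2) (\<eta> / 2 / (measure lebesgue \<omega> + I + 1))"
  have pos: "0 < measure lebesgue \<omega> + I + 1" using I measure_nonneg[of lebesgue \<omega>] by linarith
  have \<delta>0: "0 < \<delta>" using K(4) \<eta> pos by (simp add: \<delta>_def)
  have Kb: "K \<in> sets borel" using K(1) by (simp add: borel_compact)
  show ?thesis
  proof (rule that[OF \<delta>0])
    fix h and z :: "real^('n option)"
    assume h: "h \<in> C1_range_on \<omega> M" and Ih: "(\<integral>\<^sup>+y. slope \<omega> h y \<partial>lborel) \<le> ennreal I"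
      and z: "norm (horiz z) \<le> \<delta>" "height z \<le> \<delta>"
    have seg: "y + s *\<^sub>R horiz z \<in> \<omega>" if "y \<in> K" "s \<in> {0..1}" for y s
    proof (rule K(5)[OF that(1)])
      have "norm (s *\<^sub>R horiz z) \<le> 1 * norm (horiz z)" using that(2) unfolding norm_scaleR by (intro mult_right_mono) auto
      also have "\<dots> < \<epsilon>" using z(1) K(4) by (simp add: \<delta>_def)
      finally show "norm (s *\<^sub>R horiz z) < \<epsilon>" .
    qed
    have s1: "small (\<delta> * measure lebesgue \<omega> + norm (horiz z) * I)
     {x \<in> subgraph \<omega> h. horiz x \<in> K \<and> - 1 < height x + height z \<and> \<not> closed_segment x (x + z) \<subseteq> subgraph \<omega> h}"
      by (rule subgraph_exit_small[OF \<omega> h Kb K(2) seg Ih I _ z(2)]) (use \<delta>0 in auto)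
    have "\<delta> * measure lebesgue \<omega> + norm (horiz z) * I \<le> \<delta> * measure lebesgue \<omega> + \<delta> * I"
      by (intro add_left_mono mult_right_mono z I)
    also have "\<dots> \<le> \<delta> * (measure lebesgue \<omega> + I + 1)" using \<delta>0 by (simp add: algebra_simps)
    also have "\<dots> \<le> (\<eta> / 2 / (measure lebesgue \<omega> + I + 1)) * (measure lebesgue \<omega> + I + 1)"
      using pos by (intro mult_right_mono) (auto simp: \<delta>_def)
    also have "\<dots> = \<eta> / 2"
      using nonzero_divide_eq_eq[of "measure lebesgue \<omega> + I + 1" "\<eta> / 2" "\<eta> / 2 / (measure lebesgue \<omega> + I + 1)"] pos
      by linarith
    finally have b1: "\<delta> * measure lebesgue \<omega> + norm (horiz z) * I \<le> \<eta> / 2" .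
    have s2: "small (\<eta> / 2) (cylinder (\<omega> - K) (-1) M)"
      unfolding small_def
    proof (intro bexI[of _ "cylinder (\<omega> - K) (-1) M"] conjI order_refl)
      have b: "\<omega> - K \<in> sets borel" using \<omega>(1) Kb by auto
      then show "cylinder (\<omega> - K) (-1) M \<in> sets lebesgue" using cylinder_borel[OF b, of "-1" M] by simp
      have "emeasure lebesgue (cylinder (\<omega> - K) (-1) M) = emeasure lborel (\<omega> - K) * ennreal (M - (-1))"
        using emeasure_cylinder[OF b, of "-1" M] cylinder_borel[OF b] M by simp
      also have "\<dots> \<le> ennreal (\<eta> / 2 / (M + 1)) * ennreal (M - (-1))"
        by (intro mult_right_mono K) auto
      also have "\<dots> = ennreal ((\<eta> / 2 / (M + 1)) * (M - (-1)))"
        using M \<eta> by (intro ennreal_mult[symmetric]) auto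
      also have "(\<eta> / 2 / (M + 1)) * (M - (-1)) = \<eta> / 2"
        using nonzero_divide_eq_eq[of "M + 1" "\<eta> / 2" "\<eta> / 2 / (M + 1)"] M by simp
      finally show "emeasure lebesgue (cylinder (\<omega> - K) (-1) M) \<le> ennreal (\<eta> / 2)" .
    qed
    have "small (\<eta>/2 + \<eta>/2) ({x \<in> subgraph \<omega> h. horiz x \<in> K \<and> - 1 < height x + height z \<and> \<not> closed_segment x (x + z) \<subseteq> subgraph \<omega> h}
       \<union> cylinder (\<omega> - K) (-1) M)"
      using \<eta> by (intro small_Un s2 small_mono[OF s1 order_refl b1]) auto
    then show "small \<eta> (tilt_exits (subgraph \<omega> h) z)"
    proof (rule small_mono)
      have "height x < M" if "x \<in> subgraph \<omega> h" for x
        using that h unfolding subgraph_def C1_range_on_def by force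
      then show "tilt_exits (subgraph \<omega> h) z
        \<subseteq> {x \<in> subgraph \<omega> h. horiz x \<in> K \<and> - 1 < height x + height z \<and> \<not> closed_segment x (x + z) \<subseteq> subgraph \<omega> h}
       \<union> cylinder (\<omega> - K) (-1) M"
        by (auto simp: cylinder_def subgraph_def)
    qed simp
  qed
qed

text \<open>Besides the exits through the graph, short segments may leave through the bottom, but only
from a thin slab above it.\<close>

lemma subgraph_short_exit_uniformly_small:
  fixes \<omega> :: "(real^'n::finite) set"
  assumes \<omega>: "open \<omega>" "bounded \<omega>" and I: "0 \<le> I" and M: "0 < M" and \<eta>: "0 < \<eta>"
  obtains \<delta> where "0 < \<delta>"
    "\<And>h z. h \<in> C1_range_on \<omega> M \<Longrightarrow> (\<integral>\<^sup>+y. slope \<omega> h y \<partial>lborel) \<le> ennreal I \<Longrightarrow> norm z \<le> \<delta>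
      \<Longrightarrow> small \<eta> (exits (subgraph \<omega> h) z)"
proof -
  obtain \<delta>1 where \<delta>1: "0 < \<delta>1"
    "\<And>h (z :: real^('n option)). h \<in> C1_range_on \<omega> M \<Longrightarrow> (\<integral>\<^sup>+y. slope \<omega> h y \<partial>lborel) \<le> ennreal I \<Longrightarrow> norm (horiz z) \<le> \<delta>1 \<Longrightarrow> height z \<le> \<delta>1
      \<Longrightarrow> small (\<eta>/2) (tilt_exits (subgraph \<omega> h) z)"
    using subgraph_exit_uniformly_small[OF \<omega> I M half_gt_zero[OF \<eta>]] by blast
  define m where "m = measure lebesgue \<omega>"
  have m0: "0 \<le> m" by (simp add: m_def)
  have em: "emeasure lborel \<omega> = ennreal m"
  proof -
    have "\<omega> \<in> lmeasurable" using \<omega> by (simp add: lmeasurable_open)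
    then have "emeasure lebesgue \<omega> = ennreal m" by (simp add: emeasure_eq_measure2 m_def)
    then show ?thesis using \<omega>(1) by simp
  qed
  define \<delta> where "\<delta> = min \<delta>1 (\<eta> / 4 / (m + 1))"
  have \<delta>0: "0 < \<delta>" using \<delta>1(1) \<eta> m0 by (simp add: \<delta>_def)
  show ?thesis
  proof (rule that[OF \<delta>0])
    fix h and z :: "real^('n option)"
    assume h: "h \<in> C1_range_on \<omega> M" and Ih: "(\<integral>\<^sup>+y. slope \<omega> h y \<partial>lborel) \<le> ennreal I" and z: "norm z \<le> \<delta>"
    let ?C = "cylinder \<omega> (-1) (-1 + 2 * \<delta>) :: (real^('n option)) set"
    have ob: "\<omega> \<in> sets borel" using \<omega>(1) by simp
    have s1: "small (\<eta>/2) (tilt_exits (subgraph \<omega> h) z)"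
      using norm_horiz_le[of z] abs_height_le[of z] z by (intro \<delta>1(2) h Ih) (auto simp: \<delta>_def)
    have s2: "small (\<eta>/2) ?C"
      unfolding small_def
    proof (intro bexI[of _ ?C] conjI order_refl)
      show "?C \<in> sets lebesgue" using cylinder_borel[OF ob, of "-1" "-1 + 2 * \<delta>"] by simp
      have "emeasure lebesgue ?C = ennreal m * ennreal (2 * \<delta>)"
        using emeasure_cylinder[OF ob, of "-1" "-1 + 2 * \<delta>"] cylinder_borel[OF ob, of "-1" "-1 + 2 * \<delta>"] \<delta>0 by (simp add: em)
      also have "\<dots> = ennreal (m * (2 * \<delta>))" using m0 \<delta>0 by (intro ennreal_mult[symmetric]) auto
      also have "\<dots> \<le> ennreal (\<eta>/2)"
      proof (rule ennreal_leI)
        have "m * \<delta> \<le> (m + 1) * (\<eta> / 4 / (m + 1))"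
          using m0 \<delta>0 by (intro mult_mono) (auto simp: \<delta>_def)
        also have "\<dots> = \<eta> / 4" using nonzero_divide_eq_eq[of "m + 1" "\<eta> / 4" "\<eta> / 4 / (m + 1)"] m0 by (simp add: mult.commute)
        finally show "m * (2 * \<delta>) \<le> \<eta> / 2" by linarith
      qed
      finally show "emeasure lebesgue ?C \<le> ennreal (\<eta>/2)" .
    qed
    have "small (\<eta>/2 + \<eta>/2) ((tilt_exits (subgraph \<omega> h) z) \<union> ?C)"
      using \<eta> by (intro small_Un s1 s2) auto
    then show "small \<eta> (exits (subgraph \<omega> h) z)"
    proof (rule small_mono)
      have "\<bar>height z\<bar> \<le> \<delta>" using abs_height_le[of z] z by linarith
      then have "height x < -1 + 2 * \<delta>" if "\<not> - 1 < height x + height z" for x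
        using that \<delta>0 by linarith
      then show "exits (subgraph \<omega> h) z
        \<subseteq> (tilt_exits (subgraph \<omega> h) z) \<union> ?C"
        by (auto simp: subgraph_def cylinder_def)
    qed simp
  qed
qed

text \<open>If one of the two points lies in \<open>K\<close>, the difference is bounded by the variation along the segment, read
from that point; otherwise both lie outside \<open>K\<close>, and the bound \<open>M\<close> is used on \<open>\<omega> - K\<close>.\<close>

lemma graph_translation_small:
  fixes \<omega> :: "(real^'n::finite) set"
  assumes \<omega>: "open \<omega>" "bounded \<omega>" and I: "0 \<le> I" and M: "0 < M" and \<eta>: "0 < \<eta>"
  obtains \<rho> where "0 < \<rho>"
    "\<And>h z. h \<in> C1_range_on \<omega> M \<Longrightarrow> (\<integral>\<^sup>+y. slope \<omega> h y \<partial>lborel) \<le> ennreal I \<Longrightarrow> norm z < \<rho> \<Longrightarrow>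
      (\<integral>\<^sup>+y. norm (indicator \<omega> (y + z) * h (y + z) - indicator \<omega> y * h y) \<partial>lborel) \<le> ennreal \<eta>"
proof -
  obtain K \<epsilon> where K: "compact K" "K \<subseteq> \<omega>" "emeasure lborel (\<omega> - K) \<le> ennreal (\<eta> / 4 / M)" "0 < \<epsilon>"
    "\<And>y w. y \<in> K \<Longrightarrow> norm w < \<epsilon> \<Longrightarrow> y + w \<in> \<omega>"
    using compact_exhaustion[OF \<omega>, of "\<eta> / 4 / M"] M \<eta> by auto
  define \<rho> where "\<rho> = min \<epsilon> (\<eta> / 4 / (I + 1))"
  have \<rho>0: "0 < \<rho>" using K(4) \<eta> I by (simp add: \<rho>_def)
  have Kb: "K \<in> sets borel" using K(1) by (simp add: borel_compact)
  show ?thesis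
  proof (rule that[OF \<rho>0])
    fix h and z :: "real^'n"
    assume h: "h \<in> C1_range_on \<omega> M" and Ih: "(\<integral>\<^sup>+y. slope \<omega> h y \<partial>lborel) \<le> ennreal I" and z: "norm z < \<rho>"
    define H where "H y = indicator \<omega> y * h y" for y
    have Hb: "0 \<le> H y" "H y \<le> M" for y
      using h M by (auto simp: H_def indicator_def C1_range_on_def)
    define V where "V w y = ennreal (norm w) * path_variation \<omega> h w y" for w y
    have mV: "V w \<in> borel_measurable borel" for w
      unfolding V_def[abs_def] by (intro borel_measurable_times_ennreal borel_measurable_const measurable_path_variation[OF \<omega>(1) h])
    have inK: "ennreal \<bar>H (y + w) - H y\<bar> \<le> V w y" if y: "y \<in> K" and w: "norm w < \<rho>" for y w
    proof -
      have seg: "y + s *\<^sub>R w \<in> \<omega>" if "s \<in> {0..1}" for s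
      proof (rule K(5)[OF y])
        have "norm (s *\<^sub>R w) \<le> 1 * norm w" using that unfolding norm_scaleR by (intro mult_right_mono) auto
        also have "\<dots> < \<epsilon>" using w by (simp add: \<rho>_def)
        finally show "norm (s *\<^sub>R w) < \<epsilon>" .
      qed
      have "y \<in> \<omega>" "y + w \<in> \<omega>" using seg[of 0] seg[of 1] by auto
      moreover have "ennreal \<bar>h (y + 1 *\<^sub>R w) - h y\<bar> \<le> V w y"
        unfolding V_def by (rule C1_difference_le[OF h]) (use seg in auto)
      ultimately show ?thesis by (simp add: H_def)
    qed
    define J where "J y = ennreal M * indicator (\<omega> - K) y" for y :: "real^'n"
    have mJ: "J \<in> borel_measurable borel" unfolding J_def[abs_def] using \<omega>(1) Kb by (intro borel_measurable_times_ennreal borel_measurable_const borel_measurable_indicator) auto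
    have Jint: "(\<integral>\<^sup>+y. J y \<partial>lborel) \<le> ennreal (\<eta> / 4)"
    proof -
      have "(\<integral>\<^sup>+y. J y \<partial>lborel) = ennreal M * emeasure lborel (\<omega> - K)"
        unfolding J_def using \<omega>(1) Kb by (intro nn_integral_cmult_indicator) auto
      also have "\<dots> \<le> ennreal M * ennreal (\<eta> / 4 / M)" by (intro mult_left_mono K) auto
      also have "\<dots> = ennreal (\<eta> / 4)" using M \<eta> by (simp flip: ennreal_mult)
      finally show ?thesis .
    qed
    have Vint: "(\<integral>\<^sup>+y. V w y \<partial>lborel) \<le> ennreal (\<eta> / 4)" if w: "norm w < \<rho>" for w
    proof -
      have "(\<integral>\<^sup>+y. V w y \<partial>lborel) = ennreal (norm w) * (\<integral>\<^sup>+y. slope \<omega> h y \<partial>lborel)"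
        unfolding V_def by (simp add: nn_integral_cmult measurable_path_variation[OF \<omega>(1) h] nn_integral_path_variation[OF \<omega>(1) h])
      also have "\<dots> \<le> ennreal (norm w) * ennreal I" by (intro mult_left_mono Ih) auto
      also have "\<dots> = ennreal (norm w * I)" using I by (simp add: ennreal_mult)
      also have "\<dots> \<le> ennreal (\<eta> / 4)"
      proof (rule ennreal_leI)
        have "norm w * I \<le> (\<eta> / 4 / (I + 1)) * (I + 1)"
          using w I \<eta> by (intro mult_mono) (auto simp: \<rho>_def)
        moreover have "(\<eta> / 4 / (I + 1)) * (I + 1) = \<eta> / 4"
          using nonzero_divide_eq_eq[of "I + 1" "\<eta> / 4" "\<eta> / 4 / (I + 1)"] I by linarith
        ultimately show "norm w * I \<le> \<eta> / 4" by linarith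
      qed
      finally show ?thesis .
    qed
    have ptw: "ennreal (norm (H (y + z) - H y)) \<le> (V z y + V (- z) (y + z)) + (J y + J (y + z))" for y
    proof (cases "y \<in> K")
      case True
      then have "ennreal \<bar>H (y + z) - H y\<bar> \<le> V z y" using z by (rule inK)
      then show ?thesis by (simp add: add_increasing2)
    next
      case n1: False
      show ?thesis
      proof (cases "y + z \<in> K")
        case True
        then have "ennreal \<bar>H ((y + z) + (- z)) - H (y + z)\<bar> \<le> V (- z) (y + z)" using z by (intro inK) auto
        then have "ennreal (norm (H (y + z) - H y)) \<le> V (- z) (y + z)" by (simp add: abs_minus_commute)
        then show ?thesis by (simp add: add_increasing add_increasing2)
      next
        case n2: False
        have "ennreal (norm (H (y + z) - H y)) \<le> J y + J (y + z)"
        proof (cases "y \<in> \<omega> \<or> y + z \<in> \<omega>")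
          case True
          have "norm (H (y + z) - H y) \<le> M" using Hb[of y] Hb[of "y + z"] by auto
          then have "ennreal (norm (H (y + z) - H y)) \<le> ennreal M" by (rule ennreal_leI)
          also have "ennreal M \<le> J y + J (y + z)" using True n1 n2 by (auto simp: J_def indicator_def add_increasing add_increasing2)
          finally show ?thesis .
        next
          case False
          then show ?thesis by (simp add: H_def)
        qed
        then show ?thesis by (simp add: add_increasing)
      qed
    qed
    have mt: "(\<lambda>y. f (y + z)) \<in> borel_measurable borel" if "f \<in> borel_measurable borel" for f :: "real^'n \<Rightarrow> ennreal"
      by (rule measurable_compose[OF _ that]) (intro borel_measurable_continuous_onI continuous_intros)
    have "(\<integral>\<^sup>+y. norm (H (y + z) - H y) \<partial>lborel) \<le> (\<integral>\<^sup>+y. (V z y + V (- z) (y + z)) + (J y + J (y + z)) \<partial>lborel)"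
      by (intro nn_integral_mono ptw)
    also have "\<dots> = ((\<integral>\<^sup>+y. V z y \<partial>lborel) + (\<integral>\<^sup>+y. V (- z) y \<partial>lborel)) + ((\<integral>\<^sup>+y. J y \<partial>lborel) + (\<integral>\<^sup>+y. J y \<partial>lborel))"
      using mV mJ mt[OF mV] mt[OF mJ] nn_integral_lborel_translate[OF mV[of "- z"], of z] nn_integral_lborel_translate[OF mJ, of z]
      by (simp add: nn_integral_add borel_measurable_add)
    also have "\<dots> \<le> (ennreal (\<eta>/4) + ennreal (\<eta>/4)) + (ennreal (\<eta>/4) + ennreal (\<eta>/4))"
      using z by (intro add_mono Vint Jint) auto
    also have "\<dots> = ennreal \<eta>" using \<eta> by (simp flip: ennreal_plus)
    finally show "(\<integral>\<^sup>+y. norm (indicator \<omega> (y + z) * h (y + z) - indicator \<omega> y * h y) \<partial>lborel) \<le> ennreal \<eta>"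
      by (simp add: H_def)
  qed
qed

section \<open>Translations controlled by directional increments\<close>

text \<open>The function vanishes outside \<open>U n\<close>, so a large increment needs an end point in \<open>U n\<close>; then either
the segment stays inside or it is an exit from one of its end points. The quadratic dependence on the length in
\<open>seg\<close> leaves one power of \<open>|y|\<close> to spare.\<close>

lemma difference_quotient_small:
  fixes v :: "'i \<Rightarrow> 'a::euclidean_space \<Rightarrow> 'a" and U :: "'i \<Rightarrow> 'a set"
  assumes out: "\<And>n x. x \<notin> U n \<Longrightarrow> v n x = 0" and I: "0 \<le> I"
    and seg: "\<And>n y \<delta>. 0 < \<delta> \<Longrightarrow> small (I * (norm y)\<^sup>2 / \<delta>) (jumps (U n) (v n) \<delta> y)"
    and bad: "\<And>\<eta>. 0 < \<eta> \<Longrightarrow> \<exists>\<rho>>0. \<forall>n y. norm y \<le> \<rho> \<longrightarrow> small \<eta> (exits (U n) y)"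
    and pos: "0 < \<eta>" "0 < \<delta>"
  shows "\<exists>\<rho>>0. \<forall>n y. norm y \<le> \<rho> \<longrightarrow> small \<eta> {x. \<delta> * norm y < \<bar>(v n (x + y) - v n x) \<bullet> y\<bar>}"
proof -
  obtain \<rho>1 where \<rho>1: "0 < \<rho>1" "\<And>n y. norm y \<le> \<rho>1 \<Longrightarrow> small (\<eta> / 3) (exits (U n) y)"
    using bad[of "\<eta> / 3"] pos by auto
  define \<rho> where "\<rho> = min \<rho>1 (\<eta> * \<delta> / (3 * (I + 1)))"
  have "0 < \<rho>" using \<rho>1(1) pos I by (simp add: \<rho>_def)
  moreover have "small \<eta> {x. \<delta> * norm y < \<bar>(v n (x + y) - v n x) \<bullet> y\<bar>}" if y: "norm y \<le> \<rho>" for n y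
  proof (cases "y = 0")
    case True
    then show ?thesis by (simp add: small_empty)
  next
    case False
    let ?S1 = "jumps (U n) (v n) (\<delta> * norm y) y"
    let ?B = "\<lambda>y. exits (U n) y"
    have "I * norm y \<le> (I + 1) * (\<eta> * \<delta> / (3 * (I + 1)))"
      using y I by (intro mult_mono) (auto simp: \<rho>_def)
    also have "\<dots> = \<eta> / 3 * \<delta>"
      using I by (simp add: add_eq_0_iff divide_simps)
    finally have le: "I * (norm y)\<^sup>2 / (\<delta> * norm y) \<le> \<eta> / 3"
      using False pos by (simp add: power2_eq_square divide_le_eq)
    have "0 < \<delta> * norm y" using False pos by simp
    from small_mono[OF seg[OF this] order_refl le] have s1: "small (\<eta> / 3) ?S1" .
    have s2: "small (\<eta> / 3) (?B y)" using y by (intro \<rho>1(2)) (simp add: \<rho>_def)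
    have "small (\<eta> / 3) (?B (- y))" using y by (intro \<rho>1(2)) (simp add: \<rho>_def)
    then have s3: "small (\<eta> / 3) {x. x + y \<in> ?B (- y)}" by (rule small_translate)
    have "small (\<eta> / 3 + \<eta> / 3 + \<eta> / 3) (?S1 \<union> ?B y \<union> {x. x + y \<in> ?B (- y)})"
      using pos by (intro small_Un s1 s2 s3) auto
    then show ?thesis
    proof (rule small_mono)
      show "{x. \<delta> * norm y < \<bar>(v n (x + y) - v n x) \<bullet> y\<bar>} \<subseteq> ?S1 \<union> ?B y \<union> {x. x + y \<in> ?B (- y)}"
      proof (rule subsetI, rule ccontr)
        fix x assume a: "x \<in> {x. \<delta> * norm y < \<bar>(v n (x + y) - v n x) \<bullet> y\<bar>}"
          and b: "x \<notin> ?S1 \<union> ?B y \<union> {x. x + y \<in> ?B (- y)}"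
        have n: "\<not> closed_segment x (x + y) \<subseteq> U n" using a b by blast
        then have "x \<notin> U n" using b by blast
        moreover have "x + y \<notin> U n"
          using b n by (simp add: closed_segment_commute)
        ultimately have "v n (x + y) = 0" "v n x = 0" by (simp_all add: out)
        moreover have "0 \<le> \<delta> * norm y" using pos by simp
        ultimately show False using a by simp
      qed
    qed simp
  qed
  ultimately show ?thesis by blast
qed

text \<open>Write \<open>a\<close>, \<open>b\<close>, \<open>c\<close> for the values at \<open>x\<close>, \<open>x + y\<close>, \<open>x + z\<close> with \<open>z\<close> a multiple of the basis
vector. The identity \<open>(b - a) \<bullet> z = (c - a) \<bullet> z - (c - b) \<bullet> (z - y) - (c - b) \<bullet> y\<close> expresses an increment
across the segment through two increments along segments and a remainder bounded by \<open>|y|\<close> times values of the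
function. First the length of \<open>z\<close> is fixed, then \<open>y\<close> is taken much shorter.\<close>

lemma translation_component_small:
  fixes v :: "'i \<Rightarrow> 'a::euclidean_space \<Rightarrow> 'a"
  assumes quot: "\<And>\<eta> \<delta>. 0 < \<eta> \<Longrightarrow> 0 < \<delta> \<Longrightarrow> \<exists>\<rho>>0. \<forall>n y. norm y \<le> \<rho> \<longrightarrow> small \<eta> {x. \<delta> * norm y < \<bar>(v n (x + y) - v n x) \<bullet> y\<bar>}"
    and tight: "\<And>\<eta>. 0 < \<eta> \<Longrightarrow> \<exists>R. \<forall>n. small \<eta> {x. R < norm (v n x)}"
    and pos: "0 < \<eta>" "0 < \<delta>" and b: "b \<in> Basis"
  shows "\<exists>\<rho>>0. \<forall>n y. norm y < \<rho> \<longrightarrow> small (4 * \<eta>) {x. 4 * \<delta> < \<bar>(v n (x + y) - v n x) \<bullet> b\<bar>}"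
proof -
  obtain r0 where r0: "0 < r0" "\<And>n y. norm y \<le> r0 \<Longrightarrow> small \<eta> {x. \<delta> * norm y < \<bar>(v n (x + y) - v n x) \<bullet> y\<bar>}"
    using quot[OF pos] by auto
  obtain R0 where R0: "\<And>n. small \<eta> {x. R0 < norm (v n x)}" using tight[OF pos(1)] by auto
  define R where "R = \<bar>R0\<bar> + 1"
  have R: "0 < R" "small \<eta> {x. R < norm (v n x)}" for n
    by (auto simp: R_def intro: small_mono[OF R0[of n]])
  \<comment> \<open>Both \<open>z\<close> and \<open>z - y\<close> must be no longer than \<open>r0\<close>.\<close>
  define r where "r = r0 / 2"
  have r: "0 < r" using r0(1) by (simp add: r_def)
  define \<rho> where "\<rho> = min r (\<delta> * r / (2 * R))"
  have "0 < \<rho>" using r R pos by (simp add: \<rho>_def)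
  moreover have "small (4 * \<eta>) {x. 4 * \<delta> < \<bar>(v n (x + y) - v n x) \<bullet> b\<bar>}" if y: "norm y < \<rho>" for n y
  proof -
    define z where "z = r *\<^sub>R b"
    have nz: "norm z = r" using b r by (simp add: z_def)
    have nzy: "norm (z - y) \<le> 2 * r"
      using norm_triangle_ineq4[of z y] y by (simp add: nz \<rho>_def)
    let ?P = "{x. \<delta> * norm z < \<bar>(v n (x + z) - v n x) \<bullet> z\<bar>}"
    let ?Q = "{x. \<delta> * norm (z - y) < \<bar>(v n (x + (z - y)) - v n x) \<bullet> (z - y)\<bar>}"
    let ?T = "{x. R < norm (v n x)}"
    have sP: "small \<eta> ?P" by (rule r0(2)) (use nz r0(1) in \<open>simp add: r_def\<close>)
    have "small \<eta> ?Q" by (rule r0(2)) (use nzy in \<open>simp add: r_def\<close>)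
    then have sQ: "small \<eta> {x. x + y \<in> ?Q}" by (rule small_translate)
    have sT: "small \<eta> {x. x + w \<in> ?T}" for w by (rule small_translate[OF R(2)])
    have "small (\<eta> + \<eta> + \<eta> + \<eta>) (?P \<union> {x. x + y \<in> ?Q} \<union> {x. x + y \<in> ?T} \<union> {x. x + z \<in> ?T})"
      using pos by (intro small_Un sP sQ sT) auto
    then show ?thesis
    proof (rule small_mono)
      show "{x. 4 * \<delta> < \<bar>(v n (x + y) - v n x) \<bullet> b\<bar>} \<subseteq> ?P \<union> {x. x + y \<in> ?Q} \<union> {x. x + y \<in> ?T} \<union> {x. x + z \<in> ?T}"
      proof (rule subsetI, rule ccontr)
        fix x assume a: "x \<in> {x. 4 * \<delta> < \<bar>(v n (x + y) - v n x) \<bullet> b\<bar>}"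
          and nn: "x \<notin> ?P \<union> {x. x + y \<in> ?Q} \<union> {x. x + y \<in> ?T} \<union> {x. x + z \<in> ?T}"
        let ?a = "v n x" and ?b = "v n (x + y)" and ?c = "v n (x + z)"
        have P: "\<bar>(?c - ?a) \<bullet> z\<bar> \<le> \<delta> * r" using nn by (simp add: nz not_less)
        have "\<bar>(?c - ?b) \<bullet> (z - y)\<bar> \<le> \<delta> * norm (z - y)" using nn by (simp add: not_less add.assoc)
        also have "\<dots> \<le> \<delta> * (2 * r)" using nzy pos by (intro mult_left_mono) auto
        finally have Q: "\<bar>(?c - ?b) \<bullet> (z - y)\<bar> \<le> 2 * \<delta> * r" by simp
        have T: "norm ?b \<le> R" "norm ?c \<le> R" using nn by (simp_all add: not_less)
        have "\<bar>(?c - ?b) \<bullet> y\<bar> \<le> norm (?c - ?b) * norm y" by (rule Cauchy_Schwarz_ineq2)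
        also have "\<dots> \<le> (2 * R) * (\<delta> * r / (2 * R))"
          using norm_triangle_ineq4[of ?c ?b] T y R(1) by (intro mult_mono) (auto simp: \<rho>_def)
        also have "\<dots> = \<delta> * r" using R(1) by simp
        finally have Y: "\<bar>(?c - ?b) \<bullet> y\<bar> \<le> \<delta> * r" .
        have "(?b - ?a) \<bullet> z = (?c - ?a) \<bullet> z - (?c - ?b) \<bullet> (z - y) - (?c - ?b) \<bullet> y"
          by (simp add: inner_diff_left inner_diff_right)
        then have "\<bar>(?b - ?a) \<bullet> z\<bar> \<le> \<delta> * r + 2 * \<delta> * r + \<delta> * r" using P Q Y by linarith
        moreover have "\<bar>(?b - ?a) \<bullet> z\<bar> = r * \<bar>(?b - ?a) \<bullet> b\<bar>" using r by (simp add: z_def abs_mult)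
        moreover have "r * (4 * \<delta>) < r * \<bar>(?b - ?a) \<bullet> b\<bar>" using a r by (intro mult_strict_left_mono) auto
        ultimately show False by (simp add: algebra_simps)
      qed
    qed simp
  qed
  ultimately show ?thesis by blast
qed

lemma translation_small:
  fixes v :: "'i \<Rightarrow> 'a::euclidean_space \<Rightarrow> 'a"
  assumes comp: "\<And>b \<eta> \<delta>. 0 < \<eta> \<Longrightarrow> 0 < \<delta> \<Longrightarrow> b \<in> Basis \<Longrightarrow>
      \<exists>\<rho>>0. \<forall>n y. norm y < \<rho> \<longrightarrow> small (4 * \<eta>) {x. 4 * \<delta> < \<bar>(v n (x + y) - v n x) \<bullet> b\<bar>}"
    and pos: "0 < \<eta>" "0 < \<delta>"
  shows "\<exists>\<rho>>0. \<forall>n y. norm y < \<rho> \<longrightarrow> small \<eta> {x. \<delta> < norm (v n (x + y) - v n x)}"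
proof -
  let ?d = "real DIM('a)"
  have d: "0 < ?d" by simp
  have "\<forall>b\<in>Basis. \<exists>\<rho>>0. \<forall>n y. norm y < \<rho> \<longrightarrow> small (4 * (\<eta> / (4 * ?d))) {x. 4 * (\<delta> / (4 * ?d)) < \<bar>(v n (x + y) - v n x) \<bullet> b\<bar>}"
    using pos d by (intro ballI comp) auto
  then obtain \<rho> where \<rho>: "\<And>b. b \<in> Basis \<Longrightarrow> 0 < \<rho> b"
    "\<And>b n y. b \<in> Basis \<Longrightarrow> norm y < \<rho> b \<Longrightarrow> small (4 * (\<eta> / (4 * ?d))) {x. 4 * (\<delta> / (4 * ?d)) < \<bar>(v n (x + y) - v n x) \<bullet> b\<bar>}"
    by (auto dest!: bchoice)
  define \<rho>' where "\<rho>' = Min (\<rho> ` (Basis :: 'a set))"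
  have \<rho>': "0 < \<rho>'" "\<And>b. b \<in> Basis \<Longrightarrow> \<rho>' \<le> \<rho> b"
    using \<rho>(1) by (auto simp: \<rho>'_def)
  have "small \<eta> {x. \<delta> < norm (v n (x + y) - v n x)}" if y: "norm y < \<rho>'" for n y
  proof -
    let ?S = "\<lambda>b. {x. \<delta> / ?d < \<bar>(v n (x + y) - v n x) \<bullet> b\<bar>}"
    have "small (\<eta> / ?d) (?S b)" if "b \<in> Basis" for b
      using \<rho>(2)[OF that, of y n] \<rho>'(2)[OF that] y by simp
    then have "small (?d * (\<eta> / ?d)) (\<Union>b\<in>Basis. ?S b)"
      using pos d by (intro small_UN) auto
    then show ?thesis
    proof (rule small_mono)
      show "{x. \<delta> < norm (v n (x + y) - v n x)} \<subseteq> (\<Union>b\<in>Basis. ?S b)"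
      proof (rule subsetI, rule ccontr)
        fix x assume a: "x \<in> {x. \<delta> < norm (v n (x + y) - v n x)}" and nn: "x \<notin> (\<Union>b\<in>Basis. ?S b)"
        have "norm (v n (x + y) - v n x) \<le> (\<Sum>b\<in>Basis. \<bar>(v n (x + y) - v n x) \<bullet> b\<bar>)" by (rule norm_le_l1)
        also have "\<dots> \<le> (\<Sum>b\<in>(Basis::'a set). \<delta> / ?d)" using nn by (intro sum_mono) (auto simp: not_less)
        also have "\<dots> = \<delta>" using d by simp
        finally show False using a by simp
      qed
    qed (use d in simp)
  qed
  with \<rho>'(1) show ?thesis by blast
qed

section \<open>Tightness from the clamped base\<close>

lemma inner_lift_coord: "v \<bullet> lift_coord y t = horiz v \<bullet> y + height v * t"
  by (simp add: inner_vec_def UNIV_option_conv sum.reindex horiz_def height_def lift_coord_def)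

lemma norm_lift_coord_le:
  fixes y :: "real^'n::finite"
  shows "norm (lift_coord y t) \<le> norm y + \<bar>t\<bar>"
proof -
  have eq: "lift_coord y t = lift_coord y 0 + lift_coord (0 :: real^'n) t"
    by (auto simp: vec_eq_iff lift_coord_def split: option.split)
  have "norm (lift_coord y t) \<le> norm (lift_coord y 0) + norm (lift_coord (0 :: real^'n) t)"
    by (subst eq) (rule norm_triangle_ineq)
  moreover have "norm (lift_coord y 0) = norm y" "norm (lift_coord (0 :: real^'n) t) = \<bar>t\<bar>"
    by (simp_all add: norm_vec_def L2_set_def UNIV_option_conv sum.reindex lift_coord_def)
  ultimately show ?thesis by simp
qed

text \<open>From a point of height at least zero, descend by one half along \<open>card (UNIV :: 'n option set)\<close> linearly
independent, nearly vertical vectors \<open>Y i\<close>. At the end points the function is bounded by the hypothesis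
\<open>below\<close>, and the increments in the directions \<open>Y i\<close> are controlled, so all \<open>v n x \<bullet> Y i\<close> are bounded.
The tilt \<open>\<epsilon>\<close> must be small for the exit sets to be small; it enters the bound only through \<open>1/\<epsilon>\<close>.\<close>

lemma subgraph_tightness_step:
  fixes v :: "'i \<Rightarrow> real^('n::finite option) \<Rightarrow> real^('n option)"
  assumes out: "\<And>n x. x \<notin> U n \<Longrightarrow> v n x = 0" and I: "0 \<le> I"
    and seg: "\<And>n y \<delta>. 0 < \<delta> \<Longrightarrow> small (I * (norm y)\<^sup>2 / \<delta>) (jumps (U n) (v n) \<delta> y)"
    and bad: "\<And>\<eta>. 0 < \<eta> \<Longrightarrow> \<exists>\<delta>>0. \<forall>n z. norm (horiz z) \<le> \<delta> \<longrightarrow> height z \<le> \<delta> \<longrightarrow>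
        small \<eta> (tilt_exits (U n) z)"
    and base: "\<And>\<eta>. 0 < \<eta> \<Longrightarrow> \<exists>R. \<forall>n. small \<eta> {x. height x < 0 \<and> R < norm (v n x)}"
    and below: "\<And>\<eta>. 0 < \<eta> \<Longrightarrow> \<exists>R. \<forall>n. small \<eta> {x. height x < a \<and> R < norm (v n x)}"
    and \<eta>: "0 < \<eta>"
  shows "\<exists>R. \<forall>n. small \<eta> {x. height x < a + 1/2 \<and> R < norm (v n x)}"
proof -
  define N where "N = real CARD('n option)"
  have N: "0 < N" by (simp add: N_def)
  \<comment> \<open>One exceptional set on the base, and three for each of the \<open>N\<close> directions.\<close>
  define e where "e = \<eta> / (3 * N + 1)"
  have e: "0 < e" using \<eta> N by (simp add: e_def)
  have etot: "e + N * (e + e + e) = \<eta>"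
  proof -
    have "e * (3 * N + 1) = \<eta>" using N by (simp add: e_def)
    then show ?thesis by (simp add: algebra_simps)
  qed
  obtain \<delta> where \<delta>: "0 < \<delta>" "\<And>n z. norm (horiz z) \<le> \<delta> \<Longrightarrow> height z \<le> \<delta> \<Longrightarrow>
        small e (tilt_exits (U n) z)"
    using bad[OF e] by auto
  obtain R0 where R0: "\<And>n. small e {x. height x < 0 \<and> R0 < norm (v n x)}" using base[OF e] by auto
  obtain R1 where R1: "\<And>n. small e {x. height x < a \<and> R1 < norm (v n x)}" using below[OF e] by auto
  define R where "R = \<bar>R1\<bar>"
  define \<epsilon> where "\<epsilon> = min \<delta> 1"
  have \<epsilon>: "0 < \<epsilon>" "\<epsilon> \<le> 1" "\<epsilon> \<le> \<delta>" using \<delta>(1) by (auto simp: \<epsilon>_def)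
  define Y :: "'n option \<Rightarrow> real^('n option)" where
    "Y i = lift_coord (case i of None \<Rightarrow> 0 | Some j \<Rightarrow> \<epsilon> *\<^sub>R axis j 1) (- 1/2)" for i
  have Yh: "norm (horiz (Y i)) \<le> \<epsilon>" "height (Y i) = - 1/2" for i
    using \<epsilon> by (auto simp: Y_def split: option.split)
  have Yn: "norm (Y i) \<le> 2" for i
    using norm_lift_coord_le[of "horiz (Y i)" "height (Y i)"] Yh[of i] \<epsilon> by (simp add: Y_def)
  \<comment> \<open>Since \<open>norm (Y i) \<le> 2\<close>, increments exceed \<open>L\<close> only on a set of measure at most \<open>e\<close>.\<close>
  define L where "L = 4 * I / e + 1"
  have L: "0 < L" using I e by (simp add: L_def add_nonneg_pos)
  define Q where "Q = L + 2 * R"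
  have Q: "0 \<le> Q" using L by (simp add: Q_def R_def)
  define Rnew where "Rnew = max (max 0 R0) (N * (2 * Q / \<epsilon>))"
  have "small \<eta> {x. height x < a + 1/2 \<and> Rnew < norm (v n x)}" for n
  proof -
    let ?B0 = "{x. height x < 0 \<and> R0 < norm (v n x)}"
    let ?A = "\<lambda>i. tilt_exits (U n) (Y i)"
    let ?S = "\<lambda>i. jumps (U n) (v n) L (Y i)"
    let ?B1 = "{x. height x < a \<and> R1 < norm (v n x)}"
    let ?C = "\<lambda>i. ?A i \<union> ?S i \<union> {x. x + Y i \<in> ?B1}"
    have sA: "small e (?A i)" for i
      using Yh[of i] \<epsilon> \<delta>(1) by (intro \<delta>(2)) auto
    have sS: "small e (?S i)" for i
    proof (rule small_mono[OF seg[OF L] order_refl])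
      have "(norm (Y i))\<^sup>2 \<le> 2\<^sup>2" using Yn[of i] by (intro power_mono) auto
      then have "I * (norm (Y i))\<^sup>2 \<le> I * 4" using I by (intro mult_left_mono) auto
      also have "I * 4 \<le> e * L" using e by (simp add: L_def distrib_left)
      finally show "I * (norm (Y i))\<^sup>2 / L \<le> e" using L by (simp add: divide_le_eq)
    qed
    have sB: "small e {x. x + Y i \<in> ?B1}" for i by (rule small_translate[OF R1])
    have sC: "small (e + e + e) (?C i)" for i using e by (intro small_Un sA sS sB) auto
    have "small (N * (e + e + e)) (\<Union>i\<in>UNIV. ?C i)"
      unfolding N_def using e sC by (intro small_UN) auto
    then have "small (e + N * (e + e + e)) (?B0 \<union> (\<Union>i\<in>UNIV. ?C i))"
      using e N by (intro small_Un R0) auto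
    then show ?thesis
    proof (rule small_mono)
      show "e + N * (e + e + e) \<le> \<eta>" using etot by simp
      show "{x. height x < a + 1/2 \<and> Rnew < norm (v n x)} \<subseteq> ?B0 \<union> (\<Union>i\<in>UNIV. ?C i)"
      proof (rule subsetI, rule ccontr)
        fix x assume x: "x \<in> {x. height x < a + 1/2 \<and> Rnew < norm (v n x)}"
          and nn: "x \<notin> ?B0 \<union> (\<Union>i\<in>UNIV. ?C i)"
        have gt: "0 < norm (v n x)" "R0 < norm (v n x)" "N * (2 * Q / \<epsilon>) < norm (v n x)"
          using x by (auto simp: Rnew_def)
        have xU: "x \<in> U n" using gt(1) out[of x n] by auto
        have h0: "0 \<le> height x" using nn gt(2) by (auto simp: not_less)
        have bd: "\<bar>v n x \<bullet> Y i\<bar> \<le> Q" for i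
        proof -
          have nC: "x \<notin> ?A i" "x \<notin> ?S i" "x + Y i \<notin> ?B1" using nn by blast+
          have "closed_segment x (x + Y i) \<subseteq> U n" using nC(1) xU h0 Yh[of i] by auto
          then have l: "\<bar>(v n (x + Y i) - v n x) \<bullet> Y i\<bar> \<le> L" using nC(2) by auto
          have "height (x + Y i) < a" using x Yh[of i] by simp
          then have "norm (v n (x + Y i)) \<le> R" using nC(3) by (auto simp: R_def)
          then have "norm (v n (x + Y i)) * norm (Y i) \<le> R * 2" using Yn[of i] by (intro mult_mono) (auto simp: R_def)
          then have "\<bar>v n (x + Y i) \<bullet> Y i\<bar> \<le> 2 * R" using Cauchy_Schwarz_ineq2[of "v n (x + Y i)" "Y i"] by simp
          then show ?thesis using l by (simp add: Q_def inner_diff_left)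
        qed
        have hv: "\<bar>height (v n x)\<bar> \<le> 2 * Q" using bd[of None] by (simp add: Y_def inner_lift_coord)
        have cv: "\<bar>v n x $ i\<bar> \<le> 2 * Q / \<epsilon>" for i
        proof (cases i)
          case None
          have "2 * Q * \<epsilon> \<le> 2 * Q * 1" using Q \<epsilon> by (intro mult_left_mono) auto
          then have "2 * Q \<le> 2 * Q / \<epsilon>" using \<epsilon> by (simp add: le_divide_eq)
          then show ?thesis using hv None by (simp add: height_def)
        next
          case (Some j)
          have "\<bar>\<epsilon> * v n x $ Some j - height (v n x) / 2\<bar> \<le> Q"
            using bd[of "Some j"] by (simp add: Y_def inner_lift_coord inner_axis horiz_def)
          then have "\<bar>\<epsilon> * v n x $ Some j\<bar> \<le> 2 * Q" using hv by linarith
          then show ?thesis using \<epsilon> Some by (simp add: abs_mult le_divide_eq mult.commute)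
        qed
        have "norm (v n x) \<le> (\<Sum>i\<in>UNIV. \<bar>v n x $ i\<bar>)" by (rule norm_le_l1_cart)
        also have "\<dots> \<le> (\<Sum>i\<in>(UNIV::'n option set). 2 * Q / \<epsilon>)" by (intro sum_mono cv)
        also have "\<dots> = N * (2 * Q / \<epsilon>)" by (simp add: N_def)
        finally show False using gt(3) by simp
      qed
    qed
  qed
  then show ?thesis by blast
qed

text \<open>Bounds climb from the base in slabs of height one half, up to the level \<open>M\<close>.\<close>

lemma subgraph_tightness:
  fixes v :: "'i \<Rightarrow> real^('n::finite option) \<Rightarrow> real^('n option)"
  assumes out: "\<And>n x. x \<notin> U n \<Longrightarrow> v n x = 0" and I: "0 \<le> I"
    and seg: "\<And>n y \<delta>. 0 < \<delta> \<Longrightarrow> small (I * (norm y)\<^sup>2 / \<delta>) (jumps (U n) (v n) \<delta> y)"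
    and bad: "\<And>\<eta>. 0 < \<eta> \<Longrightarrow> \<exists>\<delta>>0. \<forall>n z. norm (horiz z) \<le> \<delta> \<longrightarrow> height z \<le> \<delta> \<longrightarrow>
        small \<eta> (tilt_exits (U n) z)"
    and base: "\<And>\<eta>. 0 < \<eta> \<Longrightarrow> \<exists>R. \<forall>n. small \<eta> {x. height x < 0 \<and> R < norm (v n x)}"
    and top: "\<And>n x. x \<in> U n \<Longrightarrow> height x < M"
    and \<eta>: "0 < \<eta>"
  shows "\<exists>R. \<forall>n. small \<eta> {x. R < norm (v n x)}"
proof -
  have P: "\<forall>\<eta>>0. \<exists>R. \<forall>n. small \<eta> {x. height x < real k / 2 \<and> R < norm (v n x)}" for k
  proof (induction k)
    case 0
    then show ?case using base by simp
  next
    case (Suc k)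
    have "\<exists>R. \<forall>n. small \<eta> {x. height x < real k / 2 + 1/2 \<and> R < norm (v n x)}" if "0 < \<eta>" for \<eta>
      by (rule subgraph_tightness_step[OF out I seg bad base _ that]) (use Suc in auto)
    then show ?case by (simp add: add_divide_distrib add.commute)
  qed
  obtain k where k: "2 * M \<le> real k" using real_arch_simple by blast
  obtain R where R: "\<And>n. small \<eta> {x. height x < real k / 2 \<and> R < norm (v n x)}" using P[of k] \<eta> by blast
  have "small \<eta> {x. max R 0 < norm (v n x)}" for n
  proof (rule small_mono[OF R _ order_refl])
    show "{x. max R 0 < norm (v n x)} \<subseteq> {x. height x < real k / 2 \<and> R < norm (v n x)}"
    proof (rule subsetI)
      fix x assume x: "x \<in> {x. max R 0 < norm (v n x)}"
      then have "x \<in> U n" using out[of x n] by auto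
      from top[OF this] show "x \<in> {x. height x < real k / 2 \<and> R < norm (v n x)}" using x k by auto
    qed
  qed
  then show ?thesis by blast
qed

section \<open>Bounds from the energy\<close>

lemma open_subgraph:
  assumes "open \<omega>" "h \<in> C1_range_on \<omega> M"
  shows "open (subgraph \<omega> h)"
proof -
  have o: "open (horiz -` \<omega>)"
    using open_vimage[OF assms(1) continuous_on_horiz] .
  have "continuous_on (horiz -` \<omega>) (\<lambda>x. (height x, h (horiz x)))"
    by (intro continuous_on_Pair continuous_on_height continuous_on_compose2[OF C1_continuous[OF assms(2)] continuous_on_horiz]) auto
  moreover have "open {p::real \<times> real. -1 < fst p \<and> fst p < snd p}"
    by (intro open_Collect_conj open_Collect_less continuous_intros)
  ultimately have "open ((\<lambda>x. (height x, h (horiz x))) -` {p. -1 < fst p \<and> fst p < snd p} \<inter> horiz -` \<omega>)"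
    using continuous_on_open_vimage[OF o] by blast
  moreover have "subgraph \<omega> h = (\<lambda>x. (height x, h (horiz x))) -` {p. -1 < fst p \<and> fst p < snd p} \<inter> horiz -` \<omega>"
    by (auto simp: subgraph_def)
  ultimately show ?thesis by simp
qed

lemma norm_transpose: "norm (transpose A) = norm A"
  for A :: "real^'n^'m"
  unfolding norm_eq_sqrt_inner by (simp add: inner_vec_def transpose_def) (rule sum.swap)

lemma norm_symmetric_part_le: "norm (sym_part A) \<le> norm A"
  for A :: "real^'n^'n"
  using norm_triangle_ineq[of "transpose A" A] by (simp add: norm_transpose)

text \<open>Turns bounds on \<open>p\<close>-th powers into bounds in mean on sets of finite measure.\<close>

lemma le_one_add_powr:
  fixes a p :: real
  assumes "0 \<le> a" "1 < p"
  shows "a \<le> 1 + a powr p"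
proof (cases "a \<le> 1")
  case False
  then have "a powr 1 \<le> a powr p" using assms by (intro powr_mono) auto
  then show ?thesis using False by simp
qed (use assms in \<open>auto intro: add_increasing2\<close>)

lemma Lp_norm_integral_finite:
  fixes g :: "'a::euclidean_space \<Rightarrow> 'b::{banach, second_countable_topology}"
  assumes "g \<in> Lp_on p A" "1 < p" "A \<in> lmeasurable"
  shows "(\<integral>\<^sup>+x. ennreal (norm (g x)) \<partial>lebesgue_on A) < \<infinity>"
proof -
  have AL: "A \<inter> space lebesgue \<in> sets lebesgue" using assms(3) by auto
  have g: "g \<in> borel_measurable (lebesgue_on A)" "integrable (lebesgue_on A) (\<lambda>x. norm (g x) powr p)"
    using assms(1) by (auto simp: Lp_on_def)
  have "(\<integral>\<^sup>+x. ennreal (norm (g x)) \<partial>lebesgue_on A) \<le> (\<integral>\<^sup>+x. 1 + ennreal (norm (g x) powr p) \<partial>lebesgue_on A)"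
  proof (rule nn_integral_mono)
    fix x
    have "norm (g x) \<le> 1 + norm (g x) powr p" by (rule le_one_add_powr[OF norm_ge_zero assms(2)])
    then have "ennreal (norm (g x)) \<le> ennreal (1 + norm (g x) powr p)" by (rule ennreal_leI)
    then show "ennreal (norm (g x)) \<le> 1 + ennreal (norm (g x) powr p)" by simp
  qed
  also have "\<dots> = emeasure (lebesgue_on A) (space (lebesgue_on A)) + (\<integral>\<^sup>+x. ennreal (norm (g x) powr p) \<partial>lebesgue_on A)"
    using g(2) by (subst nn_integral_add) (auto dest: borel_measurable_integrable)
  also have "\<dots> < \<infinity>"
  proof -
    have "emeasure (lebesgue_on A) (space (lebesgue_on A)) = emeasure lebesgue A"
      using AL by (simp add: emeasure_restrict_space)
    moreover have "emeasure lebesgue A < \<infinity>"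
      using fmeasurableD2[OF assms(3)] by (simp only: infinity_ennreal_def top.not_eq_extremum)
    moreover have "(\<integral>\<^sup>+x. ennreal (norm (g x) powr p) \<partial>lebesgue_on A) < \<infinity>"
      using g(2) by (simp add: integrable_iff_bounded)
    ultimately show ?thesis by simp
  qed
  finally show ?thesis .
qed

lemma cylinder_lmeasurable:
  fixes \<omega> :: "(real^'n::finite) set"
  assumes "open \<omega>" "bounded \<omega>" "a \<le> b"
  shows "cylinder \<omega> a b \<in> lmeasurable"
proof -
  have ob: "\<omega> \<in> sets borel" using assms by simp
  have "\<omega> \<in> lmeasurable" using assms by (simp add: lmeasurable_open)
  then have "emeasure lborel \<omega> < \<infinity>" using ob by (simp add: fmeasurable_def)
  then have "emeasure lborel (cylinder \<omega> a b :: (real^('n option)) set) < \<infinity>"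
    by (simp add: emeasure_cylinder[OF ob assms(3)] ennreal_mult_less_top)
  then show ?thesis using cylinder_borel[OF ob, of a b] by (simp add: fmeasurable_def)
qed

lemma bounded_cylinder:
  fixes \<omega> :: "(real^'n::finite) set"
  assumes "bounded \<omega>"
  shows "bounded (cylinder \<omega> a b)"
proof -
  obtain B where B: "\<And>y. y \<in> \<omega> \<Longrightarrow> norm y \<le> B" using assms by (auto simp: bounded_iff)
  have "norm x \<le> B + (\<bar>a\<bar> + \<bar>b\<bar>)" if "x \<in> cylinder \<omega> a b" for x
  proof -
    have "x = lift_coord (horiz x) (height x)"
      by (auto simp: vec_eq_iff lift_coord_def horiz_def height_def split: option.split)
    then have "norm x \<le> norm (horiz x) + \<bar>height x\<bar>" by (metis norm_lift_coord_le)
    moreover have "norm (horiz x) \<le> B" using B that by (auto simp: cylinder_def)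
    moreover have "\<bar>height x\<bar> \<le> \<bar>a\<bar> + \<bar>b\<bar>" using that by (auto simp: cylinder_def)
    ultimately show ?thesis by linarith
  qed
  then show ?thesis by (auto simp: bounded_iff)
qed

lemma open_cylinder: "open \<omega> \<Longrightarrow> open (cylinder \<omega> a b)"
proof -
  assume "open \<omega>"
  then have "open ((horiz -` \<omega>) \<inter> (height -` {a<..<b}))"
    by (intro open_Int open_vimage[OF _ continuous_on_horiz] open_vimage[OF _ continuous_on_height]) auto
  moreover have "cylinder \<omega> a b = (horiz -` \<omega>) \<inter> (height -` {a<..<b})" by (auto simp: cylinder_def)
  ultimately show ?thesis by simp
qed

lemma AE_height_nonzero: "AE x in lborel. height (x :: real^('n::finite option)) \<noteq> 0"
proof -
  let ?B = "{x :: real^('n option). height x = 0}"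
  have B: "?B \<in> sets borel" using measurable_sets[OF measurable_height, of "{0}"] by (simp add: vimage_def)
  have "emeasure lborel ?B = (\<integral>\<^sup>+y. emeasure lborel {t. lift_coord y t \<in> ?B} \<partial>(lborel :: (real^'n) measure))"
    by (rule emeasure_lift_coord[OF B])
  also have "\<dots> = 0" by simp
  finally have "AE x in lborel. x \<notin> ?B" using B by (intro AE_not_in) auto
  then show ?thesis by simp
qed

lemma slope_bound:
  fixes \<omega> :: "(real^'n::finite) set"
  assumes "open \<omega>" "h \<in> C1_range_on \<omega> M"
    and "(\<integral>\<^sup>+y. ennreal (sqrt (1 + (norm (gradient h y))\<^sup>2)) \<partial>lebesgue_on \<omega>) \<le> C"
  shows "(\<integral>\<^sup>+y. slope \<omega> h y \<partial>lborel) \<le> C"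
proof -
  have L: "\<omega> \<inter> space lebesgue \<in> sets lebesgue" using assms(1) by auto
  have "(\<integral>\<^sup>+y. slope \<omega> h y \<partial>lborel) = (\<integral>\<^sup>+y. slope \<omega> h y \<partial>lebesgue)"
    by (rule nn_integral_completion[symmetric])
  also have "\<dots> \<le> (\<integral>\<^sup>+y. ennreal (sqrt (1 + (norm (gradient h y))\<^sup>2)) * indicator \<omega> y \<partial>lebesgue)"
  proof (rule nn_integral_mono)
    fix y
    have "norm (gradient h y) \<le> sqrt (1 + (norm (gradient h y))\<^sup>2)" by (rule real_le_rsqrt) simp
    then have "ennreal (norm (gradient h y)) \<le> ennreal (sqrt (1 + (norm (gradient h y))\<^sup>2))" by (rule ennreal_leI)
    then show "slope \<omega> h y \<le> ennreal (sqrt (1 + (norm (gradient h y))\<^sup>2)) * indicator \<omega> y"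
      by (simp add: slope_def indicator_def)
  qed
  also have "\<dots> \<le> C" using assms(3) by (simp add: nn_integral_restrict_space[OF L])
  finally show ?thesis .
qed

lemma Lp_small_superlevel:
  fixes g :: "'a::euclidean_space \<Rightarrow> 'b::euclidean_space"
  assumes g: "g \<in> Lp_on p A" "1 < p" and A: "A \<in> lmeasurable" "A \<in> sets borel" and e: "0 < e"
  shows "\<exists>R. small e {x \<in> A. R < norm (g x)}"
proof -
  have AL: "A \<inter> space lebesgue \<in> sets lebesgue" using A(1) by auto
  have "g \<in> borel_measurable (lebesgue_on A)" using g(1) by (simp add: Lp_on_def)
  from borel_representative[OF this A(2)] obtain k where k: "k \<in> borel_measurable borel" "AE x in lborel. x \<in> A \<longrightarrow> k x = g x" "\<And>x. x \<notin> A \<Longrightarrow> k x = 0"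
    by blast
  have "(\<integral>\<^sup>+x. ennreal (norm (k x)) \<partial>lborel) = (\<integral>\<^sup>+x. ennreal (norm (k x)) \<partial>lebesgue)"
    by (rule nn_integral_completion[symmetric])
  also have "\<dots> = (\<integral>\<^sup>+x. ennreal (norm (g x)) * indicator A x \<partial>lebesgue)"
    using AE_completion[OF k(2)] by (intro nn_integral_cong_AE) (auto elim!: eventually_mono simp: indicator_def k(3))
  also have "\<dots> < \<infinity>"
    using Lp_norm_integral_finite[OF g A(1)] by (simp add: nn_integral_restrict_space[OF AL])
  finally have f: "(\<integral>\<^sup>+x. ennreal (norm (k x)) \<partial>lborel) < \<infinity>" .
  define J where "J = enn2real (\<integral>\<^sup>+x. ennreal (norm (k x)) \<partial>lborel)"
  have J: "(\<integral>\<^sup>+x. ennreal (norm (k x)) \<partial>lborel) \<le> ennreal J" "0 \<le> J"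
    using f by (auto simp: J_def)
  define R where "R = (J + 1) / e"
  have R: "0 < R" using J(2) e by (simp add: R_def)
  have mk: "(\<lambda>x. ennreal (norm (k x))) \<in> borel_measurable borel"
    using k(1) by simp
  have "J \<le> e * R" using e by (simp add: R_def)
  then have "J / R \<le> e" using R by (simp add: divide_le_eq)
  from small_mono[OF small_markov[OF mk J(1) R J(2)] order_refl this]
  have s: "small e {x. ennreal R \<le> ennreal (norm (k x))}" .
  have "small e {x \<in> A. R < norm (g x)}"
  proof (rule small_mono[OF small_AE_cong[OF k(2) s] _ order_refl], rule subsetI)
    fix x assume "x \<in> {x \<in> A. R < norm (g x)}"
    then show "x \<in> {x. \<not> (x \<in> A \<longrightarrow> k x = g x) \<or> x \<in> {x. ennreal R \<le> ennreal (norm (k x))}}"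
      by (auto intro!: ennreal_leI)
  qed
  then show ?thesis by blast
qed

text \<open>Above the base the growth condition bounds \<open>|e|\<^sup>p\<close> by the elastic energy. The base carries
no elastic energy, but there the gradient is the one of \<open>u0\<close> by \<open>weak_gradient_unique\<close>. The plane between the
two parts is a null set.\<close>

lemma symmetric_gradient_L1_bound:
  fixes \<omega> :: "(real^'n::finite) set" and D :: "real^('n option) \<Rightarrow> real^('n option)^('n option)"
  assumes \<omega>: "open \<omega>" "bounded \<omega>" and M: "0 < M" and p: "1 < p" and c1: "0 < c1"
    and f: "\<And>\<zeta>. c1 * norm (transpose \<zeta> + \<zeta>) powr p \<le> f \<zeta>"
    and h: "h \<in> C1_range_on \<omega> M" and wg: "has_weak_gradient u D (subgraph \<omega> h)"
    and u0: "has_weak_gradient u0 D0 (cylinder \<omega> (-1) 0)"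
    and base: "AE x in lborel. x \<in> cylinder \<omega> (-1) 0 \<longrightarrow> u x = u0 x"
    and J: "(\<integral>\<^sup>+x. ennreal (norm (D0 x)) \<partial>lebesgue_on (cylinder \<omega> (-1) 0)) \<le> ennreal J" "0 \<le> J"
    and C: "(\<integral>\<^sup>+x. ennreal (f (sym_part (D x))) \<partial>lebesgue_on (subgraph_pos \<omega> h)) \<le> ennreal C" "0 \<le> C"
  shows "(\<integral>\<^sup>+x. ennreal (norm (sym_part (D x))) \<partial>lebesgue_on (subgraph \<omega> h))
     \<le> ennreal (measure lebesgue (cylinder \<omega> (-1) M :: (real^('n option)) set) + C / c1 + J)"
proof -
  let ?U = "subgraph \<omega> h :: (real^('n option)) set"
  let ?P = "subgraph_pos \<omega> h :: (real^('n option)) set"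
  let ?Z = "cylinder \<omega> (-1) 0 :: (real^('n option)) set"
  have U: "open ?U" by (rule open_subgraph[OF \<omega>(1) h])
  have Z: "open ?Z" by (rule open_cylinder[OF \<omega>(1)])
  have hr: "0 \<le> h y \<and> h y \<le> M" if "y \<in> \<omega>" for y using h that by (auto simp: C1_range_on_def)
  have ZU: "?Z \<subseteq> ?U" using hr by (force simp: cylinder_def subgraph_def)
  have Peq: "?P = ?U \<inter> (height -` {0<..} \<inter> space borel)" by (auto simp: subgraph_def subgraph_pos_def)
  have Pb: "?P \<in> sets borel" unfolding Peq using U by (intro sets.Int measurable_sets[OF measurable_height]) auto
  have PC: "?P \<subseteq> cylinder \<omega> (-1) M" using hr by (force simp: cylinder_def subgraph_pos_def)
  have mD: "D \<in> borel_measurable (lebesgue_on ?U)"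
    using wg U by (auto simp: has_weak_gradient_def intro: locally_integrable_measurable)
  obtain D' where D': "D' \<in> borel_measurable borel" "AE x in lborel. x \<in> ?U \<longrightarrow> D' x = D x"
    using borel_representative[OF mD borel_open[OF U]] by blast
  define e where "e x = norm (sym_part (D' x))" for x
  have me: "e \<in> borel_measurable borel"
  proof -
    have "continuous_on UNIV (\<lambda>A::real^('n option)^('n option). norm (sym_part A))"
      unfolding transpose_def by (intro continuous_intros)
    from measurable_compose[OF D'(1) borel_measurable_continuous_onI[OF this]] show ?thesis by (simp add: e_def[abs_def])
  qed
  have L: "A \<in> sets borel \<Longrightarrow> A \<inter> space lebesgue \<in> sets lebesgue" for A :: "(real^('n option)) set" by auto
  have Ub: "?U \<in> sets borel" "?Z \<in> sets borel" using U Z by auto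
  have "(\<integral>\<^sup>+x. ennreal (norm (sym_part (D x))) \<partial>lebesgue_on ?U)
      = (\<integral>\<^sup>+x. ennreal (norm (sym_part (D x))) * indicator ?U x \<partial>lebesgue)"
    by (rule nn_integral_restrict_space[OF L[OF Ub(1)]])
  also have "\<dots> = (\<integral>\<^sup>+x. ennreal (e x) * indicator ?U x \<partial>lebesgue)"
    using AE_completion[OF D'(2)] by (intro nn_integral_cong_AE) (auto elim!: eventually_mono simp: e_def indicator_def)
  also have "\<dots> = (\<integral>\<^sup>+x. ennreal (e x) * indicator ?U x \<partial>lborel)"
    by (rule nn_integral_completion)
  also have "\<dots> \<le> (\<integral>\<^sup>+x. (indicator ?P x + ennreal (e x powr p) * indicator ?P x) + ennreal (e x) * indicator ?Z x \<partial>lborel)"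
  proof (rule nn_integral_mono_AE)
    show "AE x in lborel. ennreal (e x) * indicator ?U x \<le> (indicator ?P x + ennreal (e x powr p) * indicator ?P x) + ennreal (e x) * indicator ?Z x"
      using AE_height_nonzero
    proof eventually_elim
      case (elim x)
      have "x \<in> ?U \<Longrightarrow> x \<in> ?P \<or> x \<in> ?Z" using elim by (auto simp: subgraph_def subgraph_pos_def cylinder_def)
      moreover have "ennreal (e x) \<le> 1 + ennreal (e x powr p)"
      proof -
        have "e x \<le> 1 + e x powr p" by (rule le_one_add_powr) (use p in \<open>auto simp: e_def\<close>)
        then have "ennreal (e x) \<le> ennreal (1 + e x powr p)" by (rule ennreal_leI)
        then show ?thesis by simp
      qed
      ultimately show ?case by (auto simp: indicator_def add_increasing add_increasing2)
    qed
  qed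
  also have "\<dots> = (emeasure lborel ?P + (\<integral>\<^sup>+x. ennreal (e x powr p) * indicator ?P x \<partial>lborel)) + (\<integral>\<^sup>+x. ennreal (e x) * indicator ?Z x \<partial>lborel)"
    using me Pb Ub by (simp add: nn_integral_add)
  also have "\<dots> \<le> (ennreal (measure lebesgue (cylinder \<omega> (-1) M :: (real^('n option)) set)) + ennreal (C / c1)) + ennreal J"
  proof (intro add_mono)
    have cb: "cylinder \<omega> (-1) M \<in> sets borel" using \<omega>(1) by (intro cylinder_borel) auto
    have "emeasure lborel ?P \<le> emeasure lborel (cylinder \<omega> (-1) M)" using PC cb by (intro emeasure_mono) auto
    also have "\<dots> = emeasure lebesgue (cylinder \<omega> (-1) M)" using cb by simp
    also have "\<dots> = ennreal (measure lebesgue (cylinder \<omega> (-1) M))"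
      using cylinder_lmeasurable[OF \<omega>, of "-1" M] M by (intro emeasure_eq_measure2) auto
    finally show "emeasure lborel ?P \<le> ennreal (measure lebesgue (cylinder \<omega> (-1) M :: (real^('n option)) set))" .
    have "ennreal c1 * (\<integral>\<^sup>+x. ennreal (e x powr p) * indicator ?P x \<partial>lborel) = (\<integral>\<^sup>+x. ennreal c1 * (ennreal (e x powr p) * indicator ?P x) \<partial>lborel)"
      using me Pb by (intro nn_integral_cmult[symmetric]) auto
    also have "\<dots> = (\<integral>\<^sup>+x. ennreal c1 * (ennreal (e x powr p) * indicator ?P x) \<partial>lebesgue)"
      by (rule nn_integral_completion[symmetric])
    also have "\<dots> \<le> (\<integral>\<^sup>+x. ennreal (f (sym_part (D x))) * indicator ?P x \<partial>lebesgue)"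
    proof (rule nn_integral_mono_AE)
      show "AE x in lebesgue. ennreal c1 * (ennreal (e x powr p) * indicator ?P x) \<le> ennreal (f (sym_part (D x))) * indicator ?P x"
        using AE_completion[OF D'(2)]
      proof eventually_elim
        case (elim x)
        show ?case
        proof (cases "x \<in> ?P")
          case True
          then have "x \<in> ?U" by (auto simp: subgraph_def subgraph_pos_def)
          then have Deq: "D' x = D x" using elim by simp
          let ?e = "sym_part (D x)"
          have sym: "transpose ?e = ?e" by (simp add: vec_eq_iff transpose_def add.commute)
          have "norm ?e \<le> norm (transpose ?e + ?e)" unfolding sym using norm_ge_zero[of ?e] by (simp flip: scaleR_2)
          then have "norm ?e powr p \<le> norm (transpose ?e + ?e) powr p" using p by (intro powr_mono2) auto
          then have "c1 * norm ?e powr p \<le> c1 * norm (transpose ?e + ?e) powr p" using c1 by (intro mult_left_mono) auto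
          also have "\<dots> \<le> f ?e" by (rule f)
          finally have "ennreal (c1 * norm ?e powr p) \<le> ennreal (f ?e)" by (rule ennreal_leI)
          moreover have "ennreal (c1 * norm ?e powr p) = ennreal c1 * ennreal (e x powr p)"
            unfolding e_def Deq using c1 by (intro ennreal_mult) auto
          ultimately show ?thesis using True by simp
        qed simp
      qed
    qed
    also have "\<dots> = (\<integral>\<^sup>+x. ennreal (f (sym_part (D x))) \<partial>lebesgue_on ?P)"
      by (rule nn_integral_restrict_space[OF L[OF Pb], symmetric])
    also have "\<dots> \<le> ennreal C" by (rule C)
    finally have "ennreal (1/c1) * (ennreal c1 * (\<integral>\<^sup>+x. ennreal (e x powr p) * indicator ?P x \<partial>lborel)) \<le> ennreal (1/c1) * ennreal C"
      by (intro mult_left_mono) auto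
    moreover have "ennreal (1/c1) * (ennreal c1 * X) = X" for X
      using c1 by (simp flip: mult.assoc ennreal_mult)
    moreover have "ennreal (1/c1) * ennreal C = ennreal (C / c1)" using c1 C(2) by (simp flip: ennreal_mult)
    ultimately show "(\<integral>\<^sup>+x. ennreal (e x powr p) * indicator ?P x \<partial>lborel) \<le> ennreal (C / c1)" by simp
    have un: "AE x in lborel. x \<in> ?Z \<longrightarrow> D0 x = D x"
    proof (rule weak_gradient_unique[OF u0 wg Z U ZU])
      show "AE x in lborel. x \<in> ?Z \<longrightarrow> u0 x = u x" using base by eventually_elim auto
    qed
    have "(\<integral>\<^sup>+x. ennreal (e x) * indicator ?Z x \<partial>lborel) = (\<integral>\<^sup>+x. ennreal (e x) * indicator ?Z x \<partial>lebesgue)"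
      by (rule nn_integral_completion[symmetric])
    also have "\<dots> \<le> (\<integral>\<^sup>+x. ennreal (norm (D0 x)) * indicator ?Z x \<partial>lebesgue)"
    proof (rule nn_integral_mono_AE)
      show "AE x in lebesgue. ennreal (e x) * indicator ?Z x \<le> ennreal (norm (D0 x)) * indicator ?Z x"
        using AE_completion[OF D'(2)] AE_completion[OF un]
      proof eventually_elim
        case (elim x)
        show ?case
        proof (cases "x \<in> ?Z")
          case True
          then have "D' x = D0 x" using elim ZU by auto
          then have "e x \<le> norm (D0 x)" unfolding e_def using norm_symmetric_part_le[of "D0 x"] by simp
          then show ?thesis using True by (simp add: ennreal_leI)
        qed simp
      qed
    qed
    also have "\<dots> = (\<integral>\<^sup>+x. ennreal (norm (D0 x)) \<partial>lebesgue_on ?Z)"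
      by (rule nn_integral_restrict_space[OF L[OF Ub(2)], symmetric])
    also have "\<dots> \<le> ennreal J" by (rule J)
    finally show "(\<integral>\<^sup>+x. ennreal (e x) * indicator ?Z x \<partial>lborel) \<le> ennreal J" .
  qed
  also have "\<dots> = ennreal (measure lebesgue (cylinder \<omega> (-1) M :: (real^('n option)) set) + C / c1 + J)"
    using c1 C(2) J(2) by (simp flip: ennreal_plus)
  finally show ?thesis .
qed

section \<open>Compactness in measure\<close>

text \<open>A Lipschitz homeomorphism onto the open unit ball. It makes functions bounded, as \<open>Kolmogorov_subsequence\<close>
requires, and its inverse \<open>w \<mapsto> w/(1 - |w|)\<close> is continuous.\<close>

definition compress :: "'b::real_normed_vector \<Rightarrow> 'b" where
  "compress v = (1 / (1 + norm v)) *\<^sub>R v"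

lemma norm_compress: "norm (compress v) = norm v / (1 + norm v)"
  by (simp add: compress_def)

lemma norm_compress_less: "norm (compress v) < 1"
proof -
  have "0 < 1 + norm v" by (simp add: add_pos_nonneg)
  then show ?thesis by (simp add: norm_compress)
qed

lemma compress_inverse: "(1 / (1 - norm (compress v))) *\<^sub>R compress v = v"
proof -
  have "1 - norm (compress v) = 1 / (1 + norm v)"
    unfolding norm_compress using norm_ge_zero[of v] by (simp add: field_simps add_nonneg_eq_0_iff)
  moreover have "1 + norm v \<noteq> 0" using norm_ge_zero[of v] by linarith
  ultimately show ?thesis by (simp add: compress_def)
qed

lemma compress_lipschitz: "norm (compress a - compress b) \<le> 2 * norm (a - b)"
proof -
  let ?A = "1 + norm a" and ?B = "1 + norm b"
  have p: "1 \<le> ?A" "1 \<le> ?B" "0 < ?A" "0 < ?B" by (auto simp: add_pos_nonneg)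
  have "compress a - compress b = (1 / ?A) *\<^sub>R (a - b) + ((norm b - norm a) / (?A * ?B)) *\<^sub>R b"
  proof -
    have "1 / ?A - 1 / ?B = (norm b - norm a) / (?A * ?B)" using p by (simp add: field_simps)
    then have "((norm b - norm a) / (?A * ?B)) *\<^sub>R b = (1 / ?A) *\<^sub>R b - (1 / ?B) *\<^sub>R b"
      by (metis scaleR_diff_left)
    then show ?thesis by (simp add: compress_def scaleR_diff_right)
  qed
  then have "norm (compress a - compress b) \<le> norm ((1 / ?A) *\<^sub>R (a - b)) + norm (((norm b - norm a) / (?A * ?B)) *\<^sub>R b)"
    by (metis norm_triangle_ineq)
  also have "norm ((1 / ?A) *\<^sub>R (a - b)) \<le> 1 * norm (a - b)"
    unfolding norm_scaleR using p by (intro mult_right_mono) auto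
  also have "norm (((norm b - norm a) / (?A * ?B)) *\<^sub>R b) \<le> norm (a - b)"
  proof -
    have "norm (((norm b - norm a) / (?A * ?B)) *\<^sub>R b) = \<bar>norm b - norm a\<bar> * (norm b / (?A * ?B))"
      using p by (simp add: abs_mult)
    also have "\<dots> \<le> norm (a - b) * 1"
    proof (rule mult_mono)
      show "\<bar>norm b - norm a\<bar> \<le> norm (a - b)" using norm_triangle_ineq3[of a b] by linarith
      have "norm b \<le> 1 * ?B" by simp
      also have "\<dots> \<le> ?A * ?B" using p by (intro mult_right_mono) auto
      finally show "norm b / (?A * ?B) \<le> 1" using p by (simp add: divide_le_eq)
    qed (use p in auto)
    finally show ?thesis by simp
  qed
  finally show ?thesis by simp
qed

lemma continuous_on_compress: "continuous_on UNIV compress"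
  unfolding compress_def by (intro continuous_intros) (auto simp: add_nonneg_eq_0_iff)

text \<open>After compression, closeness in measure becomes closeness in mean. Tightness is used a second time
to see that the limit of the compressed functions almost nowhere reaches the unit sphere, where the inverse
compression breaks down.\<close>

lemma measure_compactness:
  fixes v :: "nat \<Rightarrow> 'a::euclidean_space \<Rightarrow> 'b::euclidean_space"
  assumes meas: "\<And>n. v n \<in> borel_measurable borel"
    and Q: "bounded Q" "\<And>n x. x \<notin> Q \<Longrightarrow> v n x = 0"
    and tight: "\<And>\<eta>. 0 < \<eta> \<Longrightarrow> \<exists>R. \<forall>n. small \<eta> {x. R < norm (v n x)}"
    and trans: "\<And>\<eta> \<delta>. 0 < \<eta> \<Longrightarrow> 0 < \<delta> \<Longrightarrow> \<exists>\<rho>>0. \<forall>n y. norm y < \<rho> \<longrightarrow> small \<eta> {x. \<delta> < norm (v n (x + y) - v n x)}"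
  obtains r u where "strict_mono (r :: nat \<Rightarrow> nat)" "u \<in> borel_measurable borel" "AE x in lborel. (\<lambda>i. v (r i) x) \<longlonglongrightarrow> u x"
proof -
  define w where "w n x = compress (v n x)" for n x
  have mw: "w n \<in> borel_measurable borel" for n
    unfolding w_def[abs_def] by (rule measurable_compose[OF meas borel_measurable_continuous_onI[OF continuous_on_compress]])
  have wlt: "norm (w n x) < 1" for n x by (simp add: w_def norm_compress_less)
  have w0: "w n x = 0" if "x \<notin> Q" for n x using Q(2)[OF that] by (simp add: w_def compress_def)
  obtain R0 where R0: "Q \<subseteq> ball 0 R0" using Q(1) bounded_subset_ballD by blast
  let ?B = "ball (0::'a) (R0 + 1)"
  have fB: "emeasure lborel ?B < \<infinity>" by (rule emeasure_lborel_ball_finite)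
  define b where "b = measure lborel ?B"
  have b: "emeasure lborel ?B = ennreal b" "0 \<le> b"
    using fB by (auto simp: b_def emeasure_eq_ennreal_measure)
  have tr: "\<exists>\<rho>>0. \<forall>n y. norm y < \<rho> \<longrightarrow> (\<integral>\<^sup>+x. norm (w n (x + y) - w n x) \<partial>lborel) \<le> ennreal \<eta>" if \<eta>: "0 < \<eta>" for \<eta>
  proof -
    define \<delta> where "\<delta> = \<eta> / (4 * (b + 1))"
    have \<delta>: "0 < \<delta>" using \<eta> b by (simp add: \<delta>_def)
    obtain \<rho> where \<rho>: "0 < \<rho>" "\<And>n y. norm y < \<rho> \<Longrightarrow> small (\<eta>/4) {x. \<delta> < norm (v n (x + y) - v n x)}"
      using trans[of "\<eta>/4" \<delta>] \<eta> \<delta> by auto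
    have "(\<integral>\<^sup>+x. norm (w n (x + y) - w n x) \<partial>lborel) \<le> ennreal \<eta>" if y: "norm y < min \<rho> 1" for n y
    proof -
      obtain S where S: "S \<in> sets lebesgue" "{x. \<delta> < norm (v n (x + y) - v n x)} \<subseteq> S" "emeasure lebesgue S \<le> ennreal (\<eta>/4)"
        using \<rho>(2)[of y n] y unfolding small_def by auto
      have "(\<integral>\<^sup>+x. norm (w n (x + y) - w n x) \<partial>lborel) = (\<integral>\<^sup>+x. norm (w n (x + y) - w n x) \<partial>lebesgue)"
        by (rule nn_integral_completion[symmetric])
      also have "\<dots> \<le> (\<integral>\<^sup>+x. ennreal (2 * \<delta>) * indicator ?B x + 2 * indicator S x \<partial>lebesgue)"
      proof (rule nn_integral_mono)
        fix x
        show "ennreal (norm (w n (x + y) - w n x)) \<le> ennreal (2 * \<delta>) * indicator ?B x + 2 * indicator S x"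
        proof (cases "x \<in> S")
          case True
          have "norm (w n (x + y) - w n x) \<le> 2" using norm_triangle_ineq4[of "w n (x + y)" "w n x"] wlt[of n x] wlt[of n "x + y"] by linarith
          then have "ennreal (norm (w n (x + y) - w n x)) \<le> ennreal 2" by (rule ennreal_leI)
          then show ?thesis using True by (simp add: add_increasing)
        next
          case xS: False
          show ?thesis
          proof (cases "x \<in> ?B")
            case True
            have "norm (w n (x + y) - w n x) \<le> 2 * norm (v n (x + y) - v n x)"
              unfolding w_def by (rule compress_lipschitz)
            moreover have "\<not> \<delta> < norm (v n (x + y) - v n x)" using xS S(2) by blast
            ultimately have "norm (w n (x + y) - w n x) \<le> 2 * \<delta>" by linarith
            then show ?thesis using True by (simp add: add_increasing2 ennreal_leI)
          next
            case False
            then have "R0 + 1 \<le> norm x" by simp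
            moreover have "norm x \<le> norm (x + y) + norm y" using norm_triangle_ineq4[of "x + y" y] by simp
            ultimately have "x \<notin> ball 0 R0" "x + y \<notin> ball 0 R0" using y by auto
            then have "w n x = 0" "w n (x + y) = 0" using R0 by (auto intro: w0)
            then show ?thesis by simp
          qed
        qed
      qed
      also have "\<dots> = ennreal (2 * \<delta>) * emeasure lborel ?B + 2 * emeasure lebesgue S"
      proof -
        have B: "?B \<in> sets lebesgue" by (rule fmeasurableD[OF lmeasurable_ball])
        have "(\<lambda>x. ennreal (2 * \<delta>) * indicator ?B x) \<in> borel_measurable lebesgue" "(\<lambda>x. 2 * indicator S x :: ennreal) \<in> borel_measurable lebesgue"
          using B S(1) by (auto intro!: borel_measurable_times_ennreal borel_measurable_indicator)
        from nn_integral_add[OF this] show ?thesis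
          using B S(1) by (simp add: nn_integral_cmult_indicator)
      qed
      also have "\<dots> \<le> ennreal (2 * \<delta>) * ennreal b + 2 * ennreal (\<eta>/4)"
        unfolding b(1) by (intro add_left_mono mult_left_mono S) auto
      also have "\<dots> = ennreal (2 * \<delta> * b + \<eta>/2)"
      proof -
        have "2 * ennreal (\<eta>/4) = ennreal (2 * (\<eta>/4))" using \<eta> by (subst ennreal_mult) auto
        moreover have "ennreal (2 * \<delta>) * ennreal b = ennreal (2 * \<delta> * b)" using \<delta> b(2) by (intro ennreal_mult[symmetric]) auto
        ultimately show ?thesis using \<eta> \<delta> b(2) by (simp flip: ennreal_plus)
      qed
      also have "\<dots> \<le> ennreal \<eta>"
      proof (rule ennreal_leI)
        have "\<delta> * (4 * (b + 1)) = \<eta>" using b(2) by (simp add: \<delta>_def)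
        then have "4 * (\<delta> * b) + 4 * \<delta> = \<eta>" by (simp add: algebra_simps)
        then show "2 * \<delta> * b + \<eta>/2 \<le> \<eta>" using \<delta> by (simp add: algebra_simps)
      qed
      finally show ?thesis .
    qed
    then show ?thesis using \<rho>(1) by (intro exI[of _ "min \<rho> 1"]) auto
  qed
  obtain r where r: "strict_mono r" "AE x in lborel. convergent (\<lambda>i. w (r i) x)"
    using Kolmogorov_subsequence[OF mw less_imp_le[OF wlt] Q(1) w0 tr] by blast
  define W where "W x = lim (\<lambda>i. w (r i) x)" for x
  have mW: "W \<in> borel_measurable borel"
    unfolding W_def[abs_def] using mw by (intro borel_measurable_lim_metric)
  have "AE x in lborel. \<not> (convergent (\<lambda>i. w (r i) x) \<and> 1 \<le> norm (W x))"
  proof (rule AE_of_small_complement)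
    fix e :: real assume "0 < e"
    then obtain R where R: "\<And>n. small e {x. R < norm (v n x)}" using tight by blast
    have "small e {x. \<forall>\<^sub>F i in sequentially. x \<in> {x. R < norm (v (r i) x)}}"
      by (rule small_liminf[OF R])
    then show "small e {x. \<not> \<not> (convergent (\<lambda>i. w (r i) x) \<and> 1 \<le> norm (W x))}"
    proof (rule small_mono)
      show "{x. \<not> \<not> (convergent (\<lambda>i. w (r i) x) \<and> 1 \<le> norm (W x))} \<subseteq> {x. \<forall>\<^sub>F i in sequentially. x \<in> {x. R < norm (v (r i) x)}}"
      proof (rule subsetI)
        fix x assume "x \<in> {x. \<not> \<not> (convergent (\<lambda>i. w (r i) x) \<and> 1 \<le> norm (W x))}"
        then have c: "convergent (\<lambda>i. w (r i) x)" and n: "1 \<le> norm (W x)" by simp_all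
        have "(\<lambda>i. norm (w (r i) x)) \<longlonglongrightarrow> norm (W x)"
          using c unfolding W_def by (intro tendsto_norm) (simp add: convergent_LIMSEQ_iff)
        \<comment> \<open>The left-hand side is the norm of a compressed vector of norm \<open>\<bar>R\<bar>\<close>.\<close>
        moreover have "\<bar>R\<bar> / (1 + \<bar>R\<bar>) < norm (W x)" using n by (rule less_le_trans[rotated]) (simp add: divide_less_eq)
        ultimately have "\<forall>\<^sub>F i in sequentially. \<bar>R\<bar> / (1 + \<bar>R\<bar>) < norm (w (r i) x)" by (rule order_tendstoD)
        then have "\<forall>\<^sub>F i in sequentially. R < norm (v (r i) x)"
        proof eventually_elim
          case (elim i)
          have "\<bar>R\<bar> / (1 + \<bar>R\<bar>) < norm (v (r i) x) / (1 + norm (v (r i) x))" using elim by (simp add: w_def norm_compress)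
          moreover have "t / (1 + t) = 1 - 1 / (1 + t)" if "0 \<le> t" for t :: real
            using that by (simp add: field_simps add_nonneg_eq_0_iff)
          ultimately have "1 / (1 + norm (v (r i) x)) < 1 / (1 + \<bar>R\<bar>)" by simp
          moreover have "1 / (1 + \<bar>R\<bar>) \<le> 1 / (1 + norm (v (r i) x))" if "norm (v (r i) x) \<le> \<bar>R\<bar>"
            using that by (intro divide_left_mono mult_pos_pos) (auto simp: add_pos_nonneg)
          ultimately show ?case by linarith
        qed
        then show "x \<in> {x. \<forall>\<^sub>F i in sequentially. x \<in> {x. R < norm (v (r i) x)}}" by simp
      qed
    qed simp
  qed
  with r(2) have "AE x in lborel. (\<lambda>i. v (r i) x) \<longlonglongrightarrow> (1 / (1 - norm (W x))) *\<^sub>R W x"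
  proof eventually_elim
    case (elim x)
    then have "(\<lambda>i. w (r i) x) \<longlonglongrightarrow> W x" unfolding W_def by (simp add: convergent_LIMSEQ_iff)
    then have "(\<lambda>i. (1 / (1 - norm (w (r i) x))) *\<^sub>R w (r i) x) \<longlonglongrightarrow> (1 / (1 - norm (W x))) *\<^sub>R W x"
      using elim by (intro tendsto_intros) auto
    then show ?case by (simp add: w_def compress_inverse)
  qed
  moreover have "(\<lambda>x. (1 / (1 - norm (W x))) *\<^sub>R W x) \<in> borel_measurable borel"
    using mW by (intro borel_measurable_scaleR borel_measurable_divide borel_measurable_diff borel_measurable_const
        measurable_compose[OF _ borel_measurable_norm])
  ultimately show ?thesis using that r(1) by blast
qed

lemma AE_convergent_imp_tends_in_measure:
  fixes us vs :: "nat \<Rightarrow> 'a::euclidean_space \<Rightarrow> 'b::euclidean_space"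
  assumes A: "A \<in> sets borel" "emeasure lborel A < \<infinity>"
    and m: "\<And>n. vs n \<in> borel_measurable borel" "u \<in> borel_measurable borel"
    and eq: "\<And>n. AE x in lborel. x \<in> A \<longrightarrow> us n x = vs n x"
    and lim: "AE x in lborel. (\<lambda>n. vs n x) \<longlonglongrightarrow> u x"
  shows "tends_in_measure_on A us u"
  unfolding tends_in_measure_on_def
proof (intro allI impI)
  fix \<epsilon> :: real assume \<epsilon>: "0 < \<epsilon>"
  let ?E = "\<lambda>n. {x \<in> A. \<epsilon> \<le> norm (vs n x - u x)}"
  have E: "?E n \<in> sets borel" for n
  proof -
    have "{x \<in> space borel. \<epsilon> \<le> norm (vs n x - u x)} \<in> sets borel"
      by (rule borel_measurable_le[OF borel_measurable_const measurable_compose[OF borel_measurable_diff[OF m(1) m(2)] borel_measurable_norm]])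
    then have "A \<inter> {x \<in> space borel. \<epsilon> \<le> norm (vs n x - u x)} \<in> sets borel" using A(1) by (rule sets.Int[rotated])
    moreover have "A \<inter> {x \<in> space borel. \<epsilon> \<le> norm (vs n x - u x)} = ?E n" by auto
    ultimately show ?thesis by simp
  qed
  have "emeasure lebesgue {x \<in> A. \<epsilon> \<le> norm (us n x - u x)} = emeasure lborel (?E n)" for n
  proof -
    have ae: "AE x in lebesgue. x \<in> ?E n \<longleftrightarrow> x \<in> {x \<in> A. \<epsilon> \<le> norm (us n x - u x)}"
      using AE_completion[OF eq[of n]] by eventually_elim auto
    have "{x \<in> A. \<epsilon> \<le> norm (us n x - u x)} \<in> sets lebesgue"
      by (rule completion.in_sets_AE[OF ae]) (use E in auto)
    then have "emeasure lebesgue {x \<in> A. \<epsilon> \<le> norm (us n x - u x)} = emeasure lebesgue (?E n)"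
      using ae E by (intro emeasure_eq_AE) (auto elim!: eventually_mono)
    then show ?thesis using E[of n] by simp
  qed
  moreover have "(\<lambda>n. emeasure lborel (?E n)) \<longlonglongrightarrow> 0"
  proof -
    have "(\<lambda>n. \<integral>\<^sup>+x. indicator (?E n) x \<partial>lborel) \<longlonglongrightarrow> (\<integral>\<^sup>+x. 0 \<partial>(lborel :: 'a measure))"
    proof (rule nn_integral_dominated_convergence[where w = "indicator A"])
      show "AE x in lborel. indicator (?E j) x \<le> (indicator A x :: ennreal)" for j
        by (auto simp: indicator_def)
      show "(\<integral>\<^sup>+x. indicator A x \<partial>lborel) < \<infinity>" using A by simp
      show "AE x in lborel. (\<lambda>n. indicator (?E n) x :: ennreal) \<longlonglongrightarrow> 0"
        using lim
      proof eventually_elim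
        case (elim x)
        from tendsto_diff[OF elim tendsto_const[of "u x"]] have "(\<lambda>n. norm (vs n x - u x)) \<longlonglongrightarrow> 0"
          by (simp add: tendsto_norm_zero)
        then have "\<forall>\<^sub>F n in sequentially. norm (vs n x - u x) < \<epsilon>" using \<epsilon> by (rule order_tendstoD)
        then have "\<forall>\<^sub>F n in sequentially. indicator (?E n) x = (0 :: ennreal)" by eventually_elim auto
        then show ?case by (rule tendsto_eventually)
      qed
    qed (use A E in auto)
    then show ?thesis using E by simp
  qed
  ultimately show "(\<lambda>n. emeasure lebesgue {x \<in> A. \<epsilon> \<le> norm (us n x - u x)}) \<longlonglongrightarrow> 0" by simp
qed

section \<open>Compactness of sequences of bounded energy\<close>

text \<open>The limit is clamped to \<open>[0, M]\<close> so that it satisfies the bounds at every point, including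
those where the subsequence does not converge.\<close>

lemma graph_compactness:
  fixes hs :: "nat \<Rightarrow> real^'n::finite \<Rightarrow> real"
  assumes \<omega>: "open \<omega>" "bounded \<omega>" and I: "0 \<le> I" and M: "0 < M"
    and hs: "\<And>n. hs n \<in> C1_range_on \<omega> M" "\<And>n. (\<integral>\<^sup>+y. slope \<omega> (hs n) y \<partial>lborel) \<le> ennreal I"
  obtains r h where "strict_mono (r :: nat \<Rightarrow> nat)" "h \<in> L1_range_on \<omega> M" "tends_L1_on \<omega> (\<lambda>i. hs (r i)) h"
proof -
  define H where "H n y = indicator \<omega> y * hs n y" for n y
  have mH: "H n \<in> borel_measurable borel" for n
    unfolding H_def[abs_def] by (rule C1_indicator_measurable[OF \<omega>(1) hs(1)])
  have Hb: "0 \<le> H n y" "H n y \<le> M" for n y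
    using hs(1)[of n] M by (auto simp: H_def indicator_def C1_range_on_def)
  have Hn: "norm (H n y) \<le> M" for n y using Hb[of n y] by simp
  have H0: "H n y = 0" if "y \<notin> \<omega>" for n y using that by (simp add: H_def)
  have tr: "\<exists>\<rho>>0. \<forall>n y. norm y < \<rho> \<longrightarrow> (\<integral>\<^sup>+x. norm (H n (x + y) - H n x) \<partial>lborel) \<le> ennreal \<eta>" if \<eta>: "0 < \<eta>" for \<eta>
  proof -
    obtain \<rho> where \<rho>: "0 < \<rho>" "\<And>h z. h \<in> C1_range_on \<omega> M \<Longrightarrow> (\<integral>\<^sup>+y. slope \<omega> h y \<partial>lborel) \<le> ennreal I \<Longrightarrow> norm z < \<rho> \<Longrightarrow>
      (\<integral>\<^sup>+y. norm (indicator \<omega> (y + z) * h (y + z) - indicator \<omega> y * h y) \<partial>lborel) \<le> ennreal \<eta>"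
      using graph_translation_small[OF \<omega> I M \<eta>] by blast
    show ?thesis
      unfolding H_def using \<rho>(1) \<rho>(2)[OF hs] by blast
  qed
  obtain r where r: "strict_mono r" "AE y in lborel. convergent (\<lambda>i. H (r i) y)"
    using Kolmogorov_subsequence[OF mH Hn \<omega>(2) H0 tr] by blast
  define h where "h y = max 0 (min M (lim (\<lambda>i. H (r i) y)))" for y
  have mh: "h \<in> borel_measurable borel"
    unfolding h_def[abs_def] using mH by (intro borel_measurable_max borel_measurable_min borel_measurable_const borel_measurable_lim_metric)
  have hb: "0 \<le> h y" "h y \<le> M" for y using M by (auto simp: h_def)
  have ae: "AE y in lborel. (\<lambda>i. H (r i) y) \<longlonglongrightarrow> h y"
    using r(2)
  proof eventually_elim
    case (elim y)
    then have l: "(\<lambda>i. H (r i) y) \<longlonglongrightarrow> lim (\<lambda>i. H (r i) y)" by (simp add: convergent_LIMSEQ_iff)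
    have "0 \<le> lim (\<lambda>i. H (r i) y)" by (rule LIMSEQ_le_const[OF l]) (use Hb in auto)
    moreover have "lim (\<lambda>i. H (r i) y) \<le> M" by (rule LIMSEQ_le_const2[OF l]) (use Hb in auto)
    ultimately show ?case using l by (simp add: h_def)
  qed
  have \<omega>b: "\<omega> \<in> sets borel" using \<omega>(1) by simp
  have fin: "finite_measure (lebesgue_on \<omega>)"
  proof (rule finite_measureI)
    have "\<omega> \<in> lmeasurable" using \<omega> by (simp add: lmeasurable_open)
    then show "emeasure (lebesgue_on \<omega>) (space (lebesgue_on \<omega>)) \<noteq> \<infinity>"
      using fmeasurableD2[of \<omega> lebesgue] \<omega>b by (simp add: emeasure_restrict_space)
  qed
  have bl: "g \<in> borel_measurable borel \<Longrightarrow> g \<in> borel_measurable (lebesgue_on \<omega>)" for g :: "real^'n \<Rightarrow> real"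
  proof -
    assume "g \<in> borel_measurable borel"
    then have "g \<in> borel_measurable lborel" by simp
    then have "g \<in> borel_measurable lebesgue" by (rule measurable_completion)
    then show ?thesis by (rule measurable_restrict_space1)
  qed
  have "h \<in> L1_range_on \<omega> M"
    unfolding L1_range_on_def using hb mh
    by (auto intro!: finite_measure.integrable_const_bound[OF fin, where B = M] bl)
  moreover have "tends_L1_on \<omega> (\<lambda>i. hs (r i)) h"
    unfolding tends_L1_on_def
  proof -
    have "(\<lambda>i. LINT y|lebesgue_on \<omega>. \<bar>H (r i) y - h y\<bar>) \<longlonglongrightarrow> (LINT y|lebesgue_on \<omega>. 0)"
    proof (rule integral_dominated_convergence[where w = "\<lambda>_. M"])
      show "integrable (lebesgue_on \<omega>) (\<lambda>_. M)" by (rule finite_measure.integrable_const[OF fin])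
      show "(\<lambda>y. \<bar>H (r i) y - h y\<bar>) \<in> borel_measurable (lebesgue_on \<omega>)" for i
        using mH mh by (intro bl borel_measurable_abs borel_measurable_diff)
      show "AE y in lebesgue_on \<omega>. norm \<bar>H (r i) y - h y\<bar> \<le> M" for i
      proof (rule AE_I2)
        fix y show "norm \<bar>H (r i) y - h y\<bar> \<le> M" using Hb[of "r i" y] hb[of y] by simp
      qed
      show "AE y in lebesgue_on \<omega>. (\<lambda>i. \<bar>H (r i) y - h y\<bar>) \<longlonglongrightarrow> 0"
        unfolding AE_lebesgue_on_iff[OF \<omega>b] using ae
      proof eventually_elim
        case (elim y)
        from tendsto_diff[OF elim tendsto_const[of "h y"]] show ?case
          by (auto intro: tendsto_rabs_zero)
      qed
    qed simp
    moreover have "(LINT y|lebesgue_on \<omega>. \<bar>H (r i) y - h y\<bar>) = (LINT y|lebesgue_on \<omega>. \<bar>hs (r i) y - h y\<bar>)" for i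
      by (intro Bochner_Integration.integral_cong refl) (auto simp: H_def space_restrict_space)
    ultimately show "(\<lambda>i. LINT y|lebesgue_on \<omega>. \<bar>hs (r i) y - h y\<bar>) \<longlonglongrightarrow> 0" by simp
  qed
  ultimately show ?thesis using that r(1) by blast
qed

text \<open>Each displacement is replaced by a Borel function \<open>v n\<close> that vanishes outside the subgraph; this changes it
only on a null set. Energy bounds feed \<open>difference_along_segment_small\<close> and the exit estimates, and these feed
\<open>subgraph_tightness\<close> and \<open>translation_small\<close>.\<close>

theorem epitaxy_compactness:
  fixes \<omega> :: "(real^'n::finite) set" and us :: "nat \<Rightarrow> 'n field"
  assumes \<omega>: "open \<omega>" "bounded \<omega>" and M: "0 < M" and p: "1 < p" and c1: "0 < c1"
    and u0: "u0 \<in> sobolev p (cylinder \<omega> (-1) 0)"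
    and f: "\<And>\<zeta>. c1 * norm (transpose \<zeta> + \<zeta>) powr p \<le> f \<zeta>"
    and G: "\<And>n. G_functional \<omega> M p f u0 (us n) (hs n) \<le> ennreal C" and C: "0 \<le> C"
  obtains r u h where "strict_mono (r :: nat \<Rightarrow> nat)" "u \<in> L0_on (cylinder \<omega> (-1) (M + 1))" "h \<in> L1_range_on \<omega> M"
    "tends_in_measure_on (cylinder \<omega> (-1) (M + 1)) (\<lambda>i. us (r i)) u" "tends_L1_on \<omega> (\<lambda>i. hs (r i)) h"
proof -
  let ?\<Omega> = "cylinder \<omega> (-1) (M + 1) :: (real^('n option)) set"
  let ?Z = "cylinder \<omega> (-1) 0 :: (real^('n option)) set"
  define U where "U n = (subgraph \<omega> (hs n) :: (real^('n option)) set)" for n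
  define D where "D n = weak_gradient (U n) (us n)" for n
  have fd: "G_finite_dom \<omega> M p u0 (us n) (hs n)" for n
    using G[of n] by (auto simp: G_functional_def top_unique split: if_splits)
  have hC: "hs n \<in> C1_range_on \<omega> M" and uS: "us n \<in> sobolev p (U n)"
    and uz: "AE x in lebesgue_on (?\<Omega> - U n). us n x = 0" and ub: "AE x in lebesgue_on ?Z. us n x = u0 x" for n
    using fd[of n] unfolding G_finite_dom_def U_def by blast+
  have Gsum: "(\<integral>\<^sup>+ x. ennreal (f (sym_gradient (U n) (us n) x)) \<partial>lebesgue_on (subgraph_pos \<omega> (hs n)))
         + (\<integral>\<^sup>+ y. ennreal (sqrt (1 + (norm (gradient (hs n) y))\<^sup>2)) \<partial>lebesgue_on \<omega>) \<le> ennreal C" for n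
    using G[of n] fd[of n] by (simp add: G_functional_def U_def)
  have surf: "(\<integral>\<^sup>+y. slope \<omega> (hs n) y \<partial>lborel) \<le> ennreal C" for n
    by (rule slope_bound[OF \<omega>(1) hC]) (rule order_trans[OF _ Gsum[of n]], simp add: add_increasing)
  have elas: "(\<integral>\<^sup>+x. ennreal (f (sym_part (D n x))) \<partial>lebesgue_on (subgraph_pos \<omega> (hs n))) \<le> ennreal C" for n
  proof -
    have "(\<integral>\<^sup>+ x. ennreal (f (sym_gradient (U n) (us n) x)) \<partial>lebesgue_on (subgraph_pos \<omega> (hs n))) \<le> ennreal C"
      by (rule order_trans[OF _ Gsum[of n]]) (simp add: add_increasing2)
    then show ?thesis by (simp add: sym_gradient_def D_def)
  qed
  have oU: "open (U n)" for n unfolding U_def by (rule open_subgraph[OF \<omega>(1) hC])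
  have wg: "has_weak_gradient (us n) (D n) (U n)" for n
    unfolding D_def by (rule sobolev_weak_gradient[OF uS])
  have \<Omega>b: "?\<Omega> \<in> sets borel" "?Z \<in> sets borel" using \<omega>(1) by (auto intro!: cylinder_borel)
  have Zl: "?Z \<in> lmeasurable" by (rule cylinder_lmeasurable[OF \<omega>]) simp
  have hM: "hs n y \<le> M" "0 \<le> hs n y" if "y \<in> \<omega>" for n y using hC[of n] that by (auto simp: C1_range_on_def)
  have Umem: "horiz x \<in> \<omega>" "- 1 < height x" "height x < M" if "x \<in> U n" for n x
    using that hM(1)[of "horiz x" n] by (auto simp: U_def subgraph_def)
  have U\<Omega>: "U n \<subseteq> ?\<Omega>" for n
    using Umem by (fastforce simp: cylinder_def)
  note Utop = Umem(3)
  have ub': "AE x in lborel. x \<in> ?Z \<longrightarrow> us n x = u0 x" for n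
    using ub[of n] unfolding AE_lebesgue_on_iff[OF \<Omega>b(2)] .
  have "?\<Omega> - U n \<in> sets borel" for n using \<Omega>b(1) oU[of n] by (intro sets.Diff) auto
  then have uz': "AE x in lborel. x \<in> ?\<Omega> - U n \<longrightarrow> us n x = 0" for n
    using uz[of n] by (simp only: AE_lebesgue_on_iff)

  obtain D0 where D0: "D0 \<in> Lp_on p ?Z" "has_weak_gradient u0 D0 ?Z" and u0L: "u0 \<in> Lp_on p ?Z"
    using u0 by (auto simp: sobolev_def)
  define J where "J = enn2real (\<integral>\<^sup>+x. ennreal (norm (D0 x)) \<partial>lebesgue_on ?Z)"
  have J: "(\<integral>\<^sup>+x. ennreal (norm (D0 x)) \<partial>lebesgue_on ?Z) \<le> ennreal J" "0 \<le> J"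
    using Lp_norm_integral_finite[OF D0(1) p Zl] by (auto simp: J_def)
  define E where "E = measure lebesgue (cylinder \<omega> (-1) M :: (real^('n option)) set) + C / c1 + J"
  have E0: "0 \<le> E" using C c1 J(2) by (simp add: E_def)
  have energy: "(\<integral>\<^sup>+x. ennreal (norm (sym_part (D n x))) \<partial>lebesgue_on (U n)) \<le> ennreal E" for n
    unfolding E_def U_def
    by (rule symmetric_gradient_L1_bound[OF \<omega> M p c1 f hC wg[unfolded U_def] D0(2) ub' J elas C])

  have "\<exists>v. v \<in> borel_measurable borel \<and> (AE x in lborel. x \<in> U n \<longrightarrow> v x = us n x) \<and> (\<forall>x. x \<notin> U n \<longrightarrow> v x = 0)" for n
  proof -
    have "us n \<in> borel_measurable (lebesgue_on (U n))" using uS[of n] by (auto simp: sobolev_def Lp_on_def)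
    from borel_representative[OF this borel_open[OF oU]] show ?thesis by blast
  qed
  from choice[OF allI[OF this]] obtain v where v': "\<forall>n. v n \<in> borel_measurable borel \<and> (AE x in lborel. x \<in> U n \<longrightarrow> v n x = us n x) \<and> (\<forall>x. x \<notin> U n \<longrightarrow> v n x = 0)" ..
  then have v: "v n \<in> borel_measurable borel" "AE x in lborel. x \<in> U n \<longrightarrow> v n x = us n x"
    and v0: "x \<notin> U n \<Longrightarrow> v n x = 0" for n x by simp_all
  have v\<Omega>: "AE x in lborel. x \<in> ?\<Omega> \<longrightarrow> us n x = v n x" for n
    using v(2)[of n] uz'[of n] by eventually_elim (use v0 in auto)

  have seg: "small (E * (norm y)\<^sup>2 / \<delta>) (jumps (U n) (v n) \<delta> y)" if "0 < \<delta>" for n y \<delta>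
    by (rule difference_along_segment_small[OF oU wg v(1) v(2) energy E0 that])
  have bad_tilt: "\<exists>\<delta>>0. \<forall>n z. norm (horiz z) \<le> \<delta> \<longrightarrow> height z \<le> \<delta> \<longrightarrow>
        small \<eta> (tilt_exits (U n) z)" if \<eta>: "0 < \<eta>" for \<eta>
  proof -
    obtain \<delta> where \<delta>: "0 < \<delta>" "\<And>h (z :: real^('n option)). h \<in> C1_range_on \<omega> M \<Longrightarrow> (\<integral>\<^sup>+y. slope \<omega> h y \<partial>lborel) \<le> ennreal C \<Longrightarrow> norm (horiz z) \<le> \<delta> \<Longrightarrow> height z \<le> \<delta>
      \<Longrightarrow> small \<eta> (tilt_exits (subgraph \<omega> h) z)"
      using subgraph_exit_uniformly_small[OF \<omega> C M \<eta>] by blast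
    show ?thesis unfolding U_def using \<delta>(1) \<delta>(2)[OF hC surf] by blast
  qed
  have bad_short: "\<exists>\<rho>>0. \<forall>n z. norm z \<le> \<rho> \<longrightarrow> small \<eta> (exits (U n) z)" if \<eta>: "0 < \<eta>" for \<eta>
  proof -
    obtain \<delta> where \<delta>: "0 < \<delta>" "\<And>h (z :: real^('n option)). h \<in> C1_range_on \<omega> M \<Longrightarrow> (\<integral>\<^sup>+y. slope \<omega> h y \<partial>lborel) \<le> ennreal C \<Longrightarrow> norm z \<le> \<delta>
      \<Longrightarrow> small \<eta> (exits (subgraph \<omega> h) z)"
      using subgraph_short_exit_uniformly_small[OF \<omega> C M \<eta>] by blast
    show ?thesis unfolding U_def using \<delta>(1) \<delta>(2)[OF hC surf] by blast
  qed
  have base: "\<exists>R. \<forall>n. small \<eta> {x. height x < 0 \<and> R < norm (v n x)}" if \<eta>: "0 < \<eta>" for \<eta>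
  proof -
    obtain R where R: "small \<eta> {x \<in> ?Z. R < norm (u0 x)}"
      using Lp_small_superlevel[OF u0L p Zl \<Omega>b(2) \<eta>] by blast
    have "small \<eta> {x. height x < 0 \<and> max R 0 < norm (v n x)}" for n
    proof -
      have ae: "AE x in lborel. x \<in> ?Z \<longrightarrow> v n x = u0 x"
        using ub'[of n] v\<Omega>[of n] by eventually_elim (use M in \<open>auto simp: cylinder_def\<close>)
      show ?thesis
      proof (rule small_mono[OF small_AE_cong[OF ae R] _ order_refl], rule subsetI)
        fix x assume x: "x \<in> {x. height x < 0 \<and> max R 0 < norm (v n x)}"
        then have "x \<in> U n" using v0[of x n] by auto
        then have "x \<in> ?Z" using x by (auto simp: U_def subgraph_def cylinder_def)
        then show "x \<in> {x. \<not> (x \<in> ?Z \<longrightarrow> v n x = u0 x) \<or> x \<in> {x \<in> ?Z. R < norm (u0 x)}}" using x by auto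
      qed
    qed
    then show ?thesis by blast
  qed
  have tight: "\<exists>R. \<forall>n. small \<eta> {x. R < norm (v n x)}" if "0 < \<eta>" for \<eta>
    by (rule subgraph_tightness[OF v0 E0 seg bad_tilt base Utop that])
  have quot: "\<exists>\<rho>>0. \<forall>n y. norm y \<le> \<rho> \<longrightarrow> small \<eta> {x. \<delta> * norm y < \<bar>(v n (x + y) - v n x) \<bullet> y\<bar>}" if "0 < \<eta>" "0 < \<delta>" for \<eta> \<delta>
    by (rule difference_quotient_small[OF v0 E0 seg bad_short that])
  have trans: "\<exists>\<rho>>0. \<forall>n y. norm y < \<rho> \<longrightarrow> small \<eta> {x. \<delta> < norm (v n (x + y) - v n x)}" if "0 < \<eta>" "0 < \<delta>" for \<eta> \<delta>
    by (rule translation_small[OF translation_component_small[OF quot tight] that])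
  have vQ: "v n x = 0" if "x \<notin> ?\<Omega>" for n x using that U\<Omega> v0 by blast

  obtain r1 h where r1: "strict_mono (r1 :: nat \<Rightarrow> nat)" and h: "h \<in> L1_range_on \<omega> M" "tends_L1_on \<omega> (\<lambda>i. hs (r1 i)) h"
    by (rule graph_compactness[OF \<omega> C M hC surf])
  have tight1: "\<exists>R. \<forall>n. small \<eta> {x. R < norm (v (r1 n) x)}" if "0 < \<eta>" for \<eta>
    using tight[OF that] by blast
  have trans1: "\<exists>\<rho>>0. \<forall>n y. norm y < \<rho> \<longrightarrow> small \<eta> {x. \<delta> < norm (v (r1 n) (x + y) - v (r1 n) x)}" if "0 < \<eta>" "0 < \<delta>" for \<eta> \<delta>
    using trans[OF that] by blast
  obtain r2 u where r2: "strict_mono (r2 :: nat \<Rightarrow> nat)" and u: "u \<in> borel_measurable borel" "AE x in lborel. (\<lambda>i. v (r1 (r2 i)) x) \<longlonglongrightarrow> u x"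
    by (rule measure_compactness[of "\<lambda>n. v (r1 n)", OF v(1) bounded_cylinder[OF \<omega>(2)] vQ tight1 trans1])
  show ?thesis
  proof
    show "strict_mono (r1 \<circ> r2)" using r1 r2 by (rule strict_mono_o)
    show "u \<in> L0_on ?\<Omega>"
    proof -
      have "u \<in> borel_measurable lborel" using u(1) by simp
      then have "u \<in> borel_measurable lebesgue" by (rule measurable_completion)
      then show ?thesis unfolding L0_on_def by (rule measurable_restrict_space1)
    qed
    show "h \<in> L1_range_on \<omega> M" by fact
    have "emeasure lborel ?\<Omega> < \<infinity>"
    proof -
      have "emeasure lebesgue ?\<Omega> \<noteq> top" by (rule fmeasurableD2[OF cylinder_lmeasurable[OF \<omega>]]) (use M in simp)
      then show ?thesis using \<Omega>b(1) by (simp add: less_top)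
    qed
    then show "tends_in_measure_on ?\<Omega> (\<lambda>i. us ((r1 \<circ> r2) i)) u"
      by (rule AE_convergent_imp_tends_in_measure[OF \<Omega>b(1) _ v(1) u(1)]) (use v\<Omega> u(2) in auto)
    show "tends_L1_on \<omega> (\<lambda>i. hs ((r1 \<circ> r2) i)) h"
      using LIMSEQ_subseq_LIMSEQ[OF h(2)[unfolded tends_L1_on_def] r2] by (simp add: tends_L1_on_def o_def)
  qed
qed

section \<open>Existence of minimizers\<close>

text \<open>Along an approximating sequence in the definition of the relaxed energy, the energy is
frequently below \<open>c\<close>, whereas the profiles are eventually close to \<open>h\<close>.\<close>

lemma G_relaxed_attained_along:
  assumes "G_relaxed \<omega> M p f u0 u h < c" "0 < \<epsilon>"
  obtains u' h' where "G_functional \<omega> M p f u0 u' h' \<le> c" "u' \<in> L0_on (cylinder \<omega> (-1) (M + 1))" "h' \<in> L1_range_on \<omega> M"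
    "(LINT y|lebesgue_on \<omega>. \<bar>h' y - h y\<bar>) < \<epsilon>"
proof -
  obtain us hs where *: "liminf (\<lambda>n. G_functional \<omega> M p f u0 (us n) (hs n)) < c"
    "\<And>n. us n \<in> L0_on (cylinder \<omega> (-1) (M + 1))" "\<And>n. hs n \<in> L1_range_on \<omega> M" "tends_L1_on \<omega> hs h"
    using assms(1) unfolding G_relaxed_def Inf_less_iff by blast
  have "\<exists>\<^sub>F n in sequentially. G_functional \<omega> M p f u0 (us n) (hs n) < c"
  proof (rule ccontr)
    assume "\<not> ?thesis"
    then have "\<forall>\<^sub>F n in sequentially. c \<le> G_functional \<omega> M p f u0 (us n) (hs n)"
      by (simp add: not_frequently not_less)
    then have "c \<le> liminf (\<lambda>n. G_functional \<omega> M p f u0 (us n) (hs n))" by (rule Liminf_bounded)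
    then show False using *(1) by simp
  qed
  moreover have "\<forall>\<^sub>F n in sequentially. (LINT y|lebesgue_on \<omega>. \<bar>hs n y - h y\<bar>) < \<epsilon>"
    using *(4) assms(2) unfolding tends_L1_on_def by (rule order_tendstoD)
  then have "\<forall>\<^sub>F n in sequentially. G_functional \<omega> M p f u0 (us n) (hs n) < c \<longrightarrow>
      G_functional \<omega> M p f u0 (us n) (hs n) < c \<and> (LINT y|lebesgue_on \<omega>. \<bar>hs n y - h y\<bar>) < \<epsilon>"
    by eventually_elim simp
  ultimately have "\<exists>\<^sub>F n in sequentially. G_functional \<omega> M p f u0 (us n) (hs n) < c \<and> (LINT y|lebesgue_on \<omega>. \<bar>hs n y - h y\<bar>) < \<epsilon>"
    by (rule frequently_rev_mp)
  then obtain n where "G_functional \<omega> M p f u0 (us n) (hs n) < c" "(LINT y|lebesgue_on \<omega>. \<bar>hs n y - h y\<bar>) < \<epsilon>"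
    using frequently_ex by blast
  then show ?thesis using that *(2,3) less_imp_le by blast
qed

lemma L1_range_integral_diff:
  assumes "h \<in> L1_range_on \<omega> M" "k \<in> L1_range_on \<omega> M"
  shows "\<bar>(LINT y|lebesgue_on \<omega>. h y) - (LINT y|lebesgue_on \<omega>. k y)\<bar> \<le> (LINT y|lebesgue_on \<omega>. \<bar>h y - k y\<bar>)"
proof -
  have i: "integrable (lebesgue_on \<omega>) h" "integrable (lebesgue_on \<omega>) k" using assms by (auto simp: L1_range_on_def)
  have "\<bar>LINT y|lebesgue_on \<omega>. h y - k y\<bar> \<le> (LINT y|lebesgue_on \<omega>. \<bar>h y - k y\<bar>)"
    by (rule integral_abs_bound)
  then show ?thesis using i by simp
qed

theorem mainTheorem6:
  fixes \<omega> :: "(real^'n::finite) set"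
    and M p m c1 c2 :: real
    and u0 :: "real^('n option) \<Rightarrow> real^('n option)"
    and f :: "real^('n option)^('n option) \<Rightarrow> real"
  assumes "bounded \<omega>" and "lipschitz_domain \<omega>"
    and "0 < M" and "1 < p"
    and "u0 \<in> sobolev p (cylinder \<omega> (-1) 0)"
    and "\<And>\<zeta>. 0 \<le> f \<zeta>" and "convex_on UNIV f" and "f 0 = 0"
    and "0 < c1" and "0 < c2"
    and "\<And>\<zeta>. c1 * norm (transpose \<zeta> + \<zeta>) powr p \<le> f \<zeta>"
    and "\<And>\<zeta>. f \<zeta> \<le> c2 * (norm (transpose \<zeta> + \<zeta>) powr p + 1)"
    and "0 < m" and "m < M * measure lebesgue \<omega>"
  shows "\<exists>u h. admissible \<omega> M m u h \<and>
    (\<forall>v k. admissible \<omega> M m v k \<longrightarrow> G_relaxed \<omega> M p f u0 u h \<le> G_relaxed \<omega> M p f u0 v k)"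
proof -
  let ?\<Omega> = "cylinder \<omega> (-1) (M + 1) :: (real^('n option)) set"
  let ?G = "G_relaxed \<omega> M p f u0"
  have \<omega>: "open \<omega>" using assms(2) by (simp add: lipschitz_domain_def)
  have vol: "emeasure lebesgue (subgraph_pos \<omega> h) = ennreal m \<longleftrightarrow> (LINT y|lebesgue_on \<omega>. h y) = m"
    if "h \<in> L1_range_on \<omega> M" for h
  proof -
    have "0 \<le> (LINT y|lebesgue_on \<omega>. h y)"
      using that by (intro Bochner_Integration.integral_nonneg) (auto simp: L1_range_on_def space_restrict_space)
    then show ?thesis using \<open>0 < m\<close> by (simp add: emeasure_subgraph_pos[OF \<omega> that])
  qed
  have \<omega>m: "\<omega> \<in> lmeasurable" using \<omega> assms(1) by (simp add: lmeasurable_open)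
  have pos: "0 < measure lebesgue \<omega>"
  proof (rule ccontr)
    assume "\<not> 0 < measure lebesgue \<omega>"
    then have "measure lebesgue \<omega> = 0" using measure_nonneg[of lebesgue \<omega>] by linarith
    then show False using assms(13,14) by simp
  qed
  have ex: "\<exists>u h. admissible \<omega> M m u h"
  proof -
    \<comment> \<open>A flat film of the prescribed volume.\<close>
    let ?c = "m / measure lebesgue \<omega>"
    have c: "?c \<in> {0..M}" using pos assms(13,14) by (simp add: divide_le_eq)
    have em: "emeasure (lebesgue_on \<omega>) (space (lebesgue_on \<omega>)) = ennreal (measure lebesgue \<omega>)"
      using \<omega>m \<omega> by (simp add: emeasure_restrict_space emeasure_eq_measure2)
    then have fm: "finite_measure (lebesgue_on \<omega>)" by (intro finite_measureI) simp
    have h: "(\<lambda>_. ?c) \<in> L1_range_on \<omega> M"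
      using c unfolding L1_range_on_def by (auto intro: finite_measure.integrable_const[OF fm])
    have "measure (lebesgue_on \<omega>) (space (lebesgue_on \<omega>)) = measure lebesgue \<omega>"
      using em by (simp add: measure_def)
    then have "(LINT y|lebesgue_on \<omega>. ?c) = m" using pos by simp
    then have "admissible \<omega> M m (\<lambda>_. 0) (\<lambda>_. ?c)"
      using h vol[OF h] by (simp add: admissible_def L0_on_def)
    then show ?thesis by blast
  qed
  define I where "I = Inf {?G v k | v k. admissible \<omega> M m v k}"
  have Ile: "I \<le> ?G v k" if "admissible \<omega> M m v k" for v k
    unfolding I_def using that by (intro Inf_lower) blast
  show ?thesis
  proof (cases "I = \<infinity>")
    case True
    obtain u h where uh: "admissible \<omega> M m u h" using ex by blast
    have "?G v k = \<infinity>" if "admissible \<omega> M m v k" for v k using Ile[OF that] True by (simp add: top_unique)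
    then show ?thesis using uh by (metis order_refl)
  next
    case False
    define I' where "I' = enn2real I"
    have I': "I = ennreal I'" "0 \<le> I'" using False by (auto simp: I'_def less_top)
    have "\<exists>u h. G_functional \<omega> M p f u0 u h \<le> ennreal (I' + 1 / real (Suc n)) \<and> u \<in> L0_on ?\<Omega> \<and> h \<in> L1_range_on \<omega> M
       \<and> \<bar>(LINT y|lebesgue_on \<omega>. h y) - m\<bar> < 1 / real (Suc n)" for n
    proof -
      have "I < ennreal (I' + 1 / real (Suc n))" unfolding I' using I'(2) add_nonneg_pos[of I' "1 / real (Suc n)"] by (intro ennreal_lessI) auto
      then obtain v k where vk: "admissible \<omega> M m v k" "?G v k < ennreal (I' + 1 / real (Suc n))"
        unfolding I_def Inf_less_iff by blast
      have k: "k \<in> L1_range_on \<omega> M" "(LINT y|lebesgue_on \<omega>. k y) = m"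
        using vk(1) vol[of k] by (auto simp: admissible_def)
      have n: "0 < 1 / real (Suc n)" by simp
      obtain u h where uh: "G_functional \<omega> M p f u0 u h \<le> ennreal (I' + 1 / real (Suc n))" "u \<in> L0_on ?\<Omega>" "h \<in> L1_range_on \<omega> M"
        "(LINT y|lebesgue_on \<omega>. \<bar>h y - k y\<bar>) < 1 / real (Suc n)"
        using G_relaxed_attained_along[OF vk(2) n] by blast
      have "\<bar>(LINT y|lebesgue_on \<omega>. h y) - m\<bar> < 1 / real (Suc n)"
        using L1_range_integral_diff[OF uh(3) k(1)] uh(4) k(2) by linarith
      then show ?thesis using uh by blast
    qed
    then have "\<forall>n. \<exists>q. G_functional \<omega> M p f u0 (fst q) (snd q) \<le> ennreal (I' + 1 / real (Suc n)) \<and> fst q \<in> L0_on ?\<Omega> \<and> snd q \<in> L1_range_on \<omega> M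
       \<and> \<bar>(LINT y|lebesgue_on \<omega>. snd q y) - m\<bar> < 1 / real (Suc n)"
      by simp
    from choice[OF this] obtain q where q: "\<forall>n. G_functional \<omega> M p f u0 (fst (q n)) (snd (q n)) \<le> ennreal (I' + 1 / real (Suc n)) \<and> fst (q n) \<in> L0_on ?\<Omega>
       \<and> snd (q n) \<in> L1_range_on \<omega> M \<and> \<bar>(LINT y|lebesgue_on \<omega>. snd (q n) y) - m\<bar> < 1 / real (Suc n)" ..
    define us where "us n = fst (q n)" for n
    define hs where "hs n = snd (q n)" for n
    have uh: "G_functional \<omega> M p f u0 (us n) (hs n) \<le> ennreal (I' + 1 / real (Suc n))"
      "us n \<in> L0_on ?\<Omega>" "hs n \<in> L1_range_on \<omega> M" "\<bar>(LINT y|lebesgue_on \<omega>. hs n y) - m\<bar> < 1 / real (Suc n)" for n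
      using q unfolding us_def hs_def by blast+
    have G: "G_functional \<omega> M p f u0 (us n) (hs n) \<le> ennreal (I' + 1)" for n
    proof (rule order_trans[OF uh(1)], rule ennreal_leI)
      show "I' + 1 / real (Suc n) \<le> I' + 1" by simp
    qed
    have C: "0 \<le> I' + 1" using I'(2) by simp
    obtain r u h where r: "strict_mono (r :: nat \<Rightarrow> nat)" and u: "u \<in> L0_on ?\<Omega>" and h: "h \<in> L1_range_on \<omega> M"
      and lim: "tends_in_measure_on ?\<Omega> (\<lambda>i. us (r i)) u" "tends_L1_on \<omega> (\<lambda>i. hs (r i)) h"
      by (rule epitaxy_compactness[OF \<omega> assms(1,3,4,9,5,11) G C])
    have "(\<lambda>n. 1 / real (Suc n)) \<longlonglongrightarrow> 0" by (rule LIMSEQ_Suc[OF lim_1_over_n])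
    from LIMSEQ_subseq_LIMSEQ[OF this r] have r0: "(\<lambda>i. 1 / real (Suc (r i))) \<longlonglongrightarrow> 0" by (simp add: o_def)
    have "(LINT y|lebesgue_on \<omega>. h y) = m"
    proof -
      have "(\<lambda>i. (LINT y|lebesgue_on \<omega>. hs (r i) y) - (LINT y|lebesgue_on \<omega>. h y)) \<longlonglongrightarrow> 0"
      proof (rule Lim_null_comparison)
        show "\<forall>\<^sub>F i in sequentially. norm ((LINT y|lebesgue_on \<omega>. hs (r i) y) - (LINT y|lebesgue_on \<omega>. h y)) \<le> (LINT y|lebesgue_on \<omega>. \<bar>hs (r i) y - h y\<bar>)"
          using L1_range_integral_diff[OF uh(3) h] by simp
        show "(\<lambda>i. LINT y|lebesgue_on \<omega>. \<bar>hs (r i) y - h y\<bar>) \<longlonglongrightarrow> 0" using lim(2) by (simp add: tends_L1_on_def)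
      qed
      moreover have "(\<lambda>i. (LINT y|lebesgue_on \<omega>. hs (r i) y) - m) \<longlonglongrightarrow> 0"
      proof (rule Lim_null_comparison[OF _ r0])
        show "\<forall>\<^sub>F i in sequentially. norm ((LINT y|lebesgue_on \<omega>. hs (r i) y) - m) \<le> 1 / real (Suc (r i))"
          using uh(4) by (intro always_eventually allI) (simp add: less_imp_le)
      qed
      ultimately have "(\<lambda>i. ((LINT y|lebesgue_on \<omega>. hs (r i) y) - m) - ((LINT y|lebesgue_on \<omega>. hs (r i) y) - (LINT y|lebesgue_on \<omega>. h y))) \<longlonglongrightarrow> 0 - 0"
        by (intro tendsto_diff)
      then show ?thesis by (simp add: LIMSEQ_const_iff)
    qed
    then have adm: "admissible \<omega> M m u h" using u h vol[OF h] by (simp add: admissible_def)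
    have "?G u h \<le> liminf (\<lambda>i. G_functional \<omega> M p f u0 (us (r i)) (hs (r i)))"
      unfolding G_relaxed_def
    proof (rule Inf_lower, rule CollectI, intro exI conjI allI)
      show "liminf (\<lambda>i. G_functional \<omega> M p f u0 (us (r i)) (hs (r i))) = liminf (\<lambda>n. G_functional \<omega> M p f u0 ((\<lambda>i. us (r i)) n) ((\<lambda>i. hs (r i)) n))"
        by simp
    qed (use uh(2,3) lim in auto)
    also have "\<dots> \<le> liminf (\<lambda>i. ennreal (I' + 1 / real (Suc (r i))))"
      by (intro Liminf_mono always_eventually allI uh(1))
    also have "\<dots> = ennreal (I' + 0)"
      by (intro lim_imp_Liminf tendsto_ennrealI tendsto_add tendsto_const r0) simp
    finally have "?G u h \<le> I" using I'(1) by simp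
    then show ?thesis using adm Ile order_trans by blast
  qed
qed

end
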